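(* Each of the following Banach spaces has strongly subdifferentiable norm. (a) $\widetilde\otimes_{\pi_s}^{2,s}X$, whenever $X$ is a complex Banach sequence lattice such that $c_{00}$ is dense in $X$ and $X$ is $p$-convex with constant one for some $p>2$. (b) $X\widetilde\otimes_\pi Y$, whenever $X$ and $Y$ are complex Banach sequence lattices such that $c_{00}$ is dense in both, and $X$ and $Y$ are $p$-convex with constant one for some $p>2$. (c) $X\widetilde\otimes_\pi Y$, whenever $X$ and $Y$ are Banach sequence lattices over $\mathbb{K}\in\{\mathbb{R},\mathbb{C}\}$ such that: $X$ is $p$-convex with constant one; $Y$ is $s$-convex with constant one; $Y^*$ has modulus of convexity of power type $q$ with $2\le q<p$; and $X^*$ has modulus of convexity of power type $r$ with $2\le r<s$.
   Context: The norm of a Banach space $E$ is strongly subdifferentiable at $x\in S_E$ if the one-sided limit $\lim_{t\to0^+}\frac{\|x+th\|-1}{t}$ exists uniformly for $h\in B_E$; the norm of $E$ is strongly subdifferentiable if this holds at every $x\in S_E$. A Banach sequence lattice over $\mathbb{K}$ is a linear subspace $X\subseteq\mathbb{K}^{\mathbb{N}}$ containing $c_{00}$ (the finitely supported sequences) which is a Banach space under a norm $\|\cdot\|_X$ and such that whenever $x\in X$, $y\in\mathbb{K}^{\mathbb{N}}$ and $|y(k)|\le|x(k)|$ for every $k$, then $y\in X$ and $\|y\|_X\le\|x\|_X$. For $1\le r<\infty$, $X$ is $r$-convex with constant one if $\big\|\big(\sum_{j=1}^m|x^j|^r\big)^{1/r}\big\|_X\le\big(\sum_{j=1}^m\|x^j\|_X^r\big)^{1/r}$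 for every finite family $x^1,\dots,x^m\in X$ (operations coordinatewise). The modulus of convexity of a Banach space $E$ is $\delta_E(\varepsilon)=\inf\{1-\tfrac12\|x+y\|:x,y\in B_E,\ \|x-y\|\ge\varepsilon\}$, $0<\varepsilon\le2$; $E$ has modulus of convexity of power type $q$ (with $q\ge2$) if there is $C>0$ with $\delta_E(\varepsilon)\ge C\varepsilon^q$ for every $0<\varepsilon\le2$. $X\widetilde\otimes_\pi Y$ is the completed projective tensor product. $\widetilde\otimes_{\pi_s}^{2,s}X$ is the completed symmetric projective tensor product, i.e. the completion of the span of $\{x\otimes x:x\in X\}$ under $\pi_s(u)=\inf\{\sum_j|\lambda_j|\|x_j\|^2:u=\sum_j\lambda_jx_j\otimes x_j\}$; its dual is isometrically the space of continuous $2$-homogeneous polynomials on $X$ with the sup norm on $B_X$. *)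

theory Defs
  imports "HOL-Analysis.Analysis"
begin

section \<open>Normed spaces on a carrier, over a scalar field that is a type\<close>

record ('k, 'v) normed_structure =
  vcarrier :: "'v set"
  vadd :: "'v \<Rightarrow> 'v \<Rightarrow> 'v"
  vzero :: "'v"
  vscale :: "'k \<Rightarrow> 'v \<Rightarrow> 'v"
  vnorm :: "'v \<Rightarrow> real"

definition vdiff :: "('k::real_normed_field, 'v) normed_structure \<Rightarrow> 'v \<Rightarrow> 'v \<Rightarrow> 'v" where
  "vdiff E x y = vadd E x (vscale E (- 1) y)"

definition unit_ball :: "('k::real_normed_field, 'v) normed_structure \<Rightarrow> 'v set" where
  "unit_ball E = {x \<in> vcarrier E. vnorm E x \<le> 1}"

definition unit_sphere :: "('k::real_normed_field, 'v) normed_structure \<Rightarrow> 'v set" where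
  "unit_sphere E = {x \<in> vcarrier E. vnorm E x = 1}"

definition cauchy_in :: "('k::real_normed_field, 'v) normed_structure \<Rightarrow> (nat \<Rightarrow> 'v) \<Rightarrow> bool" where
  "cauchy_in E u \<longleftrightarrow> (\<forall>n. u n \<in> vcarrier E) \<and>
     (\<forall>\<epsilon>>0. \<exists>M. \<forall>m\<ge>M. \<forall>n\<ge>M. vnorm E (vdiff E (u m) (u n)) < \<epsilon>)"

locale normed_space =
  fixes E :: "('k::real_normed_field, 'v) normed_structure"
  assumes zero_closed: "vzero E \<in> vcarrier E"
    and add_closed: "\<lbrakk>x \<in> vcarrier E; y \<in> vcarrier E\<rbrakk> \<Longrightarrow> vadd E x y \<in> vcarrier E"
    and scale_closed: "x \<in> vcarrier E \<Longrightarrow> vscale E c x \<in> vcarrier E"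
    and add_assoc: "\<lbrakk>x \<in> vcarrier E; y \<in> vcarrier E; z \<in> vcarrier E\<rbrakk>
          \<Longrightarrow> vadd E (vadd E x y) z = vadd E x (vadd E y z)"
    and add_commute: "\<lbrakk>x \<in> vcarrier E; y \<in> vcarrier E\<rbrakk> \<Longrightarrow> vadd E x y = vadd E y x"
    and add_zero: "x \<in> vcarrier E \<Longrightarrow> vadd E x (vzero E) = x"
    and add_inverse: "x \<in> vcarrier E \<Longrightarrow> vadd E x (vscale E (- 1) x) = vzero E"
    and scale_one: "x \<in> vcarrier E \<Longrightarrow> vscale E 1 x = x"
    and scale_scale: "x \<in> vcarrier E \<Longrightarrow> vscale E a (vscale E b x) = vscale E (a * b) x"
    and scale_add_left: "x \<in> vcarrier E
          \<Longrightarrow> vscale E (a + b) x = vadd E (vscale E a x) (vscale E b x)"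
    and scale_add_right: "\<lbrakk>x \<in> vcarrier E; y \<in> vcarrier E\<rbrakk>
          \<Longrightarrow> vscale E a (vadd E x y) = vadd E (vscale E a x) (vscale E a y)"
    and norm_nonneg: "x \<in> vcarrier E \<Longrightarrow> 0 \<le> vnorm E x"
    and norm_eq_zero: "x \<in> vcarrier E \<Longrightarrow> vnorm E x = 0 \<longleftrightarrow> x = vzero E"
    and norm_scale: "x \<in> vcarrier E \<Longrightarrow> vnorm E (vscale E c x) = norm c * vnorm E x"
    and norm_triangle: "\<lbrakk>x \<in> vcarrier E; y \<in> vcarrier E\<rbrakk>
          \<Longrightarrow> vnorm E (vadd E x y) \<le> vnorm E x + vnorm E y"

locale banach_space = normed_space +
  assumes complete: "cauchy_in E u
          \<Longrightarrow> \<exists>x\<in>vcarrier E. (\<lambda>n. vnorm E (vdiff E (u n) x)) \<longlonglongrightarrow> 0"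

definition strongly_subdifferentiable ::
    "('k::real_normed_field, 'v) normed_structure \<Rightarrow> bool" where
  "strongly_subdifferentiable E \<longleftrightarrow>
     (\<forall>x\<in>unit_sphere E. \<exists>L.
        uniform_limit (unit_ball E)
          (\<lambda>t h. (vnorm E (vadd E x (vscale E (of_real t) h)) - 1) / t) L (at_right 0))"

text \<open>The values are extended reals so that the infimum of the empty set
  (which occurs only for the zero space) is \<open>\<infinity>\<close>.\<close>

definition modulus_of_convexity ::
    "('k::real_normed_field, 'v) normed_structure \<Rightarrow> real \<Rightarrow> ereal" where
  "modulus_of_convexity E \<epsilon> =
     Inf {ereal (1 - vnorm E (vadd E x y) / 2) | x y.
            x \<in> unit_ball E \<and> y \<in> unit_ball E \<and> \<epsilon> \<le> vnorm E (vdiff E x y)}"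

definition has_convexity_power_type ::
    "real \<Rightarrow> ('k::real_normed_field, 'v) normed_structure \<Rightarrow> bool" where
  "has_convexity_power_type q E \<longleftrightarrow>
     2 \<le> q \<and> (\<exists>C>0. \<forall>\<epsilon>. 0 < \<epsilon> \<and> \<epsilon> \<le> 2 \<longrightarrow> ereal (C * \<epsilon> powr q) \<le> modulus_of_convexity E \<epsilon>)"


section \<open>Spaces of scalar functions, duals, Banach sequence lattices\<close>

definition function_space ::
    "('i \<Rightarrow> 'k) set \<Rightarrow> (('i \<Rightarrow> 'k) \<Rightarrow> real) \<Rightarrow> ('k::real_normed_field, 'i \<Rightarrow> 'k) normed_structure"
  where
  "function_space S N =
     \<lparr>vcarrier = S,
      vadd = (\<lambda>x y k. x k + y k),
      vzero = (\<lambda>k. 0),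
      vscale = (\<lambda>c x k. c * x k),
      vnorm = N\<rparr>"

text \<open>Functionals are set to \<open>0\<close> outside the carrier, so that each one is represented once.\<close>

definition dual_space ::
    "('k::real_normed_field, 'v) normed_structure \<Rightarrow> ('k, 'v \<Rightarrow> 'k) normed_structure" where
  "dual_space E = function_space
     {f. (\<forall>x\<in>vcarrier E. \<forall>y\<in>vcarrier E. f (vadd E x y) = f x + f y) \<and>
         (\<forall>c. \<forall>x\<in>vcarrier E. f (vscale E c x) = c * f x) \<and>
         (\<exists>B. \<forall>x\<in>vcarrier E. norm (f x) \<le> B * vnorm E x) \<and>
         (\<forall>x. x \<notin> vcarrier E \<longrightarrow> f x = 0)}
     (\<lambda>f. SUP x\<in>unit_ball E. norm (f x))"

definition c00 :: "(nat \<Rightarrow> 'k::real_normed_field) set" where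
  "c00 = {x. finite {k. x k \<noteq> 0}}"

locale banach_sequence_lattice = banach_space X
  for X :: "('k::real_normed_field, nat \<Rightarrow> 'k) normed_structure" +
  assumes coordinatewise: "X = function_space (vcarrier X) (vnorm X)"
    and c00_subset: "c00 \<subseteq> vcarrier X"
    and solid: "\<lbrakk>x \<in> vcarrier X; \<And>k. norm (y k) \<le> norm (x k)\<rbrakk>
          \<Longrightarrow> y \<in> vcarrier X \<and> vnorm X y \<le> vnorm X x"

definition c00_dense :: "('k::real_normed_field, nat \<Rightarrow> 'k) normed_structure \<Rightarrow> bool" where
  "c00_dense X \<longleftrightarrow> (\<forall>x\<in>vcarrier X. \<forall>\<epsilon>>0. \<exists>y\<in>c00. vnorm X (vdiff X x y) < \<epsilon>)"

definition convex_const_one ::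
    "real \<Rightarrow> ('k::real_normed_field, nat \<Rightarrow> 'k) normed_structure \<Rightarrow> bool" where
  "convex_const_one r X \<longleftrightarrow> 1 \<le> r \<and>
     (\<forall>m (x :: nat \<Rightarrow> nat \<Rightarrow> 'k). (\<forall>j<m. x j \<in> vcarrier X) \<longrightarrow>
        vnorm X (\<lambda>k. of_real ((\<Sum>j<m. norm (x j k) powr r) powr (1 / r)))
          \<le> (\<Sum>j<m. vnorm X (x j) powr r) powr (1 / r))"


section \<open>Tensor products\<close>

definition bilinear_form ::
    "('k::real_normed_field, 'v) normed_structure \<Rightarrow> ('k, 'w) normed_structure
     \<Rightarrow> ('v \<Rightarrow> 'w \<Rightarrow> 'k) \<Rightarrow> bool" where
  "bilinear_form E F A \<longleftrightarrow>
     (\<forall>x\<in>vcarrier E. \<forall>x'\<in>vcarrier E. \<forall>y\<in>vcarrier F. A (vadd E x x') y = A x y + A x' y) \<and>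
     (\<forall>x\<in>vcarrier E. \<forall>y\<in>vcarrier F. \<forall>y'\<in>vcarrier F. A x (vadd F y y') = A x y + A x y') \<and>
     (\<forall>c. \<forall>x\<in>vcarrier E. \<forall>y\<in>vcarrier F. A (vscale E c x) y = c * A x y) \<and>
     (\<forall>c. \<forall>x\<in>vcarrier E. \<forall>y\<in>vcarrier F. A x (vscale F c y) = c * A x y)"

text \<open>The algebraic tensor product is realised, as usual, inside the algebraic dual of the
  space of all (not necessarily continuous) bilinear forms: the elementary tensor of \<open>x\<close> and
  \<open>y\<close> is evaluation at \<open>(x, y)\<close>. Values at arguments that are not bilinear forms
  are set to \<open>0\<close>.\<close>

definition tensor ::
    "('k::real_normed_field, 'v) normed_structure \<Rightarrow> ('k, 'w) normed_structure
     \<Rightarrow> 'v \<Rightarrow> 'w \<Rightarrow> (('v \<Rightarrow> 'w \<Rightarrow> 'k) \<Rightarrow> 'k)" where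
  "tensor E F x y = (\<lambda>A. if bilinear_form E F A then A x y else 0)"

definition tensor_rep ::
    "('k::real_normed_field, 'v) normed_structure \<Rightarrow> ('k, 'w) normed_structure
     \<Rightarrow> (('v \<Rightarrow> 'w \<Rightarrow> 'k) \<Rightarrow> 'k) \<Rightarrow> nat \<Rightarrow> (nat \<Rightarrow> 'v) \<Rightarrow> (nat \<Rightarrow> 'w) \<Rightarrow> bool" where
  "tensor_rep E F u n x y \<longleftrightarrow>
     (\<forall>j<n. x j \<in> vcarrier E \<and> y j \<in> vcarrier F) \<and>
     u = (\<lambda>A. \<Sum>j<n. tensor E F (x j) (y j) A)"

definition projective_tensor ::
    "('k::real_normed_field, 'v) normed_structure \<Rightarrow> ('k, 'w) normed_structure
     \<Rightarrow> ('k, ('v \<Rightarrow> 'w \<Rightarrow> 'k) \<Rightarrow> 'k) normed_structure" where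
  "projective_tensor E F = function_space
     {u. \<exists>n x y. tensor_rep E F u n x y}
     (\<lambda>u. Inf {\<Sum>j<n. vnorm E (x j) * vnorm F (y j) | n x y. tensor_rep E F u n x y})"

definition sym_tensor_rep ::
    "('k::real_normed_field, 'v) normed_structure
     \<Rightarrow> (('v \<Rightarrow> 'v \<Rightarrow> 'k) \<Rightarrow> 'k) \<Rightarrow> nat \<Rightarrow> (nat \<Rightarrow> 'k) \<Rightarrow> (nat \<Rightarrow> 'v) \<Rightarrow> bool" where
  "sym_tensor_rep E u n a x \<longleftrightarrow>
     (\<forall>j<n. x j \<in> vcarrier E) \<and>
     u = (\<lambda>A. \<Sum>j<n. a j * tensor E E (x j) (x j) A)"

definition sym_projective_tensor ::
    "('k::real_normed_field, 'v) normed_structure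
     \<Rightarrow> ('k, ('v \<Rightarrow> 'v \<Rightarrow> 'k) \<Rightarrow> 'k) normed_structure" where
  "sym_projective_tensor E = function_space
     {u. \<exists>n a x. sym_tensor_rep E u n a x}
     (\<lambda>u. Inf {\<Sum>j<n. norm (a j) * (vnorm E (x j))\<^sup>2 | n a x. sym_tensor_rep E u n a x})"


section \<open>Completion: Cauchy sequences modulo null sequences\<close>

definition cauchy_rel ::
    "('k::real_normed_field, 'v) normed_structure \<Rightarrow> ((nat \<Rightarrow> 'v) \<times> (nat \<Rightarrow> 'v)) set" where
  "cauchy_rel E = {(u, v). cauchy_in E u \<and> cauchy_in E v \<and>
                           (\<lambda>n. vnorm E (vdiff E (u n) (v n))) \<longlonglongrightarrow> 0}"

definition completion ::
    "('k::real_normed_field, 'v) normed_structure \<Rightarrow> ('k, (nat \<Rightarrow> 'v) set) normed_structure"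
  where
  "completion E =
     \<lparr>vcarrier = {u. cauchy_in E u} // cauchy_rel E,
      vadd = (\<lambda>P Q. \<Union>u\<in>P. \<Union>v\<in>Q. cauchy_rel E `` {\<lambda>n. vadd E (u n) (v n)}),
      vzero = cauchy_rel E `` {\<lambda>n. vzero E},
      vscale = (\<lambda>c P. \<Union>u\<in>P. cauchy_rel E `` {\<lambda>n. vscale E c (u n)}),
      vnorm = (\<lambda>P. the_elem ((\<lambda>u. lim (\<lambda>n. vnorm E (u n))) ` P))\<rparr>"

abbreviation completed_projective_tensor ::
    "('k::real_normed_field, 'v) normed_structure \<Rightarrow> ('k, 'w) normed_structure
     \<Rightarrow> ('k, (nat \<Rightarrow> ('v \<Rightarrow> 'w \<Rightarrow> 'k) \<Rightarrow> 'k) set) normed_structure" where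
  "completed_projective_tensor E F \<equiv> completion (projective_tensor E F)"

abbreviation completed_sym_projective_tensor ::
    "('k::real_normed_field, 'v) normed_structure
     \<Rightarrow> ('k, (nat \<Rightarrow> ('v \<Rightarrow> 'v \<Rightarrow> 'k) \<Rightarrow> 'k) set) normed_structure" where
  "completed_sym_projective_tensor E \<equiv> completion (sym_projective_tensor E)"

end

theory Submission
  imports Defs "HOL-Library.Function_Algebras"
begin

text \<open>Suppose that the norm of a tensor product is not strongly subdifferentiable at a tensor \<open>u\<close> of
  norm one. Functionals norming \<open>u + t\<^sub>n h\<^sub>n\<close> for bad directions \<open>h\<^sub>n\<close> and \<open>t\<^sub>n \<rightarrow> 0\<close> almost norm \<open>u\<close>, and
  it is enough to find among them one that is uniformly close to infinitely many others. They are
  bilinear forms, and since \<open>u\<close> is almost a convex combination of elementary tensors of unit vectors,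
  infinitely many of them almost attain their norm at one and the same finitely supported pair.

  If \<open>A\<close> almost attains its norm at \<open>(x, y)\<close>, then \<open>p\<close>-convexity bounds \<open>A (x \<plusminus> t z, y \<plusminus> t w)\<close> by
  \<open>1 + O(t\<^sup>p)\<close> for \<open>z\<close>, \<open>w\<close> disjoint from \<open>x\<close>, \<open>y\<close>. As \<open>p > 2\<close>, the term \<open>t\<^sup>2 A (z, w)\<close> must be small. In the
  complex case the mixed terms \<open>A (e\<^sub>i, w)\<close> are handled by rotating the \<open>i\<close>-th coordinate of \<open>x\<close>, which
  costs only \<open>O(\<theta>\<^sup>2)\<close>. If the duals are uniformly convex of power types smaller than the convexity exponents, then all
  \<open>A (\<cdot>, w)\<close> are small at once. So, up to small errors, the forms live on finitely many coordinates,
  where the pigeonhole principle applies.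

  A bilinear form on \<open>X \<times> Y\<close> is treated as a quadratic form on the lattice \<open>X \<oplus>\<^sub>\<infinity> Y\<close>, so that the
  symmetric and the non-symmetric tensor products have a common proof; functionals are real-linear
  throughout.\<close>

section \<open>Functions as a real vector space\<close>

text \<open>Closeness to infinitely many functionals is enough because they almost norm
  \<open>u\<close> better and better. If Q_n is uniformly close to Q_m for arbitrarily late m, then
  testing u + s h_n with Q_m bounds every difference quotient at h_n from below by almost Q_n h_n,
  whereas the quotient at t_n is at most Q_n h_n; so h_n was not bad. The delicate block of a form
  is the mixed one, a coordinate e_i of the support against a vector w beyond it. Estimates are
  available only for one coordinate at a time, so the error is multiplied by the size of the
  support, and that size is known only after the near-maximizer has been found. Therefore a second
  near-maximizer is chosen, with an accuracy that depends on the support of the first one.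
  Truncation to finite supports requires tails that vanish in norm. Density of \<open>c00\<close>
  gives this in the first two statements; in the third it has to be extracted from the convexity of
  the dual.\<close>

instantiation "fun" :: (type, real_vector) real_vector
begin
definition "r *\<^sub>R f = (\<lambda>x. r *\<^sub>R f x)"
instance
  by standard (auto simp: scaleR_fun_def fun_eq_iff scaleR_add_right scaleR_add_left)
end

lemma scaleR_fun_apply [simp]: "(r *\<^sub>R f) x = r *\<^sub>R f x"
  by (simp add: scaleR_fun_def)

lemma sum_fun_apply: "(\<Sum>j\<in>A. f j) x = (\<Sum>j\<in>A. f j x)"
  by (induction A rule: infinite_finite_induct) auto


section \<open>The Hahn-Banach theorem\<close>

text \<open>Scaling is demanded only as an inequality, which is easier to check for infima; equality
  follows by applying it to the inverse factor.\<close>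

definition sublinear :: "('v::real_vector \<Rightarrow> real) \<Rightarrow> bool" where
  "sublinear q \<longleftrightarrow> (\<forall>x y. q (x + y) \<le> q x + q y) \<and> (\<forall>r\<ge>0. \<forall>x. q (r *\<^sub>R x) \<le> r * q x)"

lemma sublinear_add: "sublinear q \<Longrightarrow> q (x + y) \<le> q x + q y"
  and sublinear_scale_le: "sublinear q \<Longrightarrow> 0 \<le> r \<Longrightarrow> q (r *\<^sub>R x) \<le> r * q x"
  by (auto simp: sublinear_def)

lemma sublinear_0: "sublinear q \<Longrightarrow> q 0 = 0"
  using sublinear_add[of q 0 0] sublinear_scale_le[of q 0 0] by simp

lemma sublinear_scale:
  assumes q: "sublinear q" and r: "0 \<le> r"
  shows "q (r *\<^sub>R x) = r * q x"
proof (cases "r = 0")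
  case True
  then show ?thesis using sublinear_0[OF q] by simp
next
  case False
  then have "r > 0" using r by simp
  then have "q (inverse r *\<^sub>R (r *\<^sub>R x)) \<le> inverse r * q (r *\<^sub>R x)"
    by (intro sublinear_scale_le[OF q]) auto
  then have "r * q x \<le> q (r *\<^sub>R x)"
    using \<open>r > 0\<close> by (simp add: field_simps)
  then show ?thesis
    using sublinear_scale_le[OF q r, of x] by simp
qed

lemma sublinear_minus_le: "sublinear q \<Longrightarrow> - q (- x) \<le> q x"
  using sublinear_add[of q x "- x"] sublinear_0[of q] by simp

text \<open>Lowers \<open>q\<close> so that the value at \<open>- a\<close> becomes at most
  \<open>- q a\<close> (take t = 1) while sublinearity is kept. This is the device that replaces the
  one-dimensional extension step of the usual Hahn-Banach proof.\<close>

definition tilt :: "'v::real_vector \<Rightarrow> ('v \<Rightarrow> real) \<Rightarrow> 'v \<Rightarrow> real" where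
  "tilt a q x = (INF t\<in>{0..}. q (x + t *\<^sub>R a) - t * q a)"

lemma bdd_below_tilt:
  assumes q: "sublinear q"
  shows "bdd_below ((\<lambda>t. q (x + t *\<^sub>R a) - t * q a) ` {0..})"
proof (rule bdd_belowI2)
  fix t :: real
  assume "t \<in> {0..}"
  then have "t * q a = q (t *\<^sub>R a)"
    using sublinear_scale[OF q] by simp
  also have "\<dots> \<le> q (x + t *\<^sub>R a) + q (- x)"
    using sublinear_add[OF q, of "x + t *\<^sub>R a" "- x"] by simp
  finally show "- q (- x) \<le> q (x + t *\<^sub>R a) - t * q a" by simp
qed

lemma tilt_le:
  assumes "sublinear q" "0 \<le> t"
  shows "tilt a q x \<le> q (x + t *\<^sub>R a) - t * q a"
  unfolding tilt_def using assms by (intro cINF_lower bdd_below_tilt) auto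

lemma tilt_le_self: "sublinear q \<Longrightarrow> tilt a q x \<le> q x"
  using tilt_le[of q 0 a x] by simp

lemma tilt_sublinear:
  assumes q: "sublinear q"
  shows "sublinear (tilt a q)"
  unfolding sublinear_def
proof (intro conjI allI impI)
  fix x y
  have "tilt a q (x + y) \<le> (q (x + s *\<^sub>R a) - s * q a) + (q (y + t *\<^sub>R a) - t * q a)"
    if "0 \<le> s" "0 \<le> t" for s t
  proof -
    have "tilt a q (x + y) \<le> q ((x + y) + (s + t) *\<^sub>R a) - (s + t) * q a"
      using that by (intro tilt_le q) auto
    also have "(x + y) + (s + t) *\<^sub>R a = (x + s *\<^sub>R a) + (y + t *\<^sub>R a)"
      by (simp add: algebra_simps)
    finally show ?thesis
      using sublinear_add[OF q, of "x + s *\<^sub>R a" "y + t *\<^sub>R a"] by (simp add: algebra_simps)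
  qed
  then have "tilt a q (x + y) - (q (y + t *\<^sub>R a) - t * q a) \<le> tilt a q x" if "0 \<le> t" for t
    unfolding tilt_def[of a q x] using that by (intro cINF_greatest) (auto simp: algebra_simps)
  then have "tilt a q (x + y) - tilt a q x \<le> tilt a q y"
    unfolding tilt_def[of a q y] by (intro cINF_greatest) (auto simp: algebra_simps)
  then show "tilt a q (x + y) \<le> tilt a q x + tilt a q y" by simp
next
  fix r :: real and x
  assume "0 \<le> r"
  show "tilt a q (r *\<^sub>R x) \<le> r * tilt a q x"
  proof (cases "r = 0")
    case True
    then show ?thesis
      using tilt_le_self[OF q, of a 0] sublinear_0[OF q] by simp
  next
    case False
    with \<open>0 \<le> r\<close> have r: "r > 0" by simp
    have "tilt a q (r *\<^sub>R x) / r \<le> q (x + t *\<^sub>R a) - t * q a" if "0 \<le> t" for t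
    proof -
      have "tilt a q (r *\<^sub>R x) \<le> q (r *\<^sub>R x + (r * t) *\<^sub>R a) - (r * t) * q a"
        using r that by (intro tilt_le q) auto
      also have "r *\<^sub>R x + (r * t) *\<^sub>R a = r *\<^sub>R (x + t *\<^sub>R a)"
        by (simp add: algebra_simps)
      also have "q \<dots> = r * q (x + t *\<^sub>R a)"
        using r by (intro sublinear_scale q) auto
      finally show ?thesis using r by (simp add: field_simps)
    qed
    then have "tilt a q (r *\<^sub>R x) / r \<le> tilt a q x"
      unfolding tilt_def[of a q x] by (intro cINF_greatest) auto
    then show ?thesis using r by (simp add: field_simps)
  qed
qed

text \<open>A minimal \<open>q\<close> equals each of its tilts, and t = 1 in the infimum gives q x
  + q a <= q (x + a), the converse of subadditivity.\<close>

lemma minimal_sublinear_linear: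
  assumes q: "sublinear q" and min: "\<And>q'. sublinear q' \<Longrightarrow> (\<And>x. q' x \<le> q x) \<Longrightarrow> q' = q"
  shows "linear q"
proof -
  have add: "q (x + a) = q x + q a" for x a
  proof -
    have "tilt a q = q"
      by (intro min tilt_sublinear tilt_le_self q)
    then have "q x \<le> q (x + a) - q a"
      using tilt_le[OF q, of 1 a x] by simp
    then show ?thesis using sublinear_add[OF q, of x a] by simp
  qed
  have neg: "q (- x) = - q x" for x
    using add[of x "- x"] sublinear_0[OF q] by simp
  have "q (r *\<^sub>R x) = r * q x" for r x
  proof (cases "0 \<le> r")
    case False
    then have "q ((- r) *\<^sub>R x) = (- r) * q x"
      by (intro sublinear_scale q) auto
    then show ?thesis using neg[of "r *\<^sub>R x"] by simp
  qed (rule sublinear_scale[OF q])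
  then show ?thesis by (intro linearI add) auto
qed

text \<open>Zorn's lemma for the reversed pointwise order. The infimum of a chain is finite because
  \<open>- p (- x)\<close> bounds all its members below, and it is subadditive because of two
  members of a chain the smaller one serves both summands.\<close>

lemma exists_minimal_sublinear:
  assumes p: "sublinear p"
  obtains q where "sublinear q" "\<And>x. q x \<le> p x"
    "\<And>q'. sublinear q' \<Longrightarrow> (\<And>x. q' x \<le> q x) \<Longrightarrow> q' = q"
proof -
  define A where "A = {q. sublinear q \<and> (\<forall>x. q x \<le> p x)}"
  define P where "P = (\<lambda>q r :: 'a \<Rightarrow> real. \<forall>x. r x \<le> q x)"
  have po: "partial_order_on A (relation_of P A)"
    by (rule partial_order_on_relation_ofI) (auto simp: P_def fun_eq_iff intro: order_trans antisym)
  have "\<exists>m\<in>A. \<forall>a\<in>A. P m a \<longrightarrow> a = m"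
  proof (rule predicate_Zorn[OF po])
    fix C
    assume C: "C \<in> Chains (relation_of P A)"
    then have CA: "C \<subseteq> A" and tot: "\<And>q r. q \<in> C \<Longrightarrow> r \<in> C \<Longrightarrow> P q r \<or> P r q"
      by (auto simp: Chains_def relation_of_def)
    show "\<exists>u\<in>A. \<forall>a\<in>C. P a u"
    proof (cases "C = {}")
      case True
      then show ?thesis using p by (auto simp: A_def intro!: exI[of _ p])
    next
      case False
      have sl: "sublinear q" and qp: "q x \<le> p x" if "q \<in> C" for q x
        using CA that by (auto simp: A_def)
      define u where "u = (\<lambda>x. INF q\<in>C. q x)"
      have bdd: "bdd_below ((\<lambda>q. q x) ` C)" for x
      proof (rule bdd_belowI2)
        fix q assume "q \<in> C"
        then show "- p (- x) \<le> q x"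
          using sublinear_minus_le[OF sl[of q], of x] qp[of q "- x"] by simp
      qed
      have ul: "u x \<le> q x" if "q \<in> C" for q x
        unfolding u_def using that bdd by (intro cINF_lower) auto
      have "sublinear u"
        unfolding sublinear_def
      proof (intro conjI allI impI)
        fix x y
        have "u (x + y) \<le> q x + r y" if qr: "q \<in> C" "r \<in> C" for q r
        proof -
          from tot[OF qr] qr obtain m where m: "m \<in> C" "m x \<le> q x" "m y \<le> r y"
            by (auto simp: P_def)
          then show ?thesis
            using ul[OF m(1), of "x + y"] sublinear_add[OF sl[OF m(1)], of x y] by simp
        qed
        then have "u (x + y) - r y \<le> u x" if "r \<in> C" for r
          unfolding u_def[THEN fun_cong, of x] using that False
          by (intro cINF_greatest) (auto simp: algebra_simps)
        then have "u (x + y) - u x \<le> u y"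
          unfolding u_def[THEN fun_cong, of y] using False
          by (intro cINF_greatest) (auto simp: algebra_simps)
        then show "u (x + y) \<le> u x + u y" by simp
      next
        fix r :: real and x
        assume "0 \<le> r"
        show "u (r *\<^sub>R x) \<le> r * u x"
        proof (cases "r = 0")
          case True
          obtain q where "q \<in> C" using False by auto
          then show ?thesis
            using ul[of q 0] sublinear_0[OF sl[of q]] True by simp
        next
          case False
          with \<open>0 \<le> r\<close> have r: "r > 0" by simp
          have "u (r *\<^sub>R x) / r \<le> u x"
            unfolding u_def[THEN fun_cong, of x]
          proof (rule cINF_greatest[OF \<open>C \<noteq> {}\<close>])
            fix q assume "q \<in> C"
            then show "u (r *\<^sub>R x) / r \<le> q x"
              using ul[of q "r *\<^sub>R x"] sublinear_scale_le[OF sl, of q r x] r by (simp add: field_simps)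
          qed
          then show ?thesis using r by (simp add: field_simps)
        qed
      qed
      moreover have "u x \<le> p x" for x
        using False ul qp by (meson all_not_in_conv order_trans)
      ultimately show ?thesis
        using ul by (auto simp: A_def P_def)
    qed
  qed
  then obtain m where m: "m \<in> A" "\<And>a. a \<in> A \<Longrightarrow> P m a \<Longrightarrow> a = m" by auto
  show thesis
  proof (rule that)
    fix q' assume "sublinear q'" and le: "\<And>x. q' x \<le> m x"
    then show "q' = m"
      using m by (intro m(2)) (auto simp: A_def P_def intro: order_trans)
  qed (use m in \<open>auto simp: A_def\<close>)
qed

text \<open>Minimizing below the tilt in direction \<open>x0\<close>, not below \<open>p\<close>
  itself, forces q (- x0) <= - p x0 and hence equality at \<open>x0\<close>.\<close>

theorem hahn_banach:
  assumes p: "sublinear p"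
  obtains q where "linear q" "\<And>x. q x \<le> p x" "q x0 = p x0"
proof -
  obtain q where q: "sublinear q" "\<And>x. q x \<le> tilt x0 p x"
      and min: "\<And>q'. sublinear q' \<Longrightarrow> (\<And>x. q' x \<le> q x) \<Longrightarrow> q' = q"
    by (rule exists_minimal_sublinear[OF tilt_sublinear[OF p, of x0]]) blast
  have lin: "linear q"
    using minimal_sublinear_linear[OF q(1) min] .
  have le: "q x \<le> p x" for x
    using q(2)[of x] tilt_le_self[OF p, of x0 x] by simp
  have "q (- x0) \<le> - p x0"
    using q(2)[of "- x0"] tilt_le[OF p, of 1 x0 "- x0"] sublinear_0[OF p] by simp
  then have "q x0 = p x0"
    using le[of x0] linear_neg[OF lin, of x0] by simp
  then show thesis using that lin le by blast
qed

text \<open>Reduced to a total \<open>p\<close> by composition with a linear projection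
  \<open>g\<close> onto \<open>V\<close>.\<close>

corollary hahn_banach_on:
  assumes V: "subspace V" and x0: "x0 \<in> V"
    and add: "\<And>x y. x \<in> V \<Longrightarrow> y \<in> V \<Longrightarrow> p (x + y) \<le> p x + p y"
    and scale: "\<And>r x. 0 \<le> r \<Longrightarrow> x \<in> V \<Longrightarrow> p (r *\<^sub>R x) \<le> r * p x"
  obtains q where "linear q" "\<And>x. x \<in> V \<Longrightarrow> q x \<le> p x" "q x0 = p x0"
proof -
  obtain g where g: "range g \<subseteq> V" "linear g" "\<And>v. v \<in> V \<Longrightarrow> g v = v"
    using real_vector.linear_exists_left_inverse_on[OF linear_id V] unfolding linear_def id_def by auto
  have "sublinear (\<lambda>x. p (g x))"
    unfolding sublinear_def using g(1)
    by (auto simp: linear_add[OF g(2)] linear_scale[OF g(2)] intro!: add scale)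
  then obtain q where "linear q" "\<And>x. q x \<le> p (g x)" "q x0 = p (g x0)"
    using hahn_banach by blast
  then show thesis using that g(3) x0 by metis
qed

section \<open>A sequential criterion for strong subdifferentiability\<close>

text \<open>A seminorm and not a norm, since one instance is the space of Cauchy sequences with
  \<open>lim_norm\<close>, where null sequences have value 0.\<close>

locale seminorm_on =
  fixes V :: "'v::real_vector set" and \<nu> :: "'v \<Rightarrow> real"
  assumes subspace: "subspace V"
    and triangle: "\<lbrakk>x \<in> V; y \<in> V\<rbrakk> \<Longrightarrow> \<nu> (x + y) \<le> \<nu> x + \<nu> y"
    and scaleR: "x \<in> V \<Longrightarrow> \<nu> (r *\<^sub>R x) = \<bar>r\<bar> * \<nu> x"
begin

lemma zero: "\<nu> 0 = 0"
  using scaleR[of 0 0] subspace_0[OF subspace] by simp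

lemma minus: "x \<in> V \<Longrightarrow> \<nu> (- x) = \<nu> x"
  using scaleR[of x "-1"] by simp

lemma nonneg: "x \<in> V \<Longrightarrow> 0 \<le> \<nu> x"
  using triangle[of x "- x"] subspace_neg[OF subspace, of x] minus[of x] zero by simp

lemma triangle_diff: "\<lbrakk>x \<in> V; y \<in> V\<rbrakk> \<Longrightarrow> \<nu> (x - y) \<le> \<nu> x + \<nu> y"
  using triangle[of x "- y"] subspace_neg[OF subspace, of y] minus[of y] by simp

lemma triangle_abs: "\<lbrakk>x \<in> V; y \<in> V\<rbrakk> \<Longrightarrow> \<bar>\<nu> x - \<nu> y\<bar> \<le> \<nu> (x - y)"
  using triangle[of "x - y" y] triangle[of "y - x" x] minus[of "x - y"] subspace_diff[OF subspace]
  by fastforce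

definition contractive :: "('v \<Rightarrow> real) \<Rightarrow> bool" where
  "contractive q \<longleftrightarrow> linear q \<and> (\<forall>v\<in>V. \<bar>q v\<bar> \<le> \<nu> v)"

lemma contractiveI:
  assumes "linear q" "\<And>v. v \<in> V \<Longrightarrow> q v \<le> \<nu> v"
  shows "contractive q"
  unfolding contractive_def
proof (intro conjI ballI assms(1))
  fix v assume "v \<in> V"
  then show "\<bar>q v\<bar> \<le> \<nu> v"
    using assms(2)[of v] assms(2)[of "- v"] minus[of v] linear_neg[OF assms(1), of v]
      subspace_neg[OF subspace, of v] by auto
qed

lemma exists_norming:
  assumes x: "x \<in> V"
  obtains q where "contractive q" "q x = \<nu> x"
proof -
  obtain q where "linear q" "\<And>y. y \<in> V \<Longrightarrow> q y \<le> \<nu> y" "q x = \<nu> x"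
    by (rule hahn_banach_on[OF subspace x, of \<nu>]) (use triangle scaleR in auto)
  then show thesis by (intro that[of q] contractiveI)
qed

section \<open>Difference quotients of the norm and one-sided derivatives\<close>

definition quot :: "'v \<Rightarrow> real \<Rightarrow> 'v \<Rightarrow> real" where
  "quot u t h = (\<nu> (u + t *\<^sub>R h) - 1) / t"

text \<open>The one-sided derivative of the norm at \<open>u\<close>: an infimum instead of a limit,
  because the quotients are monotone in t by convexity.\<close>

definition slope :: "'v \<Rightarrow> 'v \<Rightarrow> real" where
  "slope u h = (INF t\<in>{0<..}. quot u t h)"

lemma shift_in: "u \<in> V \<Longrightarrow> h \<in> V \<Longrightarrow> u + t *\<^sub>R h \<in> V"
  using subspace by (simp add: subspace_add subspace_scale)

lemma quot_ge:
  assumes "u \<in> V" "\<nu> u = 1" "h \<in> V" "t > 0"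
  shows "- \<nu> h \<le> quot u t h"
proof -
  have "\<nu> u \<le> \<nu> (u + t *\<^sub>R h) + t * \<nu> h"
    using triangle_diff[of "u + t *\<^sub>R h" "t *\<^sub>R h"] assms shift_in scaleR[of h t]
      subspace_scale[OF subspace, of h t] by simp
  then show ?thesis using assms by (simp add: quot_def field_simps)
qed

lemma slope_le_quot:
  assumes "u \<in> V" "\<nu> u = 1" "h \<in> V" "t > 0"
  shows "slope u h \<le> quot u t h"
  unfolding slope_def
  using assms by (intro cINF_lower bdd_belowI2[where m = "- \<nu> h"] quot_ge) auto

lemma quot_mono:
  assumes u: "u \<in> V" "\<nu> u = 1" and h: "h \<in> V" and st: "0 < s" "s \<le> t"
  shows "quot u s h \<le> quot u t h"
proof -
  have "u + s *\<^sub>R h = (1 - s / t) *\<^sub>R u + (s / t) *\<^sub>R (u + t *\<^sub>R h)"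
    using st by (simp add: algebra_simps)
  also have "\<nu> \<dots> \<le> (1 - s / t) * \<nu> u + (s / t) * \<nu> (u + t *\<^sub>R h)"
    using triangle[of "(1 - s / t) *\<^sub>R u" "(s / t) *\<^sub>R (u + t *\<^sub>R h)"] u(1) h st
      scaleR[OF u(1), of "1 - s / t"] scaleR[OF shift_in[OF u(1) h], of "s / t" t]
      subspace_scale[OF subspace] shift_in by simp
  finally have "\<nu> (u + s *\<^sub>R h) - 1 \<le> (s / t) * (\<nu> (u + t *\<^sub>R h) - 1)"
    using u(2) by (simp add: algebra_simps)
  then show ?thesis using st by (simp add: quot_def field_simps)
qed

text \<open>The hypothesis \<open>net\<close> is a weak form of compactness for functionals that
  asymptotically norm \<open>u\<close>. By monotonicity of the quotients it suffices to find one
  \<open>t0\<close> that works for all directions.\<close>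

lemma uniform_quot_limit:
  assumes u: "u \<in> V" "\<nu> u = 1"
    and net: "\<And>Q \<delta>. \<lbrakk>\<And>n. contractive (Q n); (\<lambda>n. Q n u) \<longlonglongrightarrow> 1; 0 < \<delta>\<rbrakk>
      \<Longrightarrow> \<exists>n. \<exists>\<^sub>\<infinity>m. \<forall>h\<in>V. \<nu> h \<le> 1 \<longrightarrow> \<bar>Q n h - Q m h\<bar> \<le> \<delta>"
    and \<epsilon>: "\<epsilon> > 0"
  shows "\<exists>t0>0. \<forall>t h. 0 < t \<and> t \<le> t0 \<and> h \<in> V \<and> \<nu> h \<le> 1 \<longrightarrow> \<bar>quot u t h - slope u h\<bar> \<le> \<epsilon>"
proof -
  have "\<exists>t0>0. \<forall>h\<in>V. \<nu> h \<le> 1 \<longrightarrow> quot u t0 h \<le> slope u h + \<epsilon>"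
  proof (rule ccontr)
    define t where "t n = 1 / real (Suc n)" for n
    have t: "t n > 0" for n by (simp add: t_def)
    assume "\<not> ?thesis"
    then have "\<forall>n. \<exists>h\<in>V. \<nu> h \<le> 1 \<and> quot u (t n) h > slope u h + \<epsilon>"
      using t by (meson not_le)
    then obtain h where h: "\<And>n. h n \<in> V" "\<And>n. \<nu> (h n) \<le> 1"
        and bad: "\<And>n. quot u (t n) (h n) > slope u (h n) + \<epsilon>"
      by metis
    have "\<forall>n. \<exists>q. contractive q \<and> q (u + t n *\<^sub>R h n) = \<nu> (u + t n *\<^sub>R h n)"
      using exists_norming shift_in u(1) h(1) by metis
    then obtain Q where Q: "\<And>n. contractive (Q n)"
        and Qn: "\<And>n. Q n (u + t n *\<^sub>R h n) = \<nu> (u + t n *\<^sub>R h n)"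
      by metis
    have lin: "linear (Q n)" and le: "v \<in> V \<Longrightarrow> \<bar>Q n v\<bar> \<le> \<nu> v" for n v
      using Q[of n] by (auto simp: contractive_def)
    have expand: "Q m (u + r *\<^sub>R h n) = Q m u + r * Q m (h n)" for m n r
      by (simp add: linear_add[OF lin] linear_scale[OF lin])
    have low: "1 - 2 * t n \<le> Q n u" for n
    proof -
      have "\<nu> u \<le> \<nu> (u + t n *\<^sub>R h n) + t n * \<nu> (h n)"
        using triangle_diff[of "u + t n *\<^sub>R h n" "t n *\<^sub>R h n"] u h(1) shift_in
          scaleR[OF h(1), of "t n" n] t[of n] subspace_scale[OF subspace] by simp
      moreover have "t n * Q n (h n) \<le> t n * 1" "t n * \<nu> (h n) \<le> t n * 1"
        using le[OF h(1), of n n] h(2)[of n] t[of n] by (intro mult_left_mono; linarith)+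
      ultimately show ?thesis
        using Qn[of n] expand[of n "t n" n] u(2) by simp
    qed
    have "(\<lambda>n. 1 - 2 * t n) \<longlonglongrightarrow> 1 - 2 * 0"
      unfolding t_def by (intro tendsto_intros LIMSEQ_Suc lim_1_over_n)
    then have lim0: "(\<lambda>n. 1 - 2 * t n) \<longlonglongrightarrow> 1" by simp
    have lim: "(\<lambda>n. Q n u) \<longlonglongrightarrow> 1"
    proof (rule tendsto_sandwich[OF _ _ lim0 tendsto_const])
      show "\<forall>\<^sub>F n in sequentially. Q n u \<le> 1"
        using le[OF u(1)] u(2) by (intro always_eventually allI) (metis abs_le_D1)
    qed (use low in auto)
    obtain n where n: "\<exists>\<^sub>\<infinity>m. \<forall>h\<in>V. \<nu> h \<le> 1 \<longrightarrow> \<bar>Q n h - Q m h\<bar> \<le> \<epsilon> / 2"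
      using net[OF Q lim, of "\<epsilon> / 2"] \<epsilon> by auto
    \<comment> \<open>Otherwise, since \<open>Q m u\<close> tends to 1, some late m with
      \<open>Q m\<close> close to \<open>Q n\<close> would satisfy Q m (u + s h_n) > \<nu> (u + s
      h_n).\<close>
    have "Q n (h n) - \<epsilon> / 2 \<le> quot u s (h n)" if s: "s > 0" for s
    proof (rule ccontr)
      assume "\<not> ?thesis"
      then have "\<nu> (u + s *\<^sub>R h n) - s * (Q n (h n) - \<epsilon> / 2) < 1"
        using s by (simp add: quot_def field_simps)
      then have "\<forall>\<^sub>F m in sequentially. \<nu> (u + s *\<^sub>R h n) - s * (Q n (h n) - \<epsilon> / 2) < Q m u"
        using order_tendstoD(1)[OF lim] by blast
      then have "\<exists>\<^sub>\<infinity>m. (\<forall>h\<in>V. \<nu> h \<le> 1 \<longrightarrow> \<bar>Q n h - Q m h\<bar> \<le> \<epsilon> / 2)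
          \<and> \<nu> (u + s *\<^sub>R h n) - s * (Q n (h n) - \<epsilon> / 2) < Q m u"
        using n by (auto simp: cofinite_eq_sequentially intro: frequently_eventually_frequently)
      then obtain m where m: "\<forall>h\<in>V. \<nu> h \<le> 1 \<longrightarrow> \<bar>Q n h - Q m h\<bar> \<le> \<epsilon> / 2"
          and low: "\<nu> (u + s *\<^sub>R h n) - s * (Q n (h n) - \<epsilon> / 2) < Q m u"
        by (auto dest: frequently_ex)
      have "Q m u + s * Q m (h n) \<le> \<nu> (u + s *\<^sub>R h n)"
        using le[OF shift_in[OF u(1) h(1)], of m s n] expand[of m s n] by simp
      moreover have "s * (Q n (h n) - \<epsilon> / 2) \<le> s * Q m (h n)"
        using bspec[OF m h(1), of n] h(2)[of n] s by (intro mult_left_mono; linarith)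
      ultimately show False using low by simp
    qed
    then have "Q n (h n) - \<epsilon> / 2 \<le> slope u (h n)"
      unfolding slope_def by (intro cINF_greatest) auto
    moreover have "quot u (t n) (h n) \<le> Q n (h n)"
    proof -
      have "\<nu> (u + t n *\<^sub>R h n) \<le> 1 + t n * Q n (h n)"
        using Qn[of n] expand[of n "t n" n] le[OF u(1), of n] u(2) by simp
      then show ?thesis using t[of n] by (simp add: quot_def field_simps)
    qed
    ultimately show False using bad[of n] \<epsilon> by simp
  qed
  then obtain t0 where t0: "t0 > 0" "\<And>h. h \<in> V \<Longrightarrow> \<nu> h \<le> 1 \<Longrightarrow> quot u t0 h \<le> slope u h + \<epsilon>"
    by blast
  have "\<bar>quot u t h - slope u h\<bar> \<le> \<epsilon>" if "0 < t" "t \<le> t0" "h \<in> V" "\<nu> h \<le> 1" for t h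
    using quot_mono[OF u that(3,1,2)] slope_le_quot[OF u that(3,1)] t0(2)[OF that(3,4)] by simp
  then show ?thesis using t0(1) by blast
qed

end

section \<open>Completions of seminormed function spaces\<close>

definition smul :: "'k::real_normed_field \<Rightarrow> ('i \<Rightarrow> 'k) \<Rightarrow> 'i \<Rightarrow> 'k" where
  "smul c x = (\<lambda>k. c * x k)"

lemma smul_apply [simp]: "smul c x k = c * x k"
  by (simp add: smul_def)

lemma smul_algebra:
  "smul c (x + y) = smul c x + smul c y" "smul c (x - y) = smul c x - smul c y"
  "smul c (- x) = - smul c x"
  "smul (c + d) x = smul c x + smul d x" "smul (c - d) x = smul c x - smul d x"
  "smul c (smul d x) = smul (c * d) x" "smul 1 x = x" "smul 0 x = 0" "smul c 0 = 0"
  by (auto simp: fun_eq_iff algebra_simps)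

lemma scaleR_eq_smul: "r *\<^sub>R x = smul (of_real r) x"
  by (auto simp: fun_eq_iff scaleR_conv_of_real)

lemma function_space_simps [simp]:
  "vcarrier (function_space S N) = S"
  "vadd (function_space S N) = (+)"
  "vzero (function_space S N) = 0"
  "vscale (function_space S N) = smul"
  "vnorm (function_space S N) = N"
  by (auto simp: function_space_def fun_eq_iff)

lemma vdiff_function_space [simp]: "vdiff (function_space S N) x y = x - y"
  by (auto simp: vdiff_def fun_eq_iff)

locale function_seminorm =
  fixes S :: "('i \<Rightarrow> 'k::real_normed_field) set" and N :: "('i \<Rightarrow> 'k) \<Rightarrow> real"
  assumes zero_in: "0 \<in> S"
    and add_in: "\<lbrakk>x \<in> S; y \<in> S\<rbrakk> \<Longrightarrow> x + y \<in> S"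
    and smul_in: "x \<in> S \<Longrightarrow> smul c x \<in> S"
    and N_triangle: "\<lbrakk>x \<in> S; y \<in> S\<rbrakk> \<Longrightarrow> N (x + y) \<le> N x + N y"
    and N_smul: "x \<in> S \<Longrightarrow> N (smul c x) = norm c * N x"
begin

sublocale seminorm_on S N
  by unfold_locales
    (auto simp: subspace_def zero_in add_in scaleR_eq_smul smul_in N_triangle N_smul)

lemma diff_in: "\<lbrakk>x \<in> S; y \<in> S\<rbrakk> \<Longrightarrow> x - y \<in> S"
  by (rule subspace_diff[OF subspace])

section \<open>Cauchy sequences as a seminormed space, and their classes\<close>

definition cauchys :: "(nat \<Rightarrow> 'i \<Rightarrow> 'k) set" where
  "cauchys = {u. cauchy_in (function_space S N) u}"

definition lim_norm :: "(nat \<Rightarrow> 'i \<Rightarrow> 'k) \<Rightarrow> real" where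
  "lim_norm u = lim (\<lambda>n. N (u n))"

definition cls :: "(nat \<Rightarrow> 'i \<Rightarrow> 'k) \<Rightarrow> (nat \<Rightarrow> 'i \<Rightarrow> 'k) set" where
  "cls u = cauchy_rel (function_space S N) `` {u}"

lemma cauchys_iff:
  "u \<in> cauchys \<longleftrightarrow> (\<forall>n. u n \<in> S) \<and> (\<forall>\<epsilon>>0. \<exists>M. \<forall>m\<ge>M. \<forall>n\<ge>M. N (u m - u n) < \<epsilon>)"
  by (simp add: cauchys_def cauchy_in_def)

lemma cauchysD: "u \<in> cauchys \<Longrightarrow> u n \<in> S"
  by (simp add: cauchys_iff)

lemma lim_norm:
  assumes u: "u \<in> cauchys"
  shows "(\<lambda>n. N (u n)) \<longlonglongrightarrow> lim_norm u"
proof -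
  have "Cauchy (\<lambda>n. N (u n))"
  proof (rule metric_CauchyI)
    fix e :: real
    assume "0 < e"
    then obtain M where M: "\<And>m n. m \<ge> M \<Longrightarrow> n \<ge> M \<Longrightarrow> N (u m - u n) < e"
      using u unfolding cauchys_iff by metis
    have "dist (N (u m)) (N (u n)) < e" if "m \<ge> M" "n \<ge> M" for m n
      using triangle_abs[OF cauchysD[OF u, of m] cauchysD[OF u, of n]] M[OF that]
      by (simp add: dist_real_def)
    then show "\<exists>M. \<forall>m\<ge>M. \<forall>n\<ge>M. dist (N (u m)) (N (u n)) < e" by blast
  qed
  then show ?thesis
    unfolding lim_norm_def by (simp add: Cauchy_convergent_iff convergent_LIMSEQ_iff)
qed

lemma lim_norm_eqI: "(\<lambda>n. N (u n)) \<longlonglongrightarrow> l \<Longrightarrow> lim_norm u = l"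
  unfolding lim_norm_def by (rule limI)

lemma const_cauchys: "x \<in> S \<Longrightarrow> (\<lambda>_. x) \<in> cauchys"
  by (auto simp: cauchys_iff zero)

lemma lim_norm_const: "lim_norm (\<lambda>_. x) = N x"
  by (intro lim_norm_eqI tendsto_const)

lemma add_cauchys:
  assumes u: "u \<in> cauchys" and v: "v \<in> cauchys"
  shows "u + v \<in> cauchys"
  unfolding cauchys_iff
proof (intro conjI allI impI)
  show "(u + v) n \<in> S" for n
    using cauchysD[OF u] cauchysD[OF v] by (simp add: add_in)
next
  fix \<epsilon> :: real
  assume "\<epsilon> > 0"
  then have "\<epsilon> / 2 > 0" by simp
  then obtain M1 M2 where M1: "\<And>m n. m \<ge> M1 \<Longrightarrow> n \<ge> M1 \<Longrightarrow> N (u m - u n) < \<epsilon> / 2"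
      and M2: "\<And>m n. m \<ge> M2 \<Longrightarrow> n \<ge> M2 \<Longrightarrow> N (v m - v n) < \<epsilon> / 2"
    using u v unfolding cauchys_iff by metis
  have "N ((u + v) m - (u + v) n) < \<epsilon>" if "m \<ge> max M1 M2" "n \<ge> max M1 M2" for m n
  proof -
    have eq: "(u + v) m - (u + v) n = (u m - u n) + (v m - v n)"
      by (simp add: algebra_simps)
    show ?thesis
      unfolding eq using triangle[of "u m - u n" "v m - v n"] M1[of m n] M2[of m n] that
      by (simp add: diff_in cauchysD[OF u] cauchysD[OF v])
  qed
  then show "\<exists>M. \<forall>m\<ge>M. \<forall>n\<ge>M. N ((u + v) m - (u + v) n) < \<epsilon>" by blast
qed

lemma smul_cauchys:
  assumes u: "u \<in> cauchys"
  shows "(\<lambda>n. smul c (u n)) \<in> cauchys"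
  unfolding cauchys_iff
proof (intro conjI allI impI)
  show "smul c (u n) \<in> S" for n
    using cauchysD[OF u] by (simp add: smul_in)
next
  fix \<epsilon> :: real
  assume "\<epsilon> > 0"
  then have "\<epsilon> / (norm c + 1) > 0" by (simp add: add_nonneg_pos)
  then obtain M where M: "\<And>m n. m \<ge> M \<Longrightarrow> n \<ge> M \<Longrightarrow> N (u m - u n) < \<epsilon> / (norm c + 1)"
    using u unfolding cauchys_iff by metis
  have "N (smul c (u m) - smul c (u n)) < \<epsilon>" if "m \<ge> M" "n \<ge> M" for m n
  proof -
    have "N (smul c (u m) - smul c (u n)) = norm c * N (u m - u n)"
      using N_smul[OF diff_in[OF cauchysD[OF u] cauchysD[OF u]], of c m n]
      by (simp add: smul_algebra)
    also have "\<dots> \<le> (norm c + 1) * N (u m - u n)"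
      using nonneg[OF diff_in[OF cauchysD[OF u] cauchysD[OF u]], of m n]
      by (intro mult_right_mono) auto
    also have "\<dots> < (norm c + 1) * (\<epsilon> / (norm c + 1))"
      by (intro mult_strict_left_mono M that) (simp add: add_nonneg_pos)
    also have "\<dots> = \<epsilon>"
      using norm_ge_zero[of c] by (simp add: add_nonneg_eq_0_iff)
    finally show ?thesis .
  qed
  then show "\<exists>M. \<forall>m\<ge>M. \<forall>n\<ge>M. N (smul c (u m) - smul c (u n)) < \<epsilon>" by blast
qed

lemma scaleR_seq: "r *\<^sub>R u = (\<lambda>n. smul (of_real r) (u n))"
  by (auto simp: fun_eq_iff scaleR_conv_of_real)

sublocale seq: seminorm_on cauchys lim_norm
proof
  show "subspace cauchys"
    using const_cauchys[OF zero_in] unfolding subspace_def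
    by (auto simp: add_cauchys scaleR_seq smul_cauchys zero_fun_def)
next
  fix u v
  assume uv: "u \<in> cauchys" "v \<in> cauchys"
  have "(\<lambda>n. N ((u + v) n)) \<longlonglongrightarrow> lim_norm (u + v)"
    by (intro lim_norm add_cauchys uv)
  then show "lim_norm (u + v) \<le> lim_norm u + lim_norm v"
    by (rule tendsto_le[OF sequentially_bot tendsto_add[OF lim_norm[OF uv(1)] lim_norm[OF uv(2)]]])
      (simp add: triangle cauchysD uv)
next
  fix u r
  assume u: "u \<in> cauchys"
  show "lim_norm (r *\<^sub>R u) = \<bar>r\<bar> * lim_norm u"
    using tendsto_mult_left[OF lim_norm[OF u], of "\<bar>r\<bar>"]
    by (intro lim_norm_eqI) (simp add: scaleR cauchysD[OF u])
qed

lemma cauchy_rel_iff: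
  "(u, v) \<in> cauchy_rel (function_space S N) \<longleftrightarrow> u \<in> cauchys \<and> v \<in> cauchys \<and> lim_norm (u - v) = 0"
proof (cases "u \<in> cauchys \<and> v \<in> cauchys")
  case True
  then have "(\<lambda>n. N (u n - v n)) \<longlonglongrightarrow> lim_norm (u - v)"
    using lim_norm[OF subspace_diff[OF seq.subspace, of u v]] by simp
  then have "(\<lambda>n. N (u n - v n)) \<longlonglongrightarrow> 0 \<longleftrightarrow> lim_norm (u - v) = 0"
    using LIMSEQ_unique by metis
  then show ?thesis
    using True by (simp add: cauchy_rel_def cauchys_def)
qed (auto simp: cauchy_rel_def cauchys_def)

lemma mem_cls: "u \<in> cauchys \<Longrightarrow> v \<in> cls u \<longleftrightarrow> v \<in> cauchys \<and> lim_norm (u - v) = 0"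
  by (auto simp: cls_def cauchy_rel_iff)

lemma cls_eqI:
  assumes u: "u \<in> cauchys" "v \<in> cauchys" and 0: "lim_norm (u - v) = 0"
  shows "cls u = cls v"
proof -
  have "lim_norm (u - w) = lim_norm (v - w)" if w: "w \<in> cauchys" for w
  proof -
    have "u - w \<in> cauchys" "v - w \<in> cauchys"
      using subspace_diff[OF seq.subspace] u w by auto
    then show ?thesis
      using seq.triangle_abs[of "u - w" "v - w"] 0 by simp
  qed
  then show ?thesis using u by (auto simp: mem_cls)
qed

lemma self_in_cls: "u \<in> cauchys \<Longrightarrow> u \<in> cls u"
  by (simp add: mem_cls seq.zero)

lemma completion_carrier: "vcarrier (completion (function_space S N)) = cls ` cauchys"
  by (auto simp: completion_def quotient_def cls_def cauchys_def)

lemma completion_add: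
  assumes u: "u \<in> cauchys" "v \<in> cauchys"
  shows "vadd (completion (function_space S N)) (cls u) (cls v) = cls (u + v)"
proof -
  have eq: "cauchy_rel (function_space S N) `` {\<lambda>n. u' n + v' n} = cls (u + v)"
    if "u' \<in> cls u" "v' \<in> cls v" for u' v'
  proof -
    have m: "u' \<in> cauchys" "lim_norm (u - u') = 0" "v' \<in> cauchys" "lim_norm (v - v') = 0"
      using that u by (auto simp: mem_cls)
    have d: "u - u' \<in> cauchys" "v - v' \<in> cauchys" "(u + v) - (u' + v') \<in> cauchys"
      by (intro subspace_diff[OF seq.subspace] add_cauchys u m)+
    have "(u + v) - (u' + v') = (u - u') + (v - v')" by (rule add_diff_add)
    then have "lim_norm ((u + v) - (u' + v')) \<le> lim_norm (u - u') + lim_norm (v - v')"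
      using seq.triangle[OF d(1,2)] by (simp only:)
    then have "lim_norm ((u + v) - (u' + v')) = 0"
      using seq.nonneg[OF d(3)] m by linarith
    then have "cls (u + v) = cls (u' + v')"
      by (intro cls_eqI add_cauchys u m)
    then show ?thesis by (simp add: cls_def plus_fun_def)
  qed
  have "vadd (completion (function_space S N)) (cls u) (cls v)
      = (\<Union>u'\<in>cls u. \<Union>v'\<in>cls v. cauchy_rel (function_space S N) `` {\<lambda>n. u' n + v' n})"
    by (simp add: completion_def)
  also have "\<dots> = (\<Union>u'\<in>cls u. \<Union>v'\<in>cls v. cls (u + v))"
    by (rule SUP_cong[OF refl], rule SUP_cong[OF refl], rule eq)
  also have "\<dots> = cls (u + v)"
    using self_in_cls[OF u(1)] self_in_cls[OF u(2)] by blast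
  finally show ?thesis .
qed

lemma completion_scale:
  assumes u: "u \<in> cauchys"
  shows "vscale (completion (function_space S N)) (of_real r) (cls u) = cls (r *\<^sub>R u)"
proof -
  have eq: "cauchy_rel (function_space S N) `` {\<lambda>n. smul (of_real r) (u' n)} = cls (r *\<^sub>R u)"
    if "u' \<in> cls u" for u'
  proof -
    have m: "u' \<in> cauchys" "lim_norm (u - u') = 0"
      using that u by (auto simp: mem_cls)
    have "lim_norm (r *\<^sub>R u - r *\<^sub>R u') = \<bar>r\<bar> * lim_norm (u - u')"
      using seq.scaleR[of "u - u'" r] subspace_diff[OF seq.subspace u m(1)]
      by (simp add: scaleR_diff_right)
    then have "cls (r *\<^sub>R u) = cls (r *\<^sub>R u')"
      using m u by (intro cls_eqI) (auto simp: subspace_scale[OF seq.subspace])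
    then show ?thesis by (simp add: cls_def scaleR_seq)
  qed
  have "vscale (completion (function_space S N)) (of_real r) (cls u)
      = (\<Union>u'\<in>cls u. cauchy_rel (function_space S N) `` {\<lambda>n. smul (of_real r) (u' n)})"
    by (simp add: completion_def)
  also have "\<dots> = (\<Union>u'\<in>cls u. cls (r *\<^sub>R u))"
    by (rule SUP_cong[OF refl], rule eq)
  also have "\<dots> = cls (r *\<^sub>R u)"
    using self_in_cls[OF u] by blast
  finally show ?thesis .
qed

lemma completion_norm:
  assumes u: "u \<in> cauchys"
  shows "vnorm (completion (function_space S N)) (cls u) = lim_norm u"
proof -
  have "lim_norm v = lim_norm u" if "v \<in> cls u" for v
  proof -
    have "v \<in> cauchys" "lim_norm (u - v) = 0"
      using that mem_cls[OF u] by blast+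
    then show ?thesis using seq.triangle_abs[OF u, of v] by linarith
  qed
  then have "lim_norm ` cls u = {lim_norm u}"
    using self_in_cls[OF u] by blast
  moreover have "vnorm (completion (function_space S N)) (cls u) = the_elem (lim_norm ` cls u)"
    unfolding completion_def lim_norm_def by simp
  ultimately show ?thesis
    by (simp only: the_elem_eq)
qed

lemma lim_norm_diff_const:
  assumes u: "u \<in> cauchys" and "\<epsilon> > 0"
  shows "\<exists>K. \<forall>k\<ge>K. lim_norm (u - (\<lambda>_. u k)) \<le> \<epsilon>"
proof -
  obtain M where M: "\<And>m n. m \<ge> M \<Longrightarrow> n \<ge> M \<Longrightarrow> N (u m - u n) < \<epsilon>"
    using assms unfolding cauchys_iff by metis
  have "lim_norm (u - (\<lambda>_. u k)) \<le> \<epsilon>" if "k \<ge> M" for k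
  proof (rule LIMSEQ_le_const2[OF lim_norm])
    show "u - (\<lambda>_. u k) \<in> cauchys"
      by (intro subspace_diff[OF seq.subspace u] const_cauchys cauchysD[OF u])
    show "\<exists>M. \<forall>n\<ge>M. N ((u - (\<lambda>_. u k)) n) \<le> \<epsilon>"
      using M[OF _ that] by (intro exI[of _ M]) (auto intro: less_imp_le)
  qed
  then show ?thesis by blast
qed

text \<open>Reduces the criterion to functionals on the uncompleted space. A functional on Cauchy
  sequences is restricted to constant sequences; a sequence \<open>h\<close> is approximated by the
  constants \<open>h k\<close>, and since all functionals are contractive the error is uniform in
  them.\<close>

theorem strongly_subdifferentiable_completion:
  assumes net: "\<And>u q \<delta>. \<lbrakk>u \<in> cauchys; lim_norm u = 1; \<And>n. contractive (q n);
      \<And>\<eta>. \<eta> > 0 \<Longrightarrow> \<exists>K. \<forall>k\<ge>K. \<forall>\<^sub>F n in sequentially. 1 - \<eta> \<le> q n (u k); 0 < \<delta>\<rbrakk>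
      \<Longrightarrow> \<exists>n. \<exists>\<^sub>\<infinity>m. \<forall>v\<in>S. \<bar>q n v - q m v\<bar> \<le> \<delta> * N v"
  shows "strongly_subdifferentiable (completion (function_space S N))"
proof -
  let ?C = "completion (function_space S N)"
  have key: "\<exists>n. \<exists>\<^sub>\<infinity>m. \<forall>h\<in>cauchys. lim_norm h \<le> 1 \<longrightarrow> \<bar>Q n h - Q m h\<bar> \<le> \<delta>"
    if u: "u \<in> cauchys" "lim_norm u = 1" and Q: "\<And>n. seq.contractive (Q n)"
      and lim: "(\<lambda>n. Q n u) \<longlonglongrightarrow> 1" and "0 < \<delta>" for u Q \<delta>
  proof -
    define q where "q n g = Q n (\<lambda>_. g)" for n g
    have lin: "linear (Q n)" and le: "v \<in> cauchys \<Longrightarrow> \<bar>Q n v\<bar> \<le> lim_norm v" for n v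
      using Q[of n] by (auto simp: seq.contractive_def)
    have near: "\<exists>K. \<forall>k\<ge>K. \<forall>n. \<bar>Q n h - q n (h k)\<bar> \<le> \<epsilon>" if h: "h \<in> cauchys" and "\<epsilon> > 0" for h \<epsilon>
    proof -
      have "\<bar>Q n h - q n (h k)\<bar> \<le> lim_norm (h - (\<lambda>_. h k))" for n k
        using le[OF subspace_diff[OF seq.subspace h const_cauchys[OF cauchysD[OF h, of k]]], of n]
        by (simp add: q_def linear_diff[OF lin])
      then show ?thesis
        using lim_norm_diff_const[OF that] by (meson order_trans)
    qed
    have "contractive (q n)" for n
    proof -
      have "linear (q n)"
      proof (rule linearI)
        show "q n (x + y) = q n x + q n y" for x y
          using linear_add[OF lin[of n], of "\<lambda>_. x" "\<lambda>_. y"] by (simp add: q_def plus_fun_def)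
        show "q n (r *\<^sub>R x) = r *\<^sub>R q n x" for r x
          using linear_scale[OF lin[of n], of r "\<lambda>_. x"] by (simp add: q_def scaleR_fun_def)
      qed
      then show ?thesis
        using le[OF const_cauchys, of _ n] by (auto simp: contractive_def q_def lim_norm_const)
    qed
    moreover have "\<exists>K. \<forall>k\<ge>K. \<forall>\<^sub>F n in sequentially. 1 - \<eta> \<le> q n (u k)" if pos: "\<eta> > 0" for \<eta>
    proof -
      obtain K where K: "\<forall>k\<ge>K. \<forall>n. \<bar>Q n u - q n (u k)\<bar> \<le> \<eta> / 2"
        using near[OF u(1), of "\<eta> / 2"] pos by auto
      have "\<forall>\<^sub>F n in sequentially. 1 - \<eta> / 2 < Q n u"
        using pos by (intro order_tendstoD(1)[OF lim]) simp
      then have "\<forall>\<^sub>F n in sequentially. 1 - \<eta> \<le> q n (u k)" if "k \<ge> K" for k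
      proof eventually_elim
        case (elim n)
        have "\<bar>Q n u - q n (u k)\<bar> \<le> \<eta> / 2" using K that by blast
        with elim show ?case by linarith
      qed
      then show ?thesis by blast
    qed
    ultimately obtain n where n: "\<exists>\<^sub>\<infinity>m. \<forall>v\<in>S. \<bar>q n v - q m v\<bar> \<le> \<delta> * N v"
      using net[OF u, of q \<delta>] \<open>0 < \<delta>\<close> by blast
    have "\<bar>Q n h - Q m h\<bar> \<le> \<delta>"
      if m: "\<forall>v\<in>S. \<bar>q n v - q m v\<bar> \<le> \<delta> * N v" and h: "h \<in> cauchys" "lim_norm h \<le> 1" for m h
    proof -
      have conv: "(\<lambda>k. q n (h k)) \<longlonglongrightarrow> Q n h" for n
      proof (rule LIMSEQ_I)
        fix r :: real
        assume "0 < r"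
        then obtain K where K: "\<forall>k\<ge>K. \<forall>n. \<bar>Q n h - q n (h k)\<bar> \<le> r / 2"
          using near[OF h(1), of "r / 2"] by auto
        have "norm (q n (h k) - Q n h) < r" if "k \<ge> K" for k
        proof -
          have "\<bar>Q n h - q n (h k)\<bar> \<le> r / 2" using K that by blast
          then show ?thesis using \<open>0 < r\<close> unfolding real_norm_def by linarith
        qed
        then show "\<exists>no. \<forall>k\<ge>no. norm (q n (h k) - Q n h) < r"
          by blast
      qed
      have "(\<lambda>k. \<bar>q n (h k) - q m (h k)\<bar>) \<longlonglongrightarrow> \<bar>Q n h - Q m h\<bar>"
        by (intro tendsto_intros conv)
      moreover have "(\<lambda>k. \<delta> * N (h k)) \<longlonglongrightarrow> \<delta> * lim_norm h"
        by (intro tendsto_intros lim_norm h)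
      ultimately have "\<bar>Q n h - Q m h\<bar> \<le> \<delta> * lim_norm h"
        using m cauchysD[OF h(1)] by (intro LIMSEQ_le) auto
      also have "\<dots> \<le> \<delta> * 1"
        using h \<open>0 < \<delta>\<close> by (intro mult_left_mono) auto
      finally show ?thesis by simp
    qed
    then have "\<exists>\<^sub>\<infinity>m. \<forall>h\<in>cauchys. lim_norm h \<le> 1 \<longrightarrow> \<bar>Q n h - Q m h\<bar> \<le> \<delta>"
      by (intro frequently_mono[OF _ n]) blast
    then show ?thesis by blast
  qed
  show ?thesis
    unfolding strongly_subdifferentiable_def
  proof
    fix x
    assume "x \<in> unit_sphere ?C"
    then obtain u where u: "u \<in> cauchys" "x = cls u" "lim_norm u = 1"
      by (auto simp: unit_sphere_def completion_carrier completion_norm)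
    \<comment> \<open>The limit function has to depend on the class alone, so \<open>slope\<close>
      is evaluated at a chosen representative.\<close>
    define rep where "rep P = (SOME h. h \<in> cauchys \<and> P = cls h)" for P
    have rep: "rep P \<in> cauchys \<and> P = cls (rep P) \<and> lim_norm (rep P) \<le> 1" if "P \<in> unit_ball ?C" for P
    proof -
      have "\<exists>h. h \<in> cauchys \<and> P = cls h"
        using that by (auto simp: unit_ball_def completion_carrier)
      then have "rep P \<in> cauchys \<and> P = cls (rep P)"
        unfolding rep_def by (rule someI_ex)
      then show ?thesis
        using that completion_norm[of "rep P"] by (auto simp: unit_ball_def)
    qed
    have "uniform_limit (unit_ball ?C)
        (\<lambda>t h. (vnorm ?C (vadd ?C x (vscale ?C (of_real t) h)) - 1) / t)
        (\<lambda>P. seq.slope u (rep P)) (at_right 0)"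
      unfolding uniform_limit_iff
    proof (intro allI impI)
      fix e :: real
      assume "0 < e"
      then obtain t0 where t0: "t0 > 0"
          "\<And>t h. 0 < t \<Longrightarrow> t \<le> t0 \<Longrightarrow> h \<in> cauchys \<Longrightarrow> lim_norm h \<le> 1
             \<Longrightarrow> \<bar>seq.quot u t h - seq.slope u h\<bar> \<le> e / 2"
        using seq.uniform_quot_limit[OF u(1,3) key[OF u(1,3)], of "e / 2"] by auto
      have "dist ((vnorm ?C (vadd ?C x (vscale ?C (of_real t) P)) - 1) / t) (seq.slope u (rep P)) < e"
        if t: "0 < t" "t \<le> t0" and P: "P \<in> unit_ball ?C" for t P
      proof -
        have "vnorm ?C (vadd ?C x (vscale ?C (of_real t) P)) = lim_norm (u + t *\<^sub>R rep P)"
          using rep[OF P] u completion_scale[of "rep P" t] completion_add[of u "t *\<^sub>R rep P"]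
            subspace_scale[OF seq.subspace, of "rep P" t] completion_norm[of "u + t *\<^sub>R rep P"]
            add_cauchys[of u "t *\<^sub>R rep P"]
          by simp
        then show ?thesis
          using t0(2)[OF t, of "rep P"] rep[OF P] \<open>0 < e\<close> by (simp add: seq.quot_def dist_real_def)
      qed
      then show "\<forall>\<^sub>F t in at_right 0. \<forall>P\<in>unit_ball ?C.
          dist ((vnorm ?C (vadd ?C x (vscale ?C (of_real t) P)) - 1) / t) (seq.slope u (rep P)) < e"
        using t0(1) unfolding eventually_at_right_field by (meson less_imp_le)
    qed
    then show "\<exists>L. uniform_limit (unit_ball ?C)
        (\<lambda>t h. (vnorm ?C (vadd ?C x (vscale ?C (of_real t) h)) - 1) / t) L (at_right 0)"
      by blast
  qed
qed

end

section \<open>Lattices of scalar functions and quadratic forms on them\<close>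

definition proj :: "'i set \<Rightarrow> ('i \<Rightarrow> 'k) \<Rightarrow> 'i \<Rightarrow> 'k::real_normed_field" where
  "proj F x = (\<lambda>i. if i \<in> F then x i else 0)"

definition single :: "'i \<Rightarrow> 'k \<Rightarrow> 'i \<Rightarrow> 'k::real_normed_field" where
  "single i c = (\<lambda>j. if j = i then c else 0)"

definition supp :: "('i \<Rightarrow> 'k::real_normed_field) \<Rightarrow> 'i set" where
  "supp x = {i. x i \<noteq> 0}"

definition orth :: "('i \<Rightarrow> 'k::real_normed_field) \<Rightarrow> ('i \<Rightarrow> 'k) \<Rightarrow> bool" where
  "orth x y \<longleftrightarrow> (\<forall>i. x i = 0 \<or> y i = 0)"

lemma proj_split: "x = proj F x + proj (- F) x"
  by (auto simp: proj_def fun_eq_iff)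

lemma subspace_orth: "subspace {w. orth z w}"
  unfolding subspace_def orth_def by (auto, metis add.right_neutral)

lemma orth_smul: "orth z w \<Longrightarrow> orth z (smul c w)"
  by (auto simp: orth_def)

lemma single_smul: "single i c = smul c (single i 1)"
  by (auto simp: single_def fun_eq_iff)

lemma linear_single: "linear (single i)"
  by (intro linearI) (auto simp: single_def fun_eq_iff)

text \<open>Pigeonhole for one t at a time: the integer part of \<open>f n t / \<kappa> t\<close>
  takes finitely many values, and equal integer parts put the values within
  \<open>\<kappa> t\<close>.\<close>

lemma infinite_subset_close:
  fixes f :: "nat \<Rightarrow> 't \<Rightarrow> real"
  assumes "finite T" "infinite I"
    and "\<And>n t. t \<in> T \<Longrightarrow> \<bar>f n t\<bar> \<le> M t" and "\<And>t. t \<in> T \<Longrightarrow> 0 < \<kappa> t"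
  shows "\<exists>J\<subseteq>I. infinite J \<and> (\<forall>n\<in>J. \<forall>m\<in>J. \<forall>t\<in>T. \<bar>f n t - f m t\<bar> \<le> \<kappa> t)"
  using assms
proof (induction T rule: finite_induct)
  case empty
  then show ?case by blast
next
  case (insert t T)
  then obtain J where J: "J \<subseteq> I" "infinite J"
      and close: "\<And>n m s. n \<in> J \<Longrightarrow> m \<in> J \<Longrightarrow> s \<in> T \<Longrightarrow> \<bar>f n s - f m s\<bar> \<le> \<kappa> s"
    by (metis insertCI)
  have \<kappa>: "\<kappa> t > 0" and bound: "\<bar>f n t\<bar> \<le> M t" for n
    using insert.prems by auto
  define g where "g n = \<lfloor>f n t / \<kappa> t\<rfloor>" for n
  have "g ` J \<subseteq> {\<lfloor>- M t / \<kappa> t\<rfloor>..\<lfloor>M t / \<kappa> t\<rfloor>}"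
  proof
    fix y
    assume "y \<in> g ` J"
    then obtain n where "y = \<lfloor>f n t / \<kappa> t\<rfloor>" by (auto simp: g_def)
    moreover have "- M t / \<kappa> t \<le> f n t / \<kappa> t" "f n t / \<kappa> t \<le> M t / \<kappa> t"
      using bound[of n] \<kappa> by (intro divide_right_mono; linarith)+
    ultimately show "y \<in> {\<lfloor>- M t / \<kappa> t\<rfloor>..\<lfloor>M t / \<kappa> t\<rfloor>}"
      by (auto intro: floor_mono)
  qed
  then have "finite (g ` J)" by (rule finite_subset) simp
  then obtain n0 where n0: "infinite {n \<in> J. g n = g n0}"
    using pigeonhole_infinite[OF J(2)] by auto
  have "\<bar>f n t - f m t\<bar> \<le> \<kappa> t" if "g n = g n0" "g m = g n0" for n m
  proof -
    have "\<bar>f n t / \<kappa> t - f m t / \<kappa> t\<bar> \<le> 1"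
      using that unfolding g_def by linarith
    then have "\<bar>(f n t - f m t) / \<kappa> t\<bar> \<le> 1"
      by (simp add: diff_divide_distrib)
    then show ?thesis using \<kappa> by (simp add: abs_divide)
  qed
  then show ?case
    using n0 J close by (intro exI[of _ "{n \<in> J. g n = g n0}"]) auto
qed

lemma linear_le_basis:
  fixes g :: "'k::euclidean_space \<Rightarrow> real" and C :: real
  assumes g: "linear g" and C: "\<And>b. b \<in> Basis \<Longrightarrow> \<bar>g b\<bar> \<le> C"
  shows "\<bar>g c\<bar> \<le> real DIM('k) * C * norm c"
proof -
  have "g c = g (\<Sum>b\<in>Basis. (c \<bullet> b) *\<^sub>R b)"
    by (simp add: euclidean_representation)
  also have "\<dots> = (\<Sum>b\<in>Basis. (c \<bullet> b) * g b)"
    by (simp add: linear_sum[OF g] linear_scale[OF g])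
  also have "\<bar>\<dots>\<bar> \<le> (\<Sum>b\<in>Basis. \<bar>(c \<bullet> b) * g b\<bar>)"
    by (rule sum_abs)
  also have "\<dots> \<le> (\<Sum>b\<in>(Basis :: 'k set). norm c * C)"
    unfolding abs_mult by (intro sum_mono mult_mono C Basis_le_norm) auto
  finally show ?thesis by (simp add: mult_ac)
qed

text \<open>The index type is arbitrary so that the sum of two lattices, indexed by
  \<open>'i + 'j\<close>, is again an instance; the scalar class covers the real and the complex
  field at once.\<close>

locale function_lattice = function_seminorm S N
  for S :: "('i \<Rightarrow> 'k::{real_normed_field,euclidean_space}) set" and N +
  assumes definite: "x \<in> S \<Longrightarrow> N x = 0 \<Longrightarrow> x = 0"
    and solid: "x \<in> S \<Longrightarrow> (\<And>k. norm (y k) \<le> norm (x k)) \<Longrightarrow> y \<in> S \<and> N y \<le> N x"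
    and single_in: "single i c \<in> S"
begin

lemma proj_in: "x \<in> S \<Longrightarrow> proj F x \<in> S"
  and N_proj: "x \<in> S \<Longrightarrow> N (proj F x) \<le> N x"
  using solid[of x "proj F x"] by (auto simp: proj_def)

lemma N_single_le: "x \<in> S \<Longrightarrow> N (single i (x i)) \<le> N x"
  using solid[of x "single i (x i)"] by (auto simp: single_def)

lemma N_single: "N (single i c) = norm c * N (single i 1)"
  using N_smul[OF single_in[of i 1], of c] single_smul[of i c] by simp

lemma N_single_pos: "N (single i 1) > 0"
proof -
  have "single i (1::'k) \<noteq> 0"
    by (auto simp: single_def fun_eq_iff)
  then show ?thesis
    using definite[OF single_in[of i 1]] nonneg[OF single_in[of i 1]] by fastforce
qed

lemma proj_bound:
  assumes "finite F" "x \<in> S"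
    and add: "\<And>u v. u \<in> S \<Longrightarrow> v \<in> S \<Longrightarrow> b (u + v) = b u + b v"
    and C: "\<And>i. \<bar>b (single i (x i))\<bar> \<le> C"
  shows "\<bar>b (proj F x)\<bar> \<le> real (card F) * C"
  using \<open>finite F\<close>
proof (induction F rule: finite_induct)
  case empty
  have "proj {} x = 0" by (auto simp: proj_def fun_eq_iff)
  then have "b (proj {} x) = 0" using add[OF zero_in zero_in] by (simp only:) simp
  then show ?case by (simp only: abs_zero card.empty)
next
  case (insert i F)
  have "proj (insert i F) x = single i (x i) + proj F x"
    using insert by (auto simp: proj_def single_def fun_eq_iff)
  then have "b (proj (insert i F) x) = b (single i (x i)) + b (proj F x)"
    using add[OF single_in proj_in[OF \<open>x \<in> S\<close>]] by simp
  then show ?case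
    using insert C[of i] by (simp add: algebra_simps)
qed

text \<open>Models the real part of a symmetric bilinear form. The rule that moves a scalar from one
  argument to the other is what scalar bilinearity leaves when only the real part is kept. The bound
  is imposed on the diagonal alone, as for the sup norm of a 2-homogeneous polynomial.\<close>

definition form :: "(('i \<Rightarrow> 'k) \<Rightarrow> ('i \<Rightarrow> 'k) \<Rightarrow> real) \<Rightarrow> bool" where
  "form a \<longleftrightarrow>
     (\<forall>x\<in>S. \<forall>y\<in>S. a x y = a y x) \<and>
     (\<forall>x\<in>S. \<forall>y\<in>S. \<forall>z\<in>S. a (x + y) z = a x z + a y z) \<and>
     (\<forall>c. \<forall>x\<in>S. \<forall>y\<in>S. a (smul c x) y = a x (smul c y)) \<and>
     (\<forall>r. \<forall>x\<in>S. \<forall>y\<in>S. a (r *\<^sub>R x) y = r * a x y) \<and>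
     (\<forall>x\<in>S. \<bar>a x x\<bar> \<le> (N x)\<^sup>2)"

context
  fixes a
  assumes a: "form a"
begin

lemma form_commute: "x \<in> S \<Longrightarrow> y \<in> S \<Longrightarrow> a x y = a y x"
  and form_add_left: "x \<in> S \<Longrightarrow> y \<in> S \<Longrightarrow> z \<in> S \<Longrightarrow> a (x + y) z = a x z + a y z"
  and form_smul: "x \<in> S \<Longrightarrow> y \<in> S \<Longrightarrow> a (smul c x) y = a x (smul c y)"
  and form_scale_left: "x \<in> S \<Longrightarrow> y \<in> S \<Longrightarrow> a (r *\<^sub>R x) y = r * a x y"
  and form_le: "x \<in> S \<Longrightarrow> \<bar>a x x\<bar> \<le> (N x)\<^sup>2"
  using a unfolding form_def by blast+

lemma form_add_right: "x \<in> S \<Longrightarrow> y \<in> S \<Longrightarrow> z \<in> S \<Longrightarrow> a z (x + y) = a z x + a z y"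
  by (simp add: form_commute[of z] form_add_left add_in)

lemma form_scale_right: "x \<in> S \<Longrightarrow> y \<in> S \<Longrightarrow> a y (r *\<^sub>R x) = r * a y x"
  by (simp add: form_commute[of y] form_scale_left subspace_scale[OF subspace])

lemma form_minus_left: "x \<in> S \<Longrightarrow> y \<in> S \<Longrightarrow> a (- x) y = - a x y"
  using form_scale_left[of x y "-1"] by simp

lemma form_minus_right: "x \<in> S \<Longrightarrow> y \<in> S \<Longrightarrow> a y (- x) = - a y x"
  using form_scale_right[of x y "-1"] by simp

lemma form_zero_left: "y \<in> S \<Longrightarrow> a 0 y = 0"
  using form_scale_left[OF zero_in, of y 0] by simp

lemma form_zero_right: "y \<in> S \<Longrightarrow> a y 0 = 0"
  using form_scale_right[OF zero_in, of y 0] by simp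

lemma form_square_add: "x \<in> S \<Longrightarrow> y \<in> S \<Longrightarrow> a (x + y) (x + y) = a x x + 2 * a x y + a y y"
  by (simp add: form_add_left form_add_right add_in form_commute[of y x])

lemma form_square_diff: "x \<in> S \<Longrightarrow> y \<in> S \<Longrightarrow> a (x - y) (x - y) = a x x - 2 * a x y + a y y"
  using form_square_add[of x "- y"] subspace_neg[OF subspace, of y]
  by (simp add: form_minus_left form_minus_right)

text \<open>Stated on a subspace so that it applies to the vectors orthogonal to some z. For
  normalized x, y the sum and the difference have norm at most 2, so 4 |a x y| <= 2 * 4 \<beta>,
  whence the factor 2.\<close>

lemma form_polarization:
  assumes T: "subspace T" "T \<subseteq> S" and \<beta>: "\<And>x. x \<in> T \<Longrightarrow> \<bar>a x x\<bar> \<le> \<beta> * (N x)\<^sup>2"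
    and xy: "x \<in> T" "y \<in> T"
  shows "\<bar>a x y\<bar> \<le> 2 * \<beta> * N x * N y"
proof -
  have xyS: "x \<in> S" "y \<in> S" using xy T by auto
  show ?thesis
  proof (cases "N x = 0 \<or> N y = 0")
    case True
    then have "x = 0 \<or> y = 0" using definite xyS by auto
    then show ?thesis
      using xyS by (auto simp: form_zero_left form_zero_right zero)
  next
    case False
    then have pos: "N x > 0" "N y > 0"
      using nonneg[OF xyS(1)] nonneg[OF xyS(2)] by auto
    define x' where "x' = (1 / N x) *\<^sub>R x"
    define y' where "y' = (1 / N y) *\<^sub>R y"
    have T': "x' \<in> T" "y' \<in> T" "x' + y' \<in> T" "x' - y' \<in> T"
      unfolding x'_def y'_def using xy T by (auto intro: subspace_add subspace_diff subspace_scale)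
    then have S': "x' \<in> S" "y' \<in> S" using T by auto
    have one: "N x' = 1" "N y' = 1"
      using pos scaleR[OF xyS(1), of "1 / N x"] scaleR[OF xyS(2), of "1 / N y"]
      by (auto simp: x'_def y'_def)
    have "N (x' + y') \<le> 2" "N (x' - y') \<le> 2"
      using triangle[OF S'] triangle_diff[OF S'] one by auto
    then have sq: "(N (x' + y'))\<^sup>2 \<le> 2\<^sup>2" "(N (x' - y'))\<^sup>2 \<le> 2\<^sup>2"
      using nonneg T' T by (intro power_mono; blast)+
    have "\<beta> * 1 \<ge> 0"
      using \<beta>[OF T'(1)] one by simp
    then have "\<beta> \<ge> 0" by simp
    have "\<bar>a (x' + y') (x' + y')\<bar> \<le> \<beta> * 2\<^sup>2" "\<bar>a (x' - y') (x' - y')\<bar> \<le> \<beta> * 2\<^sup>2"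
      using \<beta>[OF T'(3)] \<beta>[OF T'(4)] mult_left_mono[OF sq(1) \<open>\<beta> \<ge> 0\<close>]
        mult_left_mono[OF sq(2) \<open>\<beta> \<ge> 0\<close>] by linarith+
    moreover have "4 * a x' y' = a (x' + y') (x' + y') - a (x' - y') (x' - y')"
      using S' by (simp add: form_square_add form_square_diff)
    ultimately have "\<bar>a x' y'\<bar> \<le> 2 * \<beta>" by (simp add: power2_eq_square)
    moreover have "a x' y' = a x y / (N x * N y)"
      using xyS subspace_scale[OF subspace] by (simp add: x'_def y'_def form_scale_left form_scale_right)
    ultimately show ?thesis
      using pos by (simp add: abs_divide abs_mult field_simps)
  qed
qed

lemma form_bound:
  assumes "x \<in> S" "y \<in> S"
  shows "\<bar>a x y\<bar> \<le> 2 * N x * N y"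
  using form_polarization[OF subspace order_refl, of 1 x y] form_le assms by simp

end

text \<open>Rigidity makes slices of the dual ball totally bounded: up to small errors a form that almost
  attains its norm at \<open>z\<close> lives on finitely many coordinates.\<close>

definition rigid :: "(('i \<Rightarrow> 'k) \<Rightarrow> ('i \<Rightarrow> 'k) \<Rightarrow> real) set \<Rightarrow> bool" where
  "rigid \<A> \<longleftrightarrow> (\<forall>\<delta>>0. \<exists>\<eta>>0. \<forall>a\<in>\<A>. \<forall>z\<in>S. N z \<le> 1 \<and> 1 - \<eta> \<le> a z z \<longrightarrow>
     (\<forall>w\<in>S. orth z w \<longrightarrow> (\<forall>v\<in>S. orth z v \<longrightarrow> \<bar>a v w\<bar> \<le> \<delta> * N v * N w) \<and>
        (\<forall>i c. \<bar>a (single i c) w\<bar> \<le> \<delta> * N (single i c) * N w)))"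

text \<open>On finitely many coordinates a form is determined by finitely many bounded real numbers,
  its values at coordinate vectors with entries in \<open>Basis\<close>, and the pigeonhole
  principle applies to these.\<close>

lemma finite_block_close:
  assumes a: "\<And>n::nat. form (a n)" and F: "finite F" and I: "infinite I" and \<delta>: "\<delta> > 0"
  shows "\<exists>J\<subseteq>I. infinite J \<and> (\<forall>n\<in>J. \<forall>m\<in>J. \<forall>v\<in>S. \<forall>w\<in>S.
    \<bar>a n (proj F v) (proj F w) - a m (proj F v) (proj F w)\<bar> \<le> \<delta> * N v * N w)"
proof -
  define E where "E i = N (single i 1)" for i
  have E: "E i > 0" for i by (simp add: E_def N_single_pos)
  define D where "D = real DIM('k)"
  have D: "D > 0" by (simp add: D_def)
  define C where "C = real (card F) + 1"
  have C: "C > 0" by (simp add: C_def add_nonneg_pos)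
  define T where "T = (F \<times> F) \<times> ((Basis :: 'k set) \<times> (Basis :: 'k set))"
  define f where "f n = (\<lambda>((i, j), (b, b')). a n (single i b) (single j b'))" for n
  \<comment> \<open>Expanding the two scalars over \<open>Basis\<close> costs a factor D each, and
    expanding the two vectors over F a factor at most C each; the tolerance compensates for exactly
    this. The 1 added in C keeps it positive when F is empty.\<close>
  define \<kappa> where "\<kappa> = (\<lambda>((i, j), (b :: 'k, b' :: 'k)). \<delta> * E i * E j / (D\<^sup>2 * C\<^sup>2))"
  define M where "M = (\<lambda>((i, j), (b, b')). 2 * N (single i b) * N (single j b'))"
  have "\<bar>f n t\<bar> \<le> M t" for n t
    by (cases t) (auto simp: f_def M_def split: prod.split intro!: form_bound[OF a] single_in)
  moreover have "0 < \<kappa> t" for t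
    using E \<delta> C D by (cases t) (auto simp: \<kappa>_def intro!: divide_pos_pos mult_pos_pos)
  moreover have "finite T" using F by (simp add: T_def)
  ultimately obtain J where J: "J \<subseteq> I" "infinite J"
      and close: "\<And>n m t. n \<in> J \<Longrightarrow> m \<in> J \<Longrightarrow> t \<in> T \<Longrightarrow> \<bar>f n t - f m t\<bar> \<le> \<kappa> t"
    using infinite_subset_close[of T I f M \<kappa>] I by metis
  have "\<bar>a n (proj F v) (proj F w) - a m (proj F v) (proj F w)\<bar> \<le> \<delta> * N v * N w"
    if nm: "n \<in> J" "m \<in> J" and vw: "v \<in> S" "w \<in> S" for n m v w
  proof -
    define d where "d x y = a n x y - a m x y" for x y
    have d_add: "d (x + y) z = d x z + d y z" "d z (x + y) = d z x + d z y"
      if "x \<in> S" "y \<in> S" "z \<in> S" for x y z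
      using that by (simp_all add: d_def form_add_left[OF a] form_add_right[OF a])
    have d_scale: "d (r *\<^sub>R x) z = r * d x z" "d z (r *\<^sub>R x) = r * d z x"
      if "x \<in> S" "z \<in> S" for x z r
      using that by (simp_all add: d_def form_scale_left[OF a] form_scale_right[OF a] algebra_simps)
    have lin_left: "linear (\<lambda>c. d (single i c) z)" if "z \<in> S" for i z
      using that by (intro linearI) (simp_all add: linear_add[OF linear_single]
          linear_scale[OF linear_single] d_add d_scale single_in)
    have lin_right: "linear (\<lambda>c. d z (single i c))" if "z \<in> S" for i z
      using that by (intro linearI) (simp_all add: linear_add[OF linear_single]
          linear_scale[OF linear_single] d_add d_scale single_in)
    have s1: "\<bar>d (single i b) (single j b')\<bar> \<le> \<delta> * E i * E j / (D\<^sup>2 * C\<^sup>2)"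
      if "i \<in> F" "j \<in> F" "b \<in> Basis" "b' \<in> Basis" for i j b b'
      using close[OF nm, of "((i, j), (b, b'))"] that by (simp add: d_def T_def f_def \<kappa>_def)
    have s2: "\<bar>d (single i c) (single j b')\<bar> \<le> D * (\<delta> * E i * E j / (D\<^sup>2 * C\<^sup>2)) * norm c"
      if "i \<in> F" "j \<in> F" "b' \<in> Basis" for i j c b'
      using linear_le_basis[OF lin_left[OF single_in, of i j b'] s1[OF that(1,2) _ that(3)], of c]
      by (simp add: D_def)
    have s3: "\<bar>d (single i c) (single j c')\<bar>
        \<le> D * (D * (\<delta> * E i * E j / (D\<^sup>2 * C\<^sup>2)) * norm c) * norm c'"
      if "i \<in> F" "j \<in> F" for i j c c'
      using linear_le_basis[OF lin_right[OF single_in, of i c j] s2[OF that], of c']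
      by (simp add: D_def)
    have s4: "\<bar>d (single i (v i)) (single j (w j))\<bar> \<le> \<delta> * N v * N w / C\<^sup>2"
      if ij: "i \<in> F" "j \<in> F" for i j
    proof -
      have "\<bar>d (single i (v i)) (single j (w j))\<bar> \<le> \<delta> * (norm (v i) * E i) * (norm (w j) * E j) / C\<^sup>2"
        using s3[OF ij, of "v i" "w j"] D by (simp add: field_simps power2_eq_square)
      also have "norm (v i) * E i = N (single i (v i))"
        using N_single[of i "v i"] by (simp add: E_def)
      also have "norm (w j) * E j = N (single j (w j))"
        using N_single[of j "w j"] by (simp add: E_def)
      also have "\<delta> * N (single i (v i)) * N (single j (w j)) / C\<^sup>2 \<le> \<delta> * N v * N w / C\<^sup>2"
        using \<delta> nonneg[OF single_in] nonneg[OF vw(1)] nonneg[OF vw(2)] vw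
        by (intro divide_right_mono mult_mono mult_nonneg_nonneg order_refl N_single_le single_in) auto
      finally show ?thesis .
    qed
    have pos: "0 \<le> \<delta> * N v * N w" using \<delta> nonneg vw by simp
    define v' where "v' = proj F v"
    define w' where "w' = proj F w"
    have v': "v' \<in> S" "w' \<in> S" unfolding v'_def w'_def using vw by (auto intro: proj_in)
    have c: "real (card F) * x \<le> C * x" if "x \<ge> 0" for x
      using that by (simp add: C_def algebra_simps)
    have s5: "\<bar>d (single i (v i)) w'\<bar> \<le> \<delta> * N v * N w / C" if "i \<in> F" for i
    proof -
      have eq: "proj F w' = w'" "single j (w' j) = (if j \<in> F then single j (w j) else 0)" for j
        by (auto simp: w'_def proj_def single_def fun_eq_iff)
      have d0: "d z 0 = 0" if "z \<in> S" for z
        using d_scale(2)[OF zero_in that, of 0] by simp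
      have "\<bar>d (single i (v i)) (proj F w')\<bar> \<le> real (card F) * (\<delta> * N v * N w / C\<^sup>2)"
        using s4[OF that] pos
        by (intro proj_bound[OF F v'(2)] d_add single_in) (auto simp: eq d0 single_in)
      also have "\<dots> \<le> C * (\<delta> * N v * N w / C\<^sup>2)"
        using pos by (intro c) simp
      also have "\<dots> = \<delta> * N v * N w / C"
        using C by (simp add: power2_eq_square)
      finally show ?thesis by (simp add: eq)
    qed
    have eq: "proj F v' = v'" "single j (v' j) = (if j \<in> F then single j (v j) else 0)" for j
      by (auto simp: v'_def proj_def single_def fun_eq_iff)
    have d0: "d 0 z = 0" if "z \<in> S" for z
      using d_scale(1)[OF zero_in that, of 0] by simp
    have "\<bar>d (proj F v') w'\<bar> \<le> real (card F) * (\<delta> * N v * N w / C)"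
      using s5 pos C v'
      by (intro proj_bound[OF F v'(1), of "\<lambda>x. d x w'"] d_add) (auto simp: eq d0)
    also have "\<dots> \<le> C * (\<delta> * N v * N w / C)"
      using pos C by (intro c) simp
    finally have "\<bar>d v' w'\<bar> \<le> \<delta> * N v * N w"
      using C by (simp add: eq)
    then show ?thesis by (simp only: d_def v'_def w'_def)
  qed
  then show ?thesis using J by blast
qed

text \<open>Two near-maximizers are used. The first, \<open>z1\<close>, fixes F and makes the forms
  small on pairs of vectors beyond F. The second, \<open>z2\<close>, controls the coordinates in F
  against vectors beyond its own support. What remains lives on the finite set G and is treated by
  \<open>finite_block_close\<close>.\<close>

lemma rigid_forms_close:
  assumes a: "\<And>n. form (a n)" "\<And>n. a n \<in> \<A>" and \<A>: "rigid \<A>"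
    and approx: "\<And>\<eta>. \<eta> > 0 \<Longrightarrow> \<exists>Z\<subseteq>S. finite Z \<and> (\<forall>z\<in>Z. N z \<le> 1 \<and> finite (supp z)) \<and>
      (\<forall>\<^sub>F n in sequentially. \<exists>z\<in>Z. 1 - \<eta> \<le> a n z z)"
    and \<delta>: "\<delta> > 0"
  shows "\<exists>J. infinite J \<and> (\<forall>n\<in>J. \<forall>m\<in>J. \<forall>x\<in>S. \<bar>a n x x - a m x x\<bar> \<le> \<delta> * (N x)\<^sup>2)"
proof -
  \<comment> \<open>Z is finite, so one of its elements is a near-maximizer for infinitely many n of
    any given infinite set.\<close>
  have near: "\<exists>z J. z \<in> S \<and> N z \<le> 1 \<and> finite (supp z) \<and> J \<subseteq> I \<and> infinite J \<and>
      (\<forall>n\<in>J. \<forall>w\<in>S. orth z w \<longrightarrow> (\<forall>v\<in>S. orth z v \<longrightarrow> \<bar>a n v w\<bar> \<le> \<epsilon> * N v * N w) \<and>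
        (\<forall>i c. \<bar>a n (single i c) w\<bar> \<le> \<epsilon> * N (single i c) * N w))"
    if I: "infinite I" and \<epsilon>: "\<epsilon> > 0" for I :: "nat set" and \<epsilon>
  proof -
    obtain \<eta> where \<eta>: "\<eta> > 0" and far: "\<forall>a\<in>\<A>. \<forall>z\<in>S. N z \<le> 1 \<and> 1 - \<eta> \<le> a z z \<longrightarrow>
        (\<forall>w\<in>S. orth z w \<longrightarrow> (\<forall>v\<in>S. orth z v \<longrightarrow> \<bar>a v w\<bar> \<le> \<epsilon> * N v * N w) \<and>
          (\<forall>i c. \<bar>a (single i c) w\<bar> \<le> \<epsilon> * N (single i c) * N w))"
      using \<A>[unfolded rigid_def, rule_format, OF \<epsilon>] by (elim exE conjE) (rule that)
    obtain Z where Z: "Z \<subseteq> S" "finite Z" "\<And>z. z \<in> Z \<Longrightarrow> N z \<le> 1 \<and> finite (supp z)"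
        and ev: "\<forall>\<^sub>F n in sequentially. \<exists>z\<in>Z. 1 - \<eta> \<le> a n z z"
      using approx[OF \<eta>] by (elim exE conjE) (rule that, auto)
    obtain n0 where n0: "\<And>n. n \<ge> n0 \<Longrightarrow> \<exists>z\<in>Z. 1 - \<eta> \<le> a n z z"
      using ev unfolding eventually_sequentially by blast
    have "infinite {n \<in> I. n \<ge> n0}"
    proof
      assume "finite {n \<in> I. n \<ge> n0}"
      then have "finite ({n \<in> I. n \<ge> n0} \<union> {..<n0})" by simp
      moreover have "I \<subseteq> {n \<in> I. n \<ge> n0} \<union> {..<n0}" by auto
      ultimately show False using I finite_subset by blast
    qed
    moreover have "\<forall>n\<in>{n \<in> I. n \<ge> n0}. \<exists>z\<in>Z. 1 - \<eta> \<le> a n z z" using n0 by simp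
    ultimately obtain z where z: "z \<in> Z" "infinite {n \<in> {n \<in> I. n \<ge> n0}. 1 - \<eta> \<le> a n z z}"
      using pigeonhole_infinite_rel[OF _ Z(2), of "{n \<in> I. n \<ge> n0}" "\<lambda>n z. 1 - \<eta> \<le> a n z z"] by blast
    let ?J = "{n \<in> {n \<in> I. n \<ge> n0}. 1 - \<eta> \<le> a n z z}"
    have zS: "z \<in> S" "N z \<le> 1" "finite (supp z)" using z Z by auto
    show ?thesis
    proof (rule exI[of _ z], rule exI[of _ ?J], intro conjI)
      show "\<forall>n\<in>?J. \<forall>w\<in>S. orth z w \<longrightarrow> (\<forall>v\<in>S. orth z v \<longrightarrow> \<bar>a n v w\<bar> \<le> \<epsilon> * N v * N w) \<and>
          (\<forall>i c. \<bar>a n (single i c) w\<bar> \<le> \<epsilon> * N (single i c) * N w)"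
        using bspec[OF far a(2)] zS by blast
    qed (use z zS in auto)
  qed
  \<comment> \<open>The difference of two forms at x costs 1 for (u, u), 2 for (u, v), 2 + 2 for (u,
    w) and 1 + 1 for the square of v + w.\<close>
  define \<epsilon> where "\<epsilon> = \<delta> / 9"
  have \<epsilon>: "\<epsilon> > 0" using \<delta> by (simp add: \<epsilon>_def)
  obtain z1 I1 where z1: "z1 \<in> S" "finite (supp z1)" "infinite I1"
      and far: "\<And>n v w. n \<in> I1 \<Longrightarrow> v \<in> S \<Longrightarrow> w \<in> S \<Longrightarrow> orth z1 v \<Longrightarrow> orth z1 w
        \<Longrightarrow> \<bar>a n v w\<bar> \<le> \<epsilon> * N v * N w"
    using near[OF infinite_UNIV_nat \<epsilon>] by (elim exE conjE) (rule that, auto)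
  define F where "F = supp z1"
  define C where "C = real (card F) + 1"
  have C: "C > 0" by (simp add: C_def add_nonneg_pos)
  \<comment> \<open>The accuracy is \<epsilon> / C because the coordinatewise bound will be summed
    over F, which is known only now.\<close>
  obtain z2 I2 where z2: "z2 \<in> S" "finite (supp z2)" "I2 \<subseteq> I1" "infinite I2"
      and mixed: "\<And>n w i c. n \<in> I2 \<Longrightarrow> w \<in> S \<Longrightarrow> orth z2 w
        \<Longrightarrow> \<bar>a n (single i c) w\<bar> \<le> \<epsilon> / C * N (single i c) * N w"
    using near[OF z1(3) divide_pos_pos[OF \<epsilon> C]] by (elim exE conjE) (rule that, auto)
  define G where "G = F \<union> supp z2"
  have fin: "finite F" "finite G" using z1 z2 by (auto simp: F_def G_def)
  obtain J where J: "J \<subseteq> I2" "infinite J"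
      and block: "\<And>n m v w. n \<in> J \<Longrightarrow> m \<in> J \<Longrightarrow> v \<in> S \<Longrightarrow> w \<in> S \<Longrightarrow>
        \<bar>a n (proj G v) (proj G w) - a m (proj G v) (proj G w)\<bar> \<le> \<epsilon> * N v * N w"
    using finite_block_close[of a, OF a(1) fin(2) z2(4) \<epsilon>] by blast
  have "\<bar>a n x x - a m x x\<bar> \<le> \<delta> * (N x)\<^sup>2" if nm: "n \<in> J" "m \<in> J" and x: "x \<in> S" for n m x
  proof -
    define u where "u = proj F x"
    define v where "v = proj (G - F) x"
    define w where "w = proj (- G) x"
    define X where "X = \<epsilon> * (N x)\<^sup>2"
    have S': "u \<in> S" "v \<in> S" "w \<in> S" "v + w \<in> S"
      unfolding u_def v_def w_def using x by (auto intro: proj_in add_in)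
    have N': "N u \<le> N x" "N v \<le> N x" "N w \<le> N x" "N (v + w) \<le> N x"
    proof -
      have "v + w = proj (- F) x"
        by (auto simp: v_def w_def G_def proj_def fun_eq_iff)
      then show "N (v + w) \<le> N x" using x by (simp add: N_proj)
    qed (use x in \<open>auto simp: u_def v_def w_def N_proj\<close>)
    have XX: "\<epsilon> * s * t \<le> X" if "0 \<le> s" "0 \<le> t" "s \<le> N x" "t \<le> N x" for s t
    proof -
      have "\<epsilon> * s * t \<le> \<epsilon> * N x * N x"
        using that \<epsilon> nonneg[OF x] by (intro mult_mono mult_nonneg_nonneg) auto
      then show ?thesis by (simp add: X_def power2_eq_square mult.assoc)
    qed
    have pG: "proj G u = u" "proj G v = v"
      by (auto simp: u_def v_def G_def proj_def fun_eq_iff)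
    have b1: "\<bar>a n u u - a m u u\<bar> \<le> X" "\<bar>a n u v - a m u v\<bar> \<le> X"
      using block[OF nm S'(1,1)] block[OF nm S'(1,2)] XX[of "N u" "N u"] XX[of "N u" "N v"] N' S' nonneg
      by (simp_all add: pG)
    have dj: "orth z1 (v + w)" "orth z2 w"
      by (auto simp: orth_def v_def w_def proj_def G_def F_def supp_def)
    have b2: "\<bar>a k (v + w) (v + w)\<bar> \<le> X" if "k \<in> J" for k
    proof -
      have "k \<in> I1" using that J z2 by auto
      then show ?thesis
        using far[OF _ S'(4,4) dj(1,1), of k] XX[of "N (v + w)" "N (v + w)"] N' S' nonneg
        by fastforce
    qed
    have b3: "\<bar>a k u w\<bar> \<le> X" if "k \<in> J" for k
    proof -
      have k: "k \<in> I2" using that J by auto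
      have "\<bar>a k (proj F x) w\<bar> \<le> real (card F) * (\<epsilon> / C * N x * N x)"
      proof (rule proj_bound[OF fin(1) x, of "\<lambda>y. a k y w"])
        fix i
        have "\<bar>a k (single i (x i)) w\<bar> \<le> \<epsilon> / C * N (single i (x i)) * N w"
          by (rule mixed[OF k S'(3) dj(2)])
        also have "\<dots> \<le> \<epsilon> / C * N x * N x"
          using \<epsilon> C x N' S' nonneg nonneg[OF single_in]
          by (intro mult_mono mult_nonneg_nonneg N_single_le order_refl) auto
        finally show "\<bar>a k (single i (x i)) w\<bar> \<le> \<epsilon> / C * N x * N x" .
      qed (use S' in \<open>auto intro: form_add_left[OF a(1)]\<close>)
      also have "\<dots> \<le> C * (\<epsilon> / C * N x * N x)"
        using \<epsilon> C nonneg[OF x] by (intro mult_right_mono) (auto simp: C_def)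
      also have "\<dots> = X"
        using C by (simp add: X_def power2_eq_square)
      finally show ?thesis by (simp add: u_def)
    qed
    have expand: "a k x x = a k u u + 2 * a k u v + 2 * a k u w + a k (v + w) (v + w)" for k
    proof -
      have "x = u + (v + w)"
        by (auto simp: u_def v_def w_def G_def proj_def fun_eq_iff)
      then have "a k x x = a k u u + 2 * a k u (v + w) + a k (v + w) (v + w)"
        using form_square_add[OF a(1) S'(1,4)] by metis
      then show ?thesis using S' by (simp add: form_add_right[OF a(1)])
    qed
    have "\<bar>a n x x - a m x x\<bar> \<le> 9 * X"
      using b1 b2[OF nm(1)] b2[OF nm(2)] b3[OF nm(1)] b3[OF nm(2)]
      unfolding expand[of n] expand[of m] by linarith
    then show ?thesis by (simp add: X_def \<epsilon>_def)
  qed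
  then show ?thesis using J by blast
qed

end

section \<open>Rigidity of forms\<close>

text \<open>All that is needed of \<open>p\<close>-convexity with constant one.\<close>

definition upper_estimate :: "real \<Rightarrow> ('i \<Rightarrow> 'k::real_normed_field) set \<Rightarrow> (('i \<Rightarrow> 'k) \<Rightarrow> real) \<Rightarrow> bool" where
  "upper_estimate p S N \<longleftrightarrow> (\<forall>z\<in>S. \<forall>w\<in>S. \<forall>t. orth z w \<and> N z \<le> 1 \<and> N w \<le> 1 \<and> 0 \<le> t \<and> t \<le> 1 \<longrightarrow>
     N (z + t *\<^sub>R w) \<le> 1 + t powr p)"

lemma exists_small_powr:
  fixes e \<epsilon> :: real
  assumes "e > 0" "\<epsilon> > 0"
  obtains t where "0 < t" "t \<le> 1" "t powr e \<le> \<epsilon>"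
proof
  define t where "t = min 1 (\<epsilon> powr (1 / e))"
  show t: "0 < t" "t \<le> 1" using assms by (auto simp: t_def)
  have "t powr e \<le> (\<epsilon> powr (1 / e)) powr e"
    using t assms by (intro powr_mono2) (auto simp: t_def)
  also have "\<dots> = \<epsilon>" using assms by (simp add: powr_powr)
  finally show "t powr e \<le> \<epsilon>" .
qed

locale complex_upper_lattice = function_lattice S N
  for S :: "('i \<Rightarrow> complex) set" and N +
  fixes p :: real
  assumes p: "p > 2" and upper: "upper_estimate p S N"
begin

lemma form_upper:
  assumes a: "form a" and zw: "z \<in> S" "w \<in> S" "orth z w" "N z \<le> 1" "N w \<le> 1" and t: "0 < t" "t \<le> 1"
  shows "a (z + t *\<^sub>R w) (z + t *\<^sub>R w) \<le> 1 + 3 * t powr p"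
proof -
  have "a (z + t *\<^sub>R w) (z + t *\<^sub>R w) \<le> (N (z + t *\<^sub>R w))\<^sup>2"
    using form_le[OF a shift_in[OF zw(1,2)], of t] by simp
  also have "\<dots> \<le> (1 + t powr p)\<^sup>2"
    using upper zw t nonneg[OF shift_in[OF zw(1,2)]] unfolding upper_estimate_def
    by (intro power_mono) auto
  also have "t powr p * t powr p \<le> t powr p * 1"
    using t p powr_mono2[of p t 1] by (intro mult_left_mono) auto
  then have "(1 + t powr p)\<^sup>2 \<le> 1 + 3 * t powr p"
    by (simp add: power2_eq_square algebra_simps)
  finally show ?thesis .
qed

text \<open>Averaging over z + t w and z - t w removes the cross term; dividing by t^2 turns the t^p
  of the upper estimate into t^(p - 2) and the defect \<eta> into \<eta> / t^2.\<close>

lemma disjoint_square_le: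
  assumes a: "form a" and z: "z \<in> S" "N z \<le> 1" "1 - \<eta> \<le> a z z"
    and w: "w \<in> S" "orth z w" "N w \<le> 1" and t: "0 < t" "t \<le> 1"
  shows "a w w \<le> 3 * t powr (p - 2) + \<eta> / t\<^sup>2"
proof -
  have m: "- w \<in> S" "orth z (- w)" "N (- w) \<le> 1"
    using w subspace_neg[OF subspace, of w] by (auto simp: minus orth_def)
  have "a (z + t *\<^sub>R w) (z + t *\<^sub>R w) + a (z + t *\<^sub>R (- w)) (z + t *\<^sub>R (- w))
      = 2 * a z z + 2 * (t * (t * a w w))"
    using z w subspace_scale[OF subspace]
    by (simp add: form_square_add[OF a] form_square_diff[OF a] form_scale_left[OF a] form_scale_right[OF a])
  then have "t\<^sup>2 * a w w \<le> 3 * t powr p + \<eta>"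
    using form_upper[OF a z(1) w(1,2) z(2) w(3) t] form_upper[OF a z(1) m(1,2) z(2) m(3) t] z(3)
    unfolding power2_eq_square by (simp add: algebra_simps)
  then have "a w w \<le> (3 * t powr p + \<eta>) / t\<^sup>2"
    using t by (simp add: field_simps)
  also have "\<dots> = 3 * t powr (p - 2) + \<eta> / t\<^sup>2"
    using t by (simp add: powr_diff add_divide_distrib)
  finally show ?thesis .
qed

text \<open>The previous bound on squares is one-sided; it becomes two-sided because replacing x by
  \<i> x changes the sign of a x x. Polarization does the rest.\<close>

lemma disjoint_form_le:
  assumes a: "form a" and z: "z \<in> S" "N z \<le> 1" "1 - \<eta> \<le> a z z" and t: "0 < t" "t \<le> 1"
    and vw: "v \<in> S" "orth z v" "w \<in> S" "orth z w"
  shows "\<bar>a v w\<bar> \<le> 2 * (3 * t powr (p - 2) + \<eta> / t\<^sup>2) * N v * N w"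
proof (rule form_polarization[OF a, of "S \<inter> {w. orth z w}"])
  let ?\<beta> = "3 * t powr (p - 2) + \<eta> / t\<^sup>2"
  show "subspace (S \<inter> {w. orth z w})"
    by (intro subspace_inter subspace subspace_orth)
  fix x
  assume "x \<in> S \<inter> {w. orth z w}"
  then have x: "x \<in> S" "orth z x" by auto
  show "\<bar>a x x\<bar> \<le> ?\<beta> * (N x)\<^sup>2"
  proof (cases "N x = 0")
    case True
    then show ?thesis using definite[OF x(1)] form_zero_left[OF a zero_in] by simp
  next
    case False
    then have pos: "N x > 0" using nonneg[OF x(1)] by simp
    have ii: "a (smul \<i> y) (smul \<i> y) = - a y y" if y: "y \<in> S" for y
    proof -
      have "smul \<i> (smul \<i> y) = - y" by (auto simp: fun_eq_iff)
      then show ?thesis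
        using form_smul[OF a y smul_in[OF y], of \<i> \<i>] form_minus_right[OF a y y] by simp
    qed
    have bound: "a y y \<le> ?\<beta>" if "y \<in> S" "orth z y" "N y \<le> 1" for y
      using disjoint_square_le[OF a z that t] .
    define y where "y = (1 / N x) *\<^sub>R x"
    have y: "y \<in> S" "orth z y" "N y = 1" "smul \<i> y \<in> S" "orth z (smul \<i> y)" "N (smul \<i> y) = 1"
      using x pos scaleR[OF x(1), of "1 / N x"] subspace_scale[OF subspace x(1)]
        N_smul[OF subspace_scale[OF subspace x(1)], of \<i>] subspace_scale[OF subspace_orth, of x z]
      by (auto simp: y_def smul_in orth_smul)
    have "\<bar>a y y\<bar> \<le> ?\<beta>"
      using bound[of y] bound[of "smul \<i> y"] y ii[of y] by (intro abs_leI) auto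
    moreover have "a y y = a x x / (N x)\<^sup>2"
      using x subspace_scale[OF subspace x(1)]
      by (simp add: y_def form_scale_left[OF a] form_scale_right[OF a] power2_eq_square)
    ultimately show ?thesis
      using pos by (simp add: abs_divide field_simps)
  qed
qed (use vw in auto)

lemma near_maximal_orthoint:
  assumes \<epsilon>: "\<epsilon> > 0"
  shows "\<exists>\<eta>>0. \<forall>a z v w. form a \<and> z \<in> S \<and> N z \<le> 1 \<and> 1 - \<eta> \<le> a z z \<and>
    v \<in> S \<and> orth z v \<and> w \<in> S \<and> orth z w \<longrightarrow> \<bar>a v w\<bar> \<le> \<epsilon> * N v * N w"
proof -
  \<comment> \<open>First t is fixed, then \<eta> of order t^2; the constants give 2 * (3 *
    \<epsilon> / 12 + \<epsilon> / 4) = \<epsilon>.\<close>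
  obtain t where t: "0 < t" "t \<le> 1" "t powr (p - 2) \<le> \<epsilon> / 12"
    by (rule exists_small_powr[of "p - 2" "\<epsilon> / 12"]) (use p \<epsilon> in auto)
  have "\<bar>a v w\<bar> \<le> \<epsilon> * N v * N w"
    if "form a" "z \<in> S" "N z \<le> 1" "1 - \<epsilon> * t\<^sup>2 / 4 \<le> a z z" "v \<in> S" "orth z v" "w \<in> S" "orth z w" for a z v w
  proof -
    have "\<bar>a v w\<bar> \<le> 2 * (3 * t powr (p - 2) + (\<epsilon> * t\<^sup>2 / 4) / t\<^sup>2) * N v * N w"
      by (rule disjoint_form_le[OF that(1-4) t(1,2) that(5-8)])
    also have "\<dots> \<le> \<epsilon> * N v * N w"
      using t that(5,7) nonneg by (intro mult_right_mono) auto
    finally show ?thesis .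
  qed
  then show ?thesis
    using t \<epsilon> by (intro exI[of _ "\<epsilon> * t\<^sup>2 / 4"]) auto
qed

text \<open>Here the scalars must be complex: multiplying the \<open>i\<close>-th coordinate of \<open>z\<close> by a unimodular
  number does not change the norm and moves \<open>z\<close> in the direction \<open>\<i> b\<close>, up to second order.\<close>

lemma rotate_coordinate:
  assumes a: "form a" and z: "z \<in> S" "N z \<le> 1" "1 - \<eta> \<le> a z z" and w: "w \<in> S" "orth z w" "N w \<le> 1"
    and t: "0 < t" "t \<le> 1" and \<beta>: "\<beta> = 3 * t powr (p - 2) + \<eta> / t\<^sup>2" "0 < \<beta>" "\<beta> \<le> 1"
    and b: "b = single i (z i)"
  shows "a (smul \<i> b) w \<le> 4 * sqrt \<beta>"
proof -
  define \<rho> where "\<rho> = sqrt \<beta>"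
  have \<rho>: "0 < \<rho>" "\<rho> \<le> 1" "\<beta> = \<rho> * \<rho>" using \<beta> by (auto simp: \<rho>_def)
  \<comment> \<open>\<sigma> is the sine of the rotation angle. With \<sigma> = \<rho> t the gain 4
    t \<sigma> a (\<i> b) w equals 4 t^2 \<rho> a (\<i> b) w, while both losses, 4 t^2 \<beta> and
    12 \<sigma>^2, are of order t^2 \<rho>^2; the quotient is 4 \<rho>.\<close>
  define \<sigma> where "\<sigma> = \<rho> * t"
  have \<sigma>: "0 < \<sigma>" "\<sigma> \<le> 1" using \<rho> t by (auto simp: \<sigma>_def mult_le_one)
  then have \<sigma>2: "0 \<le> \<sigma>\<^sup>2" "\<sigma>\<^sup>2 \<le> 1" by (auto simp: power_le_one)
  define c where "c = sqrt (1 - \<sigma>\<^sup>2)"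
  have c: "0 \<le> c" "c \<le> 1" "c\<^sup>2 = 1 - \<sigma>\<^sup>2"
    using \<sigma>2 by (auto simp: c_def)
  \<comment> \<open>This is the squared distance from 1 to u = c + \<i> \<sigma>, hence of second
    order in \<sigma>.\<close>
  define \<kappa> where "\<kappa> = 2 - 2 * c"
  have "1 - \<sigma>\<^sup>2 \<le> c"
    using c mult_left_mono[of c 1 c] by (simp add: power2_eq_square)
  then have \<kappa>: "0 \<le> \<kappa>" "\<kappa> \<le> 2 * \<sigma>\<^sup>2" using c by (auto simp: \<kappa>_def)
  define u where "u = Complex c \<sigma>"
  have u: "norm u = 1" "norm (cnj u) = 1" "(norm (u - 1))\<^sup>2 = \<kappa>" "(norm (cnj u - 1))\<^sup>2 = \<kappa>"
    using c(2,3) by (auto simp: u_def cmod_def \<kappa>_def power2_eq_square algebra_simps)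
  have b_in: "b \<in> S" "N b \<le> 1"
    using N_single_le[OF z(1), of i] z(2) by (auto simp: b single_in)
  define zz where "zz v = z + smul (v - 1) b" for v
  have zz: "zz v \<in> S" "N (zz v) \<le> 1" "orth (zz v) w" if "norm v = 1" for v
  proof -
    have "zz v k = (if k = i then v * z k else z k)" for k
      by (auto simp: zz_def b single_def algebra_simps)
    then have "norm (zz v k) = norm (z k)" and d: "zz v k = 0 \<longleftrightarrow> z k = 0" for k
      using that by (auto simp: norm_mult)
    then show "zz v \<in> S" "N (zz v) \<le> 1"
      using solid[OF z(1), of "zz v"] z(2) by auto
    show "orth (zz v) w" using w(2) d by (auto simp: orth_def)
  qed
  have m: "- w \<in> S" "N (- w) \<le> 1" "orth x (- w) \<longleftrightarrow> orth x w" for x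
    using w subspace_neg[OF subspace, of w] by (auto simp: minus orth_def)
  have P: "a (zz v) (zz v) = a z z + 2 * a z (smul (v - 1) b) + a (smul (v - 1) b) (smul (v - 1) b)" for v
    unfolding zz_def by (rule form_square_add[OF a z(1) smul_in[OF b_in(1)]])
  have quad: "\<bar>a (smul v b) (smul v b)\<bar> \<le> (norm v)\<^sup>2" for v
  proof -
    have "\<bar>a (smul v b) (smul v b)\<bar> \<le> (norm v * N b)\<^sup>2"
      using form_le[OF a smul_in[OF b_in(1)], of v] N_smul[OF b_in(1), of v] by simp
    also have "\<dots> \<le> (norm v * 1)\<^sup>2"
      using b_in nonneg by (intro power_mono mult_left_mono) auto
    finally show ?thesis by simp
  qed
  \<comment> \<open>For the two opposite rotations the first-order terms cancel, so together they
    lower the value of the form by at most 6 \<kappa> <= 12 \<sigma>^2.\<close>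
  have "(u - 1) + (cnj u - 1) = of_real (- \<kappa>)"
    by (simp add: u_def \<kappa>_def complex_eq_iff)
  then have "smul (u - 1) b + smul (cnj u - 1) b = (- \<kappa>) *\<^sub>R b"
    by (simp only: scaleR_eq_smul smul_algebra(4)[symmetric])
  then have "a z (smul (u - 1) b) + a z (smul (cnj u - 1) b) = - \<kappa> * a z b"
    by (metis form_add_right[OF a] form_scale_right[OF a] b_in(1) smul_in z(1))
  moreover have "\<bar>a z b\<bar> \<le> 2"
  proof -
    have "\<bar>a z b\<bar> \<le> 2 * N z * N b" by (rule form_bound[OF a z(1) b_in(1)])
    also have "\<dots> \<le> 2 * 1 * 1"
      using z b_in nonneg by (intro mult_mono) auto
    finally show ?thesis by simp
  qed
  then have "\<kappa> * a z b \<le> \<kappa> * 2" using \<kappa> by (intro mult_left_mono) auto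
  ultimately have sum_ge: "a (zz u) (zz u) + a (zz (cnj u)) (zz (cnj u)) \<ge> 2 * a z z - 12 * \<sigma>\<^sup>2"
    using P[of u] P[of "cnj u"] quad[of "u - 1"] quad[of "cnj u - 1"] u \<kappa> by (simp add: abs_le_iff)
  \<comment> \<open>The two rotated vectors differ by 2 \<sigma> \<i> b. Pairing the first with + t
    w and the second with - t w makes the cross terms add up to 4 t \<sigma> a (\<i> b) w.\<close>
  have "zz u = zz (cnj u) + (2 * \<sigma>) *\<^sub>R smul \<i> b"
    by (auto simp: zz_def fun_eq_iff u_def complex_eq_iff algebra_simps)
  then have cross: "a (zz u) w = a (zz (cnj u)) w + 2 * \<sigma> * a (smul \<i> b) w"
    using form_add_left[OF a zz(1)[OF u(2)] subspace_scale[OF subspace smul_in[OF b_in(1)]] w(1)]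
      form_scale_left[OF a smul_in[OF b_in(1)] w(1)] by metis
  have sq1: "a (zz u + t *\<^sub>R w) (zz u + t *\<^sub>R w) = a (zz u) (zz u) + 2 * (t * a (zz u) w) + t\<^sup>2 * a w w"
    using zz(1)[OF u(1)] w subspace_scale[OF subspace w(1)]
    by (simp add: form_square_add[OF a] form_scale_left[OF a] form_scale_right[OF a] power2_eq_square)
  have sq2: "a (zz (cnj u) + t *\<^sub>R (- w)) (zz (cnj u) + t *\<^sub>R (- w))
      = a (zz (cnj u)) (zz (cnj u)) - 2 * (t * a (zz (cnj u)) w) + t\<^sup>2 * a w w"
    using zz(1)[OF u(2)] w subspace_scale[OF subspace w(1)]
    by (simp add: form_square_diff[OF a] form_scale_left[OF a] form_scale_right[OF a] power2_eq_square)
  have up: "a (zz u + t *\<^sub>R w) (zz u + t *\<^sub>R w) \<le> 1 + 3 * t powr p"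
      "a (zz (cnj u) + t *\<^sub>R (- w)) (zz (cnj u) + t *\<^sub>R (- w)) \<le> 1 + 3 * t powr p"
    using u zz w m t by (intro form_upper[OF a]; simp)+
  have ww: "- \<beta> \<le> a w w"
  proof -
    have iw: "smul \<i> w \<in> S" "orth z (smul \<i> w)" "N (smul \<i> w) \<le> 1"
      using w by (auto simp: smul_in orth_smul N_smul)
    have "a (smul \<i> w) (smul \<i> w) = a w (- w)"
      using form_smul[OF a w(1) iw(1), of \<i>] by (simp add: smul_algebra) (simp add: smul_def fun_Compl_def)
    moreover have "a (smul \<i> w) (smul \<i> w) \<le> \<beta>"
      unfolding \<beta>(1) by (rule disjoint_square_le[OF a z iw t])
    ultimately show ?thesis
      using form_minus_right[OF a w(1) w(1)] by linarith
  qed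
  have t\<beta>: "t\<^sup>2 * \<beta> = 3 * t powr p + \<eta>"
    using t by (simp add: \<beta>(1) algebra_simps powr_diff)
  have "t\<^sup>2 * - \<beta> \<le> t\<^sup>2 * a w w"
    using ww by (intro mult_left_mono) auto
  moreover have "t * a (zz u) w = t * a (zz (cnj u)) w + 2 * (t * \<sigma> * a (smul \<i> b) w)"
    unfolding cross by (simp add: algebra_simps)
  ultimately have "4 * (t * \<sigma> * a (smul \<i> b) w) \<le> 4 * (t\<^sup>2 * \<beta>) + 12 * \<sigma>\<^sup>2"
    using up sum_ge sq1 sq2 t\<beta> z(3) by (simp add: algebra_simps)
  then have "(t\<^sup>2 * \<rho>) * a (smul \<i> b) w \<le> (t\<^sup>2 * \<rho>) * (4 * \<rho>)"
    by (simp add: \<sigma>_def \<rho>(3) power2_eq_square algebra_simps)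
  then show ?thesis
    using t \<rho>(1) unfolding \<rho>_def[symmetric] by (simp add: mult_le_cancel_left_pos)
qed

text \<open>The rotation bounds the form from above in the direction \<i> b only. An arbitrary
  scalar c is moved to the other argument as c / \<i>, and w may be replaced by its negative, which
  gives the absolute value.\<close>

lemma near_maximal_coordinate:
  assumes \<epsilon>: "\<epsilon> > 0"
  shows "\<exists>\<eta>>0. \<forall>a z w i c. form a \<and> z \<in> S \<and> N z \<le> 1 \<and> 1 - \<eta> \<le> a z z \<and> w \<in> S \<and> orth z w
    \<longrightarrow> \<bar>a (smul c (single i (z i))) w\<bar> \<le> \<epsilon> * norm c * N w"
proof -
  \<comment> \<open>Chosen so that 4 sqrt \<gamma> <= \<epsilon>; t and \<eta> below contribute
    \<gamma> / 2 each, so that \<beta> <= \<gamma>.\<close>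
  define \<gamma> where "\<gamma> = min 1 ((\<epsilon> / 4)\<^sup>2)"
  have \<gamma>: "0 < \<gamma>" "\<gamma> \<le> 1" "4 * sqrt \<gamma> \<le> \<epsilon>"
  proof -
    have "sqrt \<gamma> \<le> sqrt ((\<epsilon> / 4)\<^sup>2)" by (simp only: \<gamma>_def real_sqrt_le_iff min.cobounded2)
    also have "\<dots> = \<epsilon> / 4" using \<epsilon> by (subst real_sqrt_abs) simp
    finally show "4 * sqrt \<gamma> \<le> \<epsilon>" by simp
  qed (use \<epsilon> in \<open>auto simp: \<gamma>_def\<close>)
  obtain t where t: "0 < t" "t \<le> 1" "t powr (p - 2) \<le> \<gamma> / 6"
    by (rule exists_small_powr[of "p - 2" "\<gamma> / 6"]) (use p \<gamma> in auto)
  define \<eta> where "\<eta> = \<gamma> * t\<^sup>2 / 2"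
  have \<eta>: "\<eta> > 0" using \<gamma> t by (simp add: \<eta>_def)
  define \<beta> where "\<beta> = 3 * t powr (p - 2) + \<eta> / t\<^sup>2"
  have \<beta>: "0 < \<beta>" "\<beta> \<le> \<gamma>"
    using t \<eta> \<gamma> by (auto simp: \<beta>_def \<eta>_def intro!: add_nonneg_pos)
  have "\<bar>a (smul c (single i (z i))) w\<bar> \<le> \<epsilon> * norm c * N w"
    if a: "form a" and z: "z \<in> S" "N z \<le> 1" "1 - \<eta> \<le> a z z" and w: "w \<in> S" "orth z w" for a z w i c
  proof -
    define b where "b = single i (z i)"
    have b_in: "b \<in> S" by (simp add: b_def single_in)
    have le: "a (smul \<i> b) v \<le> \<epsilon> * N v" if v: "v \<in> S" "orth z v" for v
    proof (cases "N v = 0")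
      case True
      then show ?thesis
        using definite[OF v(1)] form_zero_right[OF a smul_in[OF b_in]] by simp
    next
      case False
      then have pos: "N v > 0" using nonneg[OF v(1)] by simp
      define v' where "v' = (1 / N v) *\<^sub>R v"
      have v': "v' \<in> S" "orth z v'" "N v' \<le> 1"
        using v pos scaleR[OF v(1), of "1 / N v"] subspace_scale[OF subspace v(1)]
          subspace_scale[OF subspace_orth, of v z]
        by (auto simp: v'_def)
      have "a (smul \<i> b) v' \<le> 4 * sqrt \<beta>"
        by (rule rotate_coordinate[OF a z v' t(1,2) \<beta>_def \<beta>(1) _ b_def]) (use \<beta>(2) \<gamma>(2) in simp)
      also have "\<dots> \<le> 4 * sqrt \<gamma>" using \<beta>(2) by simp
      finally have "a (smul \<i> b) v' \<le> \<epsilon>" using \<gamma>(3) by simp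
      then show ?thesis
        using pos form_scale_right[OF a v(1) smul_in[OF b_in], of \<i> "1 / N v"]
        by (simp add: v'_def field_simps)
    qed
    define v where "v = smul (c / \<i>) w"
    have v: "v \<in> S" "orth z v" "N v = norm c * N w"
      using w N_smul[OF w(1), of "c / \<i>"] by (auto simp: v_def smul_in orth_smul norm_divide norm_mult)
    have m: "- v \<in> S" "orth z (- v)" "N (- v) = norm c * N w"
      using v subspace_neg[OF subspace, of v] by (auto simp: minus orth_def)
    have "c / \<i> * \<i> = c" by (metis complex_i_not_zero nonzero_divide_eq_eq)
    then have "smul c b = smul (c / \<i>) (smul \<i> b)" by (simp only: smul_algebra(6))
    then have "a (smul c b) w = a (smul \<i> b) v"
      using form_smul[OF a smul_in[OF b_in] w(1), of "c / \<i>" \<i>] by (simp add: v_def)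
    then show ?thesis
      using le[OF v(1,2)] le[OF m(1,2)] form_minus_right[OF a v(1) smul_in[OF b_in], of \<i>] v(3) m(3)
      by (simp add: b_def abs_le_iff algebra_simps)
  qed
  then show ?thesis using \<eta> by blast
qed

text \<open>The rotation controls coordinate i only in proportion to the part b of z at i. If N b >=
  \<tau>, then \<open>single i c\<close> is a multiple of b and the bound is rescaled. If b is
  smaller, it is deleted from z: the rest is still a near-maximizer and is orthogonal to
  \<open>single i c\<close>, so the orthogonal case applies.\<close>

theorem rigid_forms: "rigid {a. form a}"
  unfolding rigid_def
proof (intro allI impI)
  fix \<delta> :: real
  assume \<delta>: "\<delta> > 0"
  obtain \<eta>1 where \<eta>1: "\<eta>1 > 0" and far: "\<And>a z v w. form a \<Longrightarrow> z \<in> S \<Longrightarrow> N z \<le> 1 \<Longrightarrow> 1 - \<eta>1 \<le> a z z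
      \<Longrightarrow> v \<in> S \<Longrightarrow> orth z v \<Longrightarrow> w \<in> S \<Longrightarrow> orth z w \<Longrightarrow> \<bar>a v w\<bar> \<le> \<delta> * N v * N w"
    using near_maximal_orthoint[OF \<delta>] by blast
  \<comment> \<open>Deleting b lowers a z z by at most 4 \<tau> + \<tau>, which is at most half of
    \<eta>1; the other half is left to \<eta>.\<close>
  define \<tau> where "\<tau> = min 1 (\<eta>1 / 10)"
  have \<tau>: "0 < \<tau>" "\<tau> \<le> 1" "10 * \<tau> \<le> \<eta>1" using \<eta>1 by (auto simp: \<tau>_def)
  obtain \<eta>2 where \<eta>2: "\<eta>2 > 0" and coord: "\<And>a z w i c. form a \<Longrightarrow> z \<in> S \<Longrightarrow> N z \<le> 1 \<Longrightarrow> 1 - \<eta>2 \<le> a z z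
      \<Longrightarrow> w \<in> S \<Longrightarrow> orth z w \<Longrightarrow> \<bar>a (smul c (single i (z i))) w\<bar> \<le> \<delta> * \<tau> * norm c * N w"
    using near_maximal_coordinate[of "\<delta> * \<tau>"] \<delta> \<tau>(1) by (auto simp del: smul_apply)
  define \<eta> where "\<eta> = min (\<eta>1 / 2) \<eta>2"
  have \<eta>: "0 < \<eta>" "\<eta> \<le> \<eta>1 / 2" "\<eta> \<le> \<eta>2" using \<eta>1 \<eta>2 by (auto simp: \<eta>_def)
  have "(\<forall>v\<in>S. orth z v \<longrightarrow> \<bar>a v w\<bar> \<le> \<delta> * N v * N w) \<and>
      (\<forall>i c. \<bar>a (single i c) w\<bar> \<le> \<delta> * N (single i c) * N w)"
    if a: "form a" and z: "z \<in> S" "N z \<le> 1" "1 - \<eta> \<le> a z z" and w: "w \<in> S" "orth z w" for a z w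
  proof (intro conjI ballI allI impI)
    fix v
    assume "v \<in> S" "orth z v"
    then show "\<bar>a v w\<bar> \<le> \<delta> * N v * N w"
      using far[OF a z(1,2) _ _ _ w] z(3) \<eta> \<eta>1 by simp
  next
    fix i c
    define b where "b = single i (z i)"
    have b: "b \<in> S" "N b \<le> 1"
      using N_single_le[OF z(1), of i] z(2) by (auto simp: b_def single_in)
    show "\<bar>a (single i c) w\<bar> \<le> \<delta> * N (single i c) * N w"
    proof (cases "N b < \<tau>")
      case True
      define z' where "z' = proj (- {i}) z"
      have z': "z' \<in> S" "N z' \<le> 1"
        using z N_proj[OF z(1), of "- {i}"] proj_in[OF z(1)] by (simp_all add: z'_def)
      have z'': "orth z' w" "orth z' (single i c)" "z = z' + b"
        using w by (auto simp: z'_def orth_def proj_def b_def single_def fun_eq_iff)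
      have "a z' z' = a z z - 2 * a z b + a b b"
        using form_square_diff[OF a z(1) b(1)] z''(3) by simp
      moreover have "\<bar>a z b\<bar> \<le> 2 * \<tau>"
      proof -
        have "\<bar>a z b\<bar> \<le> 2 * N z * N b" by (rule form_bound[OF a z(1) b(1)])
        also have "\<dots> \<le> 2 * 1 * \<tau>"
          using z b nonneg True by (intro mult_mono) auto
        finally show ?thesis by simp
      qed
      moreover have "\<bar>a b b\<bar> \<le> \<tau>"
      proof -
        have "\<bar>a b b\<bar> \<le> N b * N b" using form_le[OF a b(1)] by (simp add: power2_eq_square)
        also have "\<dots> \<le> 1 * \<tau>" using b nonneg True by (intro mult_mono) auto
        finally show ?thesis by simp
      qed
      ultimately have "1 - \<eta>1 \<le> a z' z'"
        using z(3) \<eta> \<tau> by linarith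
      then show ?thesis
        by (intro far[OF a z'(1,2) _ single_in z''(2) w(1) z''(1)])
    next
      case False
      have "z i \<noteq> 0"
      proof
        assume "z i = 0"
        then have "b = 0" by (auto simp: b_def single_def fun_eq_iff)
        then show False using False \<tau> zero by simp
      qed
      then have eq: "single i c = smul (c / z i) b"
        by (auto simp: b_def single_def fun_eq_iff)
      have "\<bar>a (smul (c / z i) b) w\<bar> \<le> \<delta> * \<tau> * norm (c / z i) * N w"
        unfolding b_def using z \<eta> by (intro coord a w) auto
      also have "\<dots> \<le> \<delta> * N b * norm (c / z i) * N w"
        using False \<delta> w nonneg by (intro mult_right_mono mult_left_mono) auto
      also have "\<dots> = \<delta> * N (smul (c / z i) b) * N w"
        by (simp add: N_smul[OF b(1)])
      finally show ?thesis by (simp only: eq)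
    qed
  qed
  then show "\<exists>\<eta>>0. \<forall>a\<in>{a. form a}. \<forall>z\<in>S. N z \<le> 1 \<and> 1 - \<eta> \<le> a z z \<longrightarrow>
     (\<forall>w\<in>S. orth z w \<longrightarrow> (\<forall>v\<in>S. orth z v \<longrightarrow> \<bar>a v w\<bar> \<le> \<delta> * N v * N w) \<and>
        (\<forall>i c. \<bar>a (single i c) w\<bar> \<le> \<delta> * N (single i c) * N w))"
    using \<eta>(1) by blast
qed

end

section \<open>Convexity of the dual\<close>

context function_seminorm
begin

definition functional :: "(('i \<Rightarrow> 'k) \<Rightarrow> real) \<Rightarrow> bool" where
  "functional f \<longleftrightarrow> (\<forall>x\<in>S. \<forall>y\<in>S. f (x + y) = f x + f y) \<and>
     (\<forall>r. \<forall>x\<in>S. f (r *\<^sub>R x) = r * f x) \<and> (\<forall>x\<in>S. \<bar>f x\<bar> \<le> N x)"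

text \<open>Power type r for the dual norm, |(f + g) / 2| + C |f - g|^r <= 1, with the two norms
  replaced by values at test vectors x and v and with real functionals, so that the scalar field
  does not appear.\<close>

definition convex_dual :: "real \<Rightarrow> bool" where
  "convex_dual r \<longleftrightarrow> (\<exists>C>0. \<forall>f g. functional f \<and> functional g \<longrightarrow>
     (\<forall>x\<in>S. \<forall>v\<in>S. N x \<le> 1 \<and> N v \<le> 1 \<longrightarrow> (f x + g x) / 2 + C * \<bar>f v - g v\<bar> powr r \<le> 1))"

end

text \<open>Treats the scalar fields \<open>\<real>\<close> and \<open>\<complex>\<close> together; \<open>\<rho>\<close> is the real part.\<close>

locale scalar_part =
  fixes \<rho> :: "'k::{real_normed_field,euclidean_space} \<Rightarrow> real"
  assumes linear: "linear \<rho>"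
    and le_norm: "\<bar>\<rho> c\<bar> \<le> norm c"
    and aligned: "\<exists>c. norm c = 1 \<and> \<rho> (c * k) = norm k"
    and represent: "linear g \<Longrightarrow> \<exists>k. \<forall>c. g c = \<rho> (c * k)"
begin

lemma eqI:
  assumes "\<And>c. \<rho> (c * k) = \<rho> (c * l)"
  shows "k = l"
proof -
  obtain c where c: "\<rho> (c * (k - l)) = norm (k - l)" using aligned by blast
  have "\<rho> (c * (k - l)) = 0"
    using assms[of c] by (simp add: right_diff_distrib linear_diff[OF linear])
  then show ?thesis using c by simp
qed

text \<open>For fixed x the real-linear map c \<mapsto> f (c x) has the form \<rho> (c k), and this
  k is taken as F x; uniqueness of k makes F linear over the scalars. Rotating c so that \<rho> (c F
  x) is the norm of F x shows that the bound is preserved.\<close>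

lemma extend_functional:
  fixes S :: "('i \<Rightarrow> 'k) set"
  assumes "function_seminorm S N" and f: "function_seminorm.functional S N f"
  obtains F where "F \<in> vcarrier (dual_space (function_space S N))"
    "\<And>x. x \<in> S \<Longrightarrow> \<rho> (F x) = f x" "\<And>x. x \<in> S \<Longrightarrow> norm (F x) \<le> N x"
proof -
  interpret function_seminorm S N by fact
  have f_add: "f (x + y) = f x + f y" and f_scale: "f (r *\<^sub>R x) = r * f x" and f_le: "\<bar>f x\<bar> \<le> N x"
    if "x \<in> S" "y \<in> S" for x y r
    using f that unfolding functional_def by auto
  have "\<exists>k. \<forall>c. f (smul c x) = \<rho> (c * k)" if x: "x \<in> S" for x
  proof (rule represent, rule linearI)
    fix b c :: 'k and r :: real
    show "f (smul (b + c) x) = f (smul b x) + f (smul c x)"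
      using x by (simp add: smul_algebra f_add smul_in)
    have "smul (r *\<^sub>R b) x = r *\<^sub>R smul b x"
      by (auto simp: fun_eq_iff)
    then show "f (smul (r *\<^sub>R b) x) = r *\<^sub>R f (smul b x)"
      using f_scale[OF smul_in[OF x] x, of r b] by simp
  qed
  then obtain F0 where F0: "\<And>x c. x \<in> S \<Longrightarrow> f (smul c x) = \<rho> (c * F0 x)" by metis
  define F where "F x = (if x \<in> S then F0 x else 0)" for x
  have F: "f (smul c x) = \<rho> (c * F x)" if "x \<in> S" for c x
    using F0 that by (simp add: F_def)
  have F_add: "F (x + y) = F x + F y" if "x \<in> S" "y \<in> S" for x y
  proof (rule eqI)
    fix c
    have "\<rho> (c * F (x + y)) = f (smul c x + smul c y)"
      using F[OF add_in[OF that], of c] by (simp add: smul_algebra)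
    then show "\<rho> (c * F (x + y)) = \<rho> (c * (F x + F y))"
      using that by (simp add: f_add smul_in F distrib_left linear_add[OF linear])
  qed
  have F_smul: "F (smul d x) = d * F x" if "x \<in> S" for d x
  proof (rule eqI)
    fix c
    show "\<rho> (c * F (smul d x)) = \<rho> (c * (d * F x))"
      using F[OF smul_in[OF that, of d], of c] F[OF that, of "c * d"]
      by (simp add: smul_algebra mult.assoc)
  qed
  have F_le: "norm (F x) \<le> N x" if "x \<in> S" for x
  proof -
    obtain c where c: "norm c = 1" "\<rho> (c * F x) = norm (F x)" using aligned by blast
    then show ?thesis
      using f_le[OF smul_in[OF that] that, of c] F[OF that, of c] N_smul[OF that, of c] by simp
  qed
  have "F \<in> vcarrier (dual_space (function_space S N))"
    unfolding dual_space_def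
    by (auto simp: F_add F_smul intro!: exI[of _ 1] F_le) (simp add: F_def)
  moreover have "\<rho> (F x) = f x" if "x \<in> S" for x
    using F[OF that, of 1] by (simp add: smul_algebra)
  ultimately show thesis using that F_le by blast
qed

lemma convex_dual:
  fixes S :: "('i \<Rightarrow> 'k) set"
  assumes "function_seminorm S N"
    and conv: "has_convexity_power_type r (dual_space (function_space S N))"
  shows "function_seminorm.convex_dual S N r"
proof -
  interpret function_seminorm S N by fact
  let ?E = "function_space S N"
  let ?D = "dual_space ?E"
  obtain C where C: "C > 0"
      "\<And>\<epsilon>. 0 < \<epsilon> \<Longrightarrow> \<epsilon> \<le> 2 \<Longrightarrow> ereal (C * \<epsilon> powr r) \<le> modulus_of_convexity ?D \<epsilon>"
    using conv unfolding has_convexity_power_type_def by blast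
  have D: "vadd ?D = (+)" "vnorm ?D F = (SUP x\<in>unit_ball ?E. norm (F x))" "vdiff ?D F G = F - G" for F G
    unfolding dual_space_def by simp_all
  have ball: "x \<in> unit_ball ?E \<longleftrightarrow> x \<in> S \<and> N x \<le> 1" for x
    by (simp add: unit_ball_def)
  have ball0: "unit_ball ?E \<noteq> {}" using zero_in zero ball by fastforce
  have main: "(f x + g x) / 2 + C * \<bar>f v - g v\<bar> powr r \<le> 1"
    if f: "functional f" and g: "functional g" and x: "x \<in> S" "N x \<le> 1" and v: "v \<in> S" "N v \<le> 1" for f g x v
  proof -
    have le1: "\<bar>f y\<bar> \<le> N y" "\<bar>g y\<bar> \<le> N y" if "y \<in> S" for y
      using f g that unfolding functional_def by auto
    \<comment> \<open>The modulus is evaluated at this lower bound for the norm of F - G. The value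
      0 is treated apart, since the modulus is controlled only for positive arguments.\<close>
    define \<epsilon> where "\<epsilon> = \<bar>f v - g v\<bar>"
    show ?thesis
    proof (cases "\<epsilon> = 0")
      case True
      then show ?thesis using le1[OF x(1)] x(2) by (simp add: \<epsilon>_def)
    next
      case False
      have \<epsilon>: "0 < \<epsilon>" "\<epsilon> \<le> 2" using False le1[OF v(1)] v(2) by (auto simp: \<epsilon>_def)
      obtain F where F: "F \<in> vcarrier ?D" "\<And>x. x \<in> S \<Longrightarrow> \<rho> (F x) = f x" "\<And>x. x \<in> S \<Longrightarrow> norm (F x) \<le> N x"
        by (rule extend_functional[OF assms(1) f]) blast
      obtain G where G: "G \<in> vcarrier ?D" "\<And>x. x \<in> S \<Longrightarrow> \<rho> (G x) = g x" "\<And>x. x \<in> S \<Longrightarrow> norm (G x) \<le> N x"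
        by (rule extend_functional[OF assms(1) g]) blast
      have one: "norm (F y) \<le> 1" "norm (G y) \<le> 1" if "y \<in> unit_ball ?E" for y
        using F(3)[of y] G(3)[of y] that by (auto simp: ball)
      then have FG: "F \<in> unit_ball ?D" "G \<in> unit_ball ?D"
        using F(1) G(1) ball0 unfolding unit_ball_def D by (auto intro!: cSUP_least)
      have bdd1: "bdd_above ((\<lambda>y. norm ((F - G) y)) ` unit_ball ?E)"
      proof (rule bdd_aboveI2)
        fix y assume "y \<in> unit_ball ?E"
        then show "norm ((F - G) y) \<le> 2"
          using one[of y] norm_triangle_ineq4[of "F y" "G y"] by simp
      qed
      have bdd2: "bdd_above ((\<lambda>y. norm ((F + G) y)) ` unit_ball ?E)"
      proof (rule bdd_aboveI2)
        fix y assume "y \<in> unit_ball ?E"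
        then show "norm ((F + G) y) \<le> 2"
          using one[of y] norm_triangle_ineq[of "F y" "G y"] by simp
      qed
      have "\<epsilon> \<le> norm ((F - G) v)"
        using le_norm[of "F v - G v"] F(2)[OF v(1)] G(2)[OF v(1)] by (simp add: \<epsilon>_def linear_diff[OF linear])
      also have "\<dots> \<le> vnorm ?D (vdiff ?D F G)"
        unfolding D using v by (intro cSUP_upper bdd1) (simp add: ball)
      finally have "modulus_of_convexity ?D \<epsilon> \<le> ereal (1 - vnorm ?D (vadd ?D F G) / 2)"
        unfolding modulus_of_convexity_def using FG by (intro Inf_lower) blast
      then have "C * \<epsilon> powr r \<le> 1 - vnorm ?D (vadd ?D F G) / 2"
        using C(2)[OF \<epsilon>] order_trans by fastforce
      moreover have "f x + g x \<le> vnorm ?D (vadd ?D F G)"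
      proof -
        have "f x + g x \<le> norm ((F + G) x)"
          using le_norm[of "F x + G x"] F(2)[OF x(1)] G(2)[OF x(1)] by (simp add: linear_add[OF linear])
        also have "\<dots> \<le> vnorm ?D (vadd ?D F G)"
          unfolding D using x by (intro cSUP_upper bdd2) (simp add: ball)
        finally show ?thesis .
      qed
      moreover have "s / 2 + c \<le> 1" if "c \<le> 1 - n / 2" "s \<le> n" for s c n :: real
        using that by simp
      ultimately show ?thesis unfolding \<epsilon>_def by blast
    qed
  qed
  then show ?thesis unfolding convex_dual_def using C(1) by blast
qed

end

lemma scalar_part_real: "scalar_part (\<lambda>c::real. c)"
proof
  show "\<exists>c. norm c = 1 \<and> c * k = norm k" for k :: real
    by (intro exI[of _ "if k < 0 then -1 else 1"]) auto
  show "\<exists>k. \<forall>c. g c = c * k" if "linear g" for g :: "real \<Rightarrow> real"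
  proof (intro exI allI)
    show "g c = c * g 1" for c
      using linear_scale[OF that, of c 1] by simp
  qed
qed (auto intro: linearI)

lemma scalar_part_complex: "scalar_part Re"
proof
  show "\<bar>Re c\<bar> \<le> norm c" for c by (rule abs_Re_le_cmod)
  show "\<exists>c. norm c = 1 \<and> Re (c * k) = norm k" for k :: complex
  proof (cases "k = 0")
    case False
    then have "cnj k / norm k * k = norm k"
      by (simp add: mult.commute complex_norm_square[symmetric] power2_eq_square)
    then show ?thesis
      using False by (intro exI[of _ "cnj k / norm k"]) (simp add: norm_divide)
  qed (auto intro: exI[of _ 1])
  show "\<exists>k. \<forall>c. g c = Re (c * k)" if g: "linear g" for g :: "complex \<Rightarrow> real"
  proof (intro exI allI)
    fix c
    have "g c = g (Re c *\<^sub>R 1 + Im c *\<^sub>R \<i>)"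
      by (rule arg_cong[of _ _ g]) (simp add: complex_eq_iff)
    then show "g c = Re (c * Complex (g 1) (- g \<i>))"
      by (simp add: linear_add[OF g] linear_scale[OF g])
  qed
qed (auto intro: linearI)

section \<open>Order continuity from convexity of the dual\<close>

text \<open>If tails of \<open>x\<close> do not tend to zero, then \<open>x\<close> has two disjoint blocks \<open>d\<^sub>1\<close>, \<open>d\<^sub>2\<close> that
  almost span a two-dimensional \<open>\<ell>\<^sub>\<infinity>\<close>; functionals norming them and supported on them almost
  span a two-dimensional \<open>\<ell>\<^sub>1\<close>, which contradicts the convexity of the dual.\<close>

lemma (in function_lattice) exists_block_functional:
  assumes x: "x \<in> S"
  obtains f where "functional f" "f (proj F x) = N (proj F x)"
    "\<And>y. y \<in> S \<Longrightarrow> proj F y = 0 \<Longrightarrow> f y = 0"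
proof -
  have p: "proj F (y + z) = proj F y + proj F z" "proj F (r *\<^sub>R y) = r *\<^sub>R proj F y"
      "proj F (proj F y) = proj F y" "proj F (- y) = - proj F y" for y z r
    by (auto simp: proj_def fun_eq_iff)
  \<comment> \<open>Domination by the seminorm of the block alone makes f vanish on vectors that are
    zero on F.\<close>
  obtain f where f: "linear f" "\<And>y. y \<in> S \<Longrightarrow> f y \<le> N (proj F y)"
      "f (proj F x) = N (proj F (proj F x))"
    by (rule hahn_banach_on[OF subspace proj_in[OF x], of "\<lambda>y. N (proj F y)" F])
      (auto simp: p triangle scaleR proj_in)
  have le: "\<bar>f y\<bar> \<le> N (proj F y)" if "y \<in> S" for y
    using f(2)[OF that] f(2)[OF subspace_neg[OF subspace that]] minus[OF proj_in[OF that], of F]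
    by (simp add: p linear_neg[OF f(1)])
  have "functional f"
    unfolding functional_def using le N_proj
    by (auto simp: linear_add[OF f(1)] linear_scale[OF f(1)] intro: order_trans)
  moreover have "f y = 0" if "y \<in> S" "proj F y = 0" for y
    using le[OF that(1)] that(2) zero by simp
  ultimately show thesis using that f(3) by (simp add: p)
qed

text \<open>Suppose that the union of the blocks has norm at most M = K (1 + \<kappa>). By solidity
  (d + e) / M and (d - e) / M both lie in the unit ball. The functionals f and g norming d and e
  give the sum of their values at the first vector and the difference at the second the same value
  t, close to 2, which the convexity of the dual forbids.\<close>

lemma (in function_lattice) blocks_not_equivalent_to_sup:
  assumes conv: "convex_dual r" and r: "0 \<le> r"
  shows "\<exists>\<kappa>>0. \<forall>x\<in>S. \<forall>F G K. 0 < K \<and> F \<inter> G = {} \<and> K * (1 - \<kappa>) \<le> N (proj F x) \<and> K * (1 - \<kappa>) \<le> N (proj G x)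
    \<longrightarrow> K * (1 + \<kappa>) < N (proj (F \<union> G) x)"
proof -
  obtain C where C: "C > 0" and UC: "\<And>f g x v. functional f \<Longrightarrow> functional g \<Longrightarrow> x \<in> S \<Longrightarrow> v \<in> S
      \<Longrightarrow> N x \<le> 1 \<Longrightarrow> N v \<le> 1 \<Longrightarrow> (f x + g x) / 2 + C * \<bar>f v - g v\<bar> powr r \<le> 1"
    using conv unfolding convex_dual_def by blast
  \<comment> \<open>The bound 1 / 3 yields t >= 1, hence t^r >= 1; the bound C / 4 makes t / 2 + C
    >= 1 - 2 \<kappa> + C exceed 1.\<close>
  define \<kappa> where "\<kappa> = min (1 / 3) (C / 4)"
  have \<kappa>: "0 < \<kappa>" "\<kappa> \<le> 1 / 3" "4 * \<kappa> \<le> C" using C by (auto simp: \<kappa>_def)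
  have False if x: "x \<in> S" and K: "0 < K" and FG: "F \<inter> G = {}"
      and low: "K * (1 - \<kappa>) \<le> N (proj F x)" "K * (1 - \<kappa>) \<le> N (proj G x)"
      and up: "N (proj (F \<union> G) x) \<le> K * (1 + \<kappa>)" for x F G K
  proof -
    define d where "d = proj F x"
    define e where "e = proj G x"
    have de: "d \<in> S" "e \<in> S" "d + e \<in> S" "d - e \<in> S"
      using x by (auto simp: d_def e_def proj_in intro: add_in diff_in)
    have sum: "d + e = proj (F \<union> G) x" and 0: "proj F e = 0" "proj G d = 0"
      using FG by (auto simp: d_def e_def proj_def fun_eq_iff)
    have N_diff: "N (d - e) \<le> N (d + e)"
    proof -
      have "norm ((d - e) k) \<le> norm ((d + e) k)" for k
        using FG by (auto simp: d_def e_def proj_def)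
      then show ?thesis using solid[OF de(3)] by blast
    qed
    obtain f where f: "functional f" "f d = N d" "\<And>y. y \<in> S \<Longrightarrow> proj F y = 0 \<Longrightarrow> f y = 0"
      unfolding d_def by (rule exists_block_functional[OF x, of F]) blast
    obtain g where g: "functional g" "g e = N e" "\<And>y. y \<in> S \<Longrightarrow> proj G y = 0 \<Longrightarrow> g y = 0"
      unfolding e_def by (rule exists_block_functional[OF x, of G]) blast
    have lin: "h (y + z) = h y + h z" "h (s *\<^sub>R y) = s * h y" "h (y - z) = h y - h z"
      if "h = f \<or> h = g" "y \<in> S" "z \<in> S" for h y z s
    proof -
      have h: "functional h" using that f g by auto
      then show *: "h (y + z) = h y + h z" "h (s *\<^sub>R y) = s * h y"
        using that unfolding functional_def by auto
      have "h ((y - z) + z) = h (y - z) + h z"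
        using h diff_in[OF that(2,3)] that(3) unfolding functional_def by blast
      then show "h (y - z) = h y - h z" by simp
    qed
    define M where "M = K * (1 + \<kappa>)"
    have M: "M > 0" using K \<kappa> by (simp add: M_def)
    define t where "t = (N d + N e) / M"
    have scaled: "N ((1 / M) *\<^sub>R (d + e)) \<le> 1" "N ((1 / M) *\<^sub>R (d - e)) \<le> 1"
      using scaleR[OF de(3), of "1 / M"] scaleR[OF de(4), of "1 / M"] M up N_diff
      by (auto simp: M_def sum[symmetric])
    have "(f ((1 / M) *\<^sub>R (d + e)) + g ((1 / M) *\<^sub>R (d + e))) / 2
        + C * \<bar>f ((1 / M) *\<^sub>R (d - e)) - g ((1 / M) *\<^sub>R (d - e))\<bar> powr r \<le> 1"
      using de by (intro UC f(1) g(1) scaled subspace_scale[OF subspace])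
    moreover have "f (d + e) = N d" "g (d + e) = N e" "f (d - e) = N d" "g (d - e) = - N e"
      using de f g 0 by (simp_all add: lin)
    moreover have "f ((1 / M) *\<^sub>R y) = f y / M" "g ((1 / M) *\<^sub>R y) = g y / M" if "y \<in> S" for y
      using lin(2)[of f y y "1 / M"] lin(2)[of g y y "1 / M"] that by simp_all
    ultimately have key: "t / 2 + C * \<bar>t\<bar> powr r \<le> 1"
      using de by (simp add: t_def add_divide_distrib)
    have "(1 - 2 * \<kappa>) * (1 + \<kappa>) \<le> 1 - \<kappa>"
      using \<kappa> by (simp add: algebra_simps)
    then have "K * ((1 - 2 * \<kappa>) * (1 + \<kappa>)) \<le> K * (1 - \<kappa>)"
      using K by (intro mult_left_mono) auto
    then have "2 * (1 - 2 * \<kappa>) * M \<le> N d + N e"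
      using low by (simp add: M_def d_def e_def algebra_simps)
    then have t2: "2 * (1 - 2 * \<kappa>) \<le> t"
      using M by (simp add: t_def field_simps)
    have "K \<le> 2 * (K * (1 - \<kappa>)) - K * \<kappa>"
      using K \<kappa> mult_left_mono[of \<kappa> "1 / 3" K] by (simp add: algebra_simps)
    then have "M \<le> N d + N e"
      using low by (simp add: M_def d_def e_def algebra_simps)
    then have t1: "1 \<le> t" using M by (simp add: t_def)
    then have "C * 1 \<le> C * \<bar>t\<bar> powr r"
      using C r by (intro mult_left_mono ge_one_powr_ge_zero) auto
    then have "t / 2 + C \<le> t / 2 + C * \<bar>t\<bar> powr r" by (simp only: add_left_mono mult_1_right)
    then have "t / 2 + C \<le> 1" using key by (rule order_trans)
    then show False using t2 \<kappa> by simp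
  qed
  then show ?thesis using \<kappa>(1) by (meson not_le)
qed


locale sequence_lattice = function_lattice S N
  for S :: "(nat \<Rightarrow> 'k::{real_normed_field,euclidean_space}) set" and N

text \<open>K is the limit of the largest block norms beyond n. If it were positive, two successive
  blocks of norm almost K would have a union of norm below K (1 + \<kappa>), against the previous
  lemma.\<close>

lemma (in sequence_lattice) tails_vanish:
  assumes conv: "convex_dual r" and r: "0 \<le> r"
    and complete: "\<And>u. u \<in> cauchys \<Longrightarrow> \<exists>y\<in>S. (\<lambda>n. N (u n - y)) \<longlonglongrightarrow> 0"
    and x: "x \<in> S" and \<epsilon>: "\<epsilon> > 0"
  shows "\<exists>F. finite F \<and> N (proj (- F) x) < \<epsilon>"
proof -
  \<comment> \<open>Blocks are finite so that the next one can be taken entirely beyond the previous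
    one.\<close>
  define blocks :: "nat \<Rightarrow> nat set set" where "blocks n = {F. finite F \<and> F \<subseteq> {n..}}" for n
  define s where "s n = (SUP F\<in>blocks n. N (proj F x))" for n
  have bdd: "bdd_above ((\<lambda>F. N (proj F x)) ` blocks n)" for n
    using N_proj[OF x] by (intro bdd_aboveI2) 
  have s_upper: "N (proj F x) \<le> s n" if "F \<in> blocks n" for F n
    unfolding s_def by (intro cSUP_upper that bdd)
  have empty: "{} \<in> blocks n" for n by (simp add: blocks_def)
  have s0: "0 \<le> s n" for n
    using s_upper[OF empty, of n] nonneg[OF proj_in[OF x, of "{}"]] by simp
  define K where "K = (INF n. s n)"
  have K_le: "K \<le> s n" for n
    unfolding K_def by (intro cINF_lower bdd_belowI2[of _ 0] s0) auto
  have K_less: "\<exists>n. s n < K'" if "K < K'" for K'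
    using that unfolding K_def by (subst (asm) cINF_less_iff) (auto intro!: bdd_belowI2[of _ 0] s0)
  have "0 \<le> K" unfolding K_def by (intro cINF_greatest s0) auto
  moreover have "\<not> 0 < K"
  proof
    assume K: "0 < K"
    obtain \<kappa> where \<kappa>: "\<kappa> > 0" "\<And>F G. F \<inter> G = {} \<Longrightarrow> K * (1 - \<kappa>) \<le> N (proj F x)
        \<Longrightarrow> K * (1 - \<kappa>) \<le> N (proj G x) \<Longrightarrow> K * (1 + \<kappa>) < N (proj (F \<union> G) x)"
      using blocks_not_equivalent_to_sup[OF conv r] x K by metis
    have "K * (1 - \<kappa>) < K * 1" "K * 1 < K * (1 + \<kappa>)"
      using K \<kappa> by (intro mult_strict_left_mono; simp)+
    then have Klt: "K * (1 - \<kappa>) < K" "K < K * (1 + \<kappa>)" by simp_all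
    have large: "\<exists>F\<in>blocks n. K * (1 - \<kappa>) < N (proj F x)" for n
    proof -
      have "K * (1 - \<kappa>) < s n" using Klt(1) K_le[of n] by simp
      then show ?thesis
        unfolding s_def by (subst (asm) less_cSUP_iff) (use empty bdd in auto)
    qed
    obtain n where n: "s n < K * (1 + \<kappa>)" using K_less[OF Klt(2)] by blast
    obtain F where F: "F \<in> blocks n" "K * (1 - \<kappa>) < N (proj F x)" using large by blast
    obtain m where m: "F \<subseteq> {..<m}"
      using F(1) finite_nat_bounded unfolding blocks_def by blast
    obtain G where G: "G \<in> blocks (max n m)" "K * (1 - \<kappa>) < N (proj G x)" using large by blast
    have "F \<inter> G = {}"
      using m G(1) by (fastforce simp: blocks_def)
    then have "K * (1 + \<kappa>) < N (proj (F \<union> G) x)"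
      using \<kappa>(2) F G by simp
    moreover have "F \<union> G \<in> blocks n"
      using F(1) G(1) by (fastforce simp: blocks_def)
    ultimately show False using s_upper n by fastforce
  qed
  ultimately have K0: "K = 0" by simp
  \<comment> \<open>The norm of an infinite tail need not be the supremum over its finite blocks.
    The truncations are therefore shown to be Cauchy, and their limit is identified with x
    coordinate by coordinate.\<close>
  define u where "u n = proj {..<n} x" for n
  have u_in: "u n \<in> S" for n using x by (simp add: u_def proj_in)
  have diff: "N (u m - u n) \<le> s k" if "k \<le> n" "n \<le> m" for k m n
  proof -
    have "u m - u n = proj ({n..<m}) x"
      using that by (auto simp: u_def proj_def fun_eq_iff)
    moreover have "{n..<m} \<in> blocks k"
      using that by (auto simp: blocks_def)
    ultimately show ?thesis using s_upper by simp
  qed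
  have "u \<in> cauchys"
    unfolding cauchys_iff
  proof (intro conjI allI impI u_in)
    fix e :: real
    assume "e > 0"
    then obtain k where k: "s k < e" using K_less[of e] K0 by auto
    have "N (u m - u n) < e" if "m \<ge> k" "n \<ge> k" for m n
      using diff[of k n m] diff[of k m n] that k minus[OF diff_in[OF u_in u_in], of n m]
      by (cases "n \<le> m") auto
    then show "\<exists>M. \<forall>m\<ge>M. \<forall>n\<ge>M. N (u m - u n) < e" by blast
  qed
  then obtain y where y: "y \<in> S" "(\<lambda>n. N (u n - y)) \<longlonglongrightarrow> 0" using complete by blast
  have "x i = y i" for i
  proof -
    have "N (single i (x i - y i)) \<le> N (u n - y)" if "n \<ge> Suc i" for n
    proof -
      have "(u n - y) i = x i - y i" using that by (auto simp: u_def proj_def)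
      then show ?thesis using N_single_le[OF diff_in[OF u_in y(1)], of i n] by simp
    qed
    then have "N (single i (x i - y i)) \<le> 0"
      using y(2) by (intro LIMSEQ_le_const) auto
    then have "single i (x i - y i) = 0"
      using definite[OF single_in] nonneg[OF single_in, of i "x i - y i"] by simp
    then show ?thesis by (auto simp: single_def fun_eq_iff split: if_splits)
  qed
  then have "x = y" by auto
  then obtain n where "N (u n - x) < \<epsilon>"
    using order_tendstoD(2)[OF y(2) \<epsilon>] by (auto simp: eventually_sequentially)
  moreover have "u n - x = - proj (- {..<n}) x"
    by (auto simp: u_def proj_def fun_eq_iff)
  ultimately have "N (proj (- {..<n}) x) < \<epsilon>"
    using minus[OF proj_in[OF x], of "- {..<n}"] by simp
  then show ?thesis by (intro exI[of _ "{..<n}"]) auto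
qed

section \<open>Pairs of lattices\<close>

locale lattice_pair = X: function_lattice SX NX + Y: function_lattice SY NY
  for SX :: "('i \<Rightarrow> 'k::{real_normed_field,euclidean_space}) set" and NX
  and SY :: "('j \<Rightarrow> 'k) set" and NY
begin

definition join_carrier :: "('i + 'j \<Rightarrow> 'k) set" where
  "join_carrier = {z. z \<circ> Inl \<in> SX \<and> z \<circ> Inr \<in> SY}"

text \<open>The maximum preserves the upper p-estimate, and after rescaling the two components to
  equal norm its square is the product of the norms, the cost of an elementary tensor.\<close>

definition join_norm :: "('i + 'j \<Rightarrow> 'k) \<Rightarrow> real" where
  "join_norm z = max (NX (z \<circ> Inl)) (NY (z \<circ> Inr))"

lemma comp_algebra:
  "(z + w) \<circ> f = (z \<circ> f) + (w \<circ> f)" "smul c z \<circ> f = smul c (z \<circ> f)"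
  "(r *\<^sub>R z) \<circ> f = r *\<^sub>R (z \<circ> f)" "0 \<circ> f = 0"
  by (auto simp: fun_eq_iff)

sublocale J: function_lattice join_carrier join_norm
proof
  show "0 \<in> join_carrier"
    by (simp add: join_carrier_def comp_algebra X.zero_in Y.zero_in)
  show "x + y \<in> join_carrier" if "x \<in> join_carrier" "y \<in> join_carrier" for x y
    using that by (simp add: join_carrier_def comp_algebra X.add_in Y.add_in)
  show "smul c x \<in> join_carrier" if "x \<in> join_carrier" for x c
    using that by (simp add: join_carrier_def comp_algebra X.smul_in Y.smul_in)
  show "join_norm (x + y) \<le> join_norm x + join_norm y"
    if "x \<in> join_carrier" "y \<in> join_carrier" for x y
    using that X.triangle[of "x \<circ> Inl" "y \<circ> Inl"] Y.triangle[of "x \<circ> Inr" "y \<circ> Inr"]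
    by (auto simp: join_carrier_def join_norm_def comp_algebra)
  show "join_norm (smul c x) = norm c * join_norm x" if "x \<in> join_carrier" for x c
    using that by (simp add: join_carrier_def join_norm_def comp_algebra X.N_smul Y.N_smul
        max_mult_distrib_left)
  show "x = 0" if "x \<in> join_carrier" "join_norm x = 0" for x
  proof -
    have "x \<circ> Inl = 0" "x \<circ> Inr = 0"
      using that X.definite[of "x \<circ> Inl"] Y.definite[of "x \<circ> Inr"]
        X.nonneg[of "x \<circ> Inl"] Y.nonneg[of "x \<circ> Inr"]
      by (auto simp: join_carrier_def join_norm_def max_def split: if_splits)
    then have "x (Inl i) = 0" "x (Inr j) = 0" for i j
      by (auto dest: fun_cong[of _ _ i] fun_cong[of _ _ j])
    then have "x k = 0" for k by (cases k) auto
    then show ?thesis by auto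
  qed
  show "y \<in> join_carrier \<and> join_norm y \<le> join_norm x"
    if "x \<in> join_carrier" "\<And>k. norm (y k) \<le> norm (x k)" for x y
    using that X.solid[of "x \<circ> Inl" "y \<circ> Inl"] Y.solid[of "x \<circ> Inr" "y \<circ> Inr"]
    by (auto simp: join_carrier_def join_norm_def max_def)
  show "single k c \<in> join_carrier" for k c
  proof (cases k)
    case (Inl i)
    then have "single k c \<circ> Inl = single i c" "single k c \<circ> Inr = 0"
      by (auto simp: single_def fun_eq_iff)
    then show ?thesis by (simp add: join_carrier_def X.single_in Y.zero_in)
  next
    case (Inr j)
    then have "single k c \<circ> Inl = 0" "single k c \<circ> Inr = single j c"
      by (auto simp: single_def fun_eq_iff)
    then show ?thesis by (simp add: join_carrier_def Y.single_in X.zero_in)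
  qed
qed

lemma join_upper_estimate:
  assumes "upper_estimate p SX NX" "upper_estimate p SY NY"
  shows "upper_estimate p join_carrier join_norm"
  using assms unfolding upper_estimate_def join_carrier_def join_norm_def
  by (auto simp: comp_algebra orth_def)

lemma join_tails:
  assumes X: "\<And>x \<epsilon>. x \<in> SX \<Longrightarrow> \<epsilon> > 0 \<Longrightarrow> \<exists>F. finite F \<and> NX (proj (- F) x) < \<epsilon>"
    and Y: "\<And>y \<epsilon>. y \<in> SY \<Longrightarrow> \<epsilon> > 0 \<Longrightarrow> \<exists>F. finite F \<and> NY (proj (- F) y) < \<epsilon>"
    and z: "z \<in> join_carrier" and \<epsilon>: "\<epsilon> > 0"
  shows "\<exists>F. finite F \<and> join_norm (proj (- F) z) < \<epsilon>"
proof -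
  obtain F G where FG: "finite F" "NX (proj (- F) (z \<circ> Inl)) < \<epsilon>" "finite G" "NY (proj (- G) (z \<circ> Inr)) < \<epsilon>"
    using X[of "z \<circ> Inl" \<epsilon>] Y[of "z \<circ> Inr" \<epsilon>] z \<epsilon> by (auto simp: join_carrier_def)
  have "proj (- (Inl ` F \<union> Inr ` G)) z \<circ> Inl = proj (- F) (z \<circ> Inl)"
    "proj (- (Inl ` F \<union> Inr ` G)) z \<circ> Inr = proj (- G) (z \<circ> Inr)"
    by (auto simp: proj_def fun_eq_iff)
  then show ?thesis
    using FG by (intro exI[of _ "Inl ` F \<union> Inr ` G"]) (auto simp: join_norm_def)
qed

section \<open>Bilinear forms on a pair and convexity of the duals\<close>

definition bilinear :: "(('i \<Rightarrow> 'k) \<Rightarrow> ('j \<Rightarrow> 'k) \<Rightarrow> real) \<Rightarrow> bool" where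
  "bilinear A \<longleftrightarrow>
     (\<forall>x\<in>SX. \<forall>x'\<in>SX. \<forall>y\<in>SY. A (x + x') y = A x y + A x' y) \<and>
     (\<forall>x\<in>SX. \<forall>y\<in>SY. \<forall>y'\<in>SY. A x (y + y') = A x y + A x y') \<and>
     (\<forall>r. \<forall>x\<in>SX. \<forall>y\<in>SY. A (r *\<^sub>R x) y = r * A x y) \<and>
     (\<forall>r. \<forall>x\<in>SX. \<forall>y\<in>SY. A x (r *\<^sub>R y) = r * A x y) \<and>
     (\<forall>x\<in>SX. \<forall>y\<in>SY. \<bar>A x y\<bar> \<le> NX x * NY y)"

text \<open>The polar form of the quadratic form z \<mapsto> A (z \<circ> Inl) (z \<circ>
  Inr).\<close>

definition symmetrized :: "(('i \<Rightarrow> 'k) \<Rightarrow> ('j \<Rightarrow> 'k) \<Rightarrow> real) \<Rightarrow> ('i + 'j \<Rightarrow> 'k) \<Rightarrow> ('i + 'j \<Rightarrow> 'k) \<Rightarrow> real" where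
  "symmetrized A z w = (A (z \<circ> Inl) (w \<circ> Inr) + A (w \<circ> Inl) (z \<circ> Inr)) / 2"

text \<open>With M = 1 + t^s the functionals A (_, y + t w) / M and A (_, y - t w) / M lie in the
  dual ball, and their mean at x is A x y / M >= 1 - t^s - \<eta>. Convexity bounds the r-th power
  of their difference 2 t |A v w| / M at v, up to the factor C, by t^s + \<eta>; dividing by t^r
  leaves t^(s - r), small because r < s.\<close>

lemma small_beyond_support_unit:
  assumes conv: "X.convex_dual r" and r: "0 < r" "r < s" and upper: "upper_estimate s SY NY"
    and \<delta>: "\<delta> > 0"
  shows "\<exists>\<eta>>0. \<forall>A x y v w. bilinear A \<and> x \<in> SX \<and> NX x \<le> 1 \<and> y \<in> SY \<and> NY y \<le> 1 \<and> 1 - \<eta> \<le> A x y \<and>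
    v \<in> SX \<and> NX v \<le> 1 \<and> w \<in> SY \<and> NY w \<le> 1 \<and> orth y w \<longrightarrow> \<bar>A v w\<bar> \<le> \<delta>"
proof -
  obtain C where C: "C > 0" and UC: "\<And>f g x v. X.functional f \<Longrightarrow> X.functional g \<Longrightarrow> x \<in> SX \<Longrightarrow> v \<in> SX
      \<Longrightarrow> NX x \<le> 1 \<Longrightarrow> NX v \<le> 1 \<Longrightarrow> (f x + g x) / 2 + C * \<bar>f v - g v\<bar> powr r \<le> 1"
    using conv unfolding X.convex_dual_def by blast
  \<comment> \<open>Half of the target C \<delta>^r is reserved for t^(s - r), the other half for
    \<eta> / t^r.\<close>
  define D where "D = C * \<delta> powr r / 2"
  have D: "D > 0" using C \<delta> by (simp add: D_def)
  obtain t where t: "0 < t" "t \<le> 1" "t powr (s - r) \<le> D"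
    by (rule exists_small_powr[of "s - r" D]) (use r D in auto)
  define \<eta> where "\<eta> = D * t powr r"
  have \<eta>: "\<eta> > 0" using D t by (simp add: \<eta>_def)
  have "\<bar>A v w\<bar> \<le> \<delta>"
    if A: "bilinear A" and x: "x \<in> SX" "NX x \<le> 1" and y: "y \<in> SY" "NY y \<le> 1" "1 - \<eta> \<le> A x y"
      and v: "v \<in> SX" "NX v \<le> 1" and w: "w \<in> SY" "NY w \<le> 1" "orth y w" for A x y v w
  proof -
    define M where "M = 1 + t powr s"
    have M: "1 \<le> M" "M \<le> 2" using t r powr_le1[of s t] by (auto simp: M_def)
    have contr: "X.functional (\<lambda>u. A u y' / M)" if y': "y' \<in> SY" "NY y' \<le> M" for y'
      unfolding X.functional_def
    proof (intro conjI ballI allI)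
      fix u assume u: "u \<in> SX"
      have "\<bar>A u y'\<bar> \<le> NX u * NY y'" using A u y' unfolding bilinear_def by blast
      also have "\<dots> \<le> NX u * M" using y' X.nonneg[OF u] by (intro mult_left_mono) auto
      finally show "\<bar>A u y' / M\<bar> \<le> NX u" using M by (simp add: abs_divide field_simps)
    qed (use A y' in \<open>auto simp: bilinear_def add_divide_distrib\<close>)
    have m: "- w \<in> SY" "NY (- w) \<le> 1" "orth y (- w)"
      using w subspace_neg[OF Y.subspace w(1)] by (auto simp: Y.minus orth_def)
    have yw: "y + t *\<^sub>R w \<in> SY" "NY (y + t *\<^sub>R w) \<le> M" "y + t *\<^sub>R (- w) \<in> SY" "NY (y + t *\<^sub>R (- w)) \<le> M"
      using upper y w m t Y.shift_in unfolding upper_estimate_def M_def by (simp_all del: scaleR_minus_right)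
    have A_plus: "A u (y + t *\<^sub>R w) = A u y + t * A u w" "A u (y + t *\<^sub>R (- w)) = A u y - t * A u w"
      if "u \<in> SX" for u
    proof -
      have add: "A u (y' + y'') = A u y' + A u y''" and scale: "A u (c *\<^sub>R y') = c * A u y'"
        if "y' \<in> SY" "y'' \<in> SY" for y' y'' c
        using A that \<open>u \<in> SX\<close> unfolding bilinear_def by blast+
      have "y + t *\<^sub>R (- w) = y + (- t) *\<^sub>R w" by simp
      then show "A u (y + t *\<^sub>R w) = A u y + t * A u w" "A u (y + t *\<^sub>R (- w)) = A u y - t * A u w"
        using add[OF y(1) subspace_scale[OF Y.subspace w(1)], of t]
          add[OF y(1) subspace_scale[OF Y.subspace w(1)], of "- t"]
          scale[OF w(1) w(1), of t] scale[OF w(1) w(1), of "- t"] by simp_all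
    qed
    have "(A x (y + t *\<^sub>R w) / M + A x (y + t *\<^sub>R (- w)) / M) / 2
        + C * \<bar>A v (y + t *\<^sub>R w) / M - A v (y + t *\<^sub>R (- w)) / M\<bar> powr r \<le> 1"
      by (intro UC contr yw x v)
    moreover have "(A x (y + t *\<^sub>R w) / M + A x (y + t *\<^sub>R (- w)) / M) / 2 = A x y / M"
      unfolding A_plus[OF x(1)] by (simp add: diff_divide_distrib add_divide_distrib)
    moreover have "\<bar>A v (y + t *\<^sub>R w) / M - A v (y + t *\<^sub>R (- w)) / M\<bar> = 2 * t * \<bar>A v w\<bar> / M"
      unfolding A_plus[OF v(1)] using M t by (simp add: abs_mult abs_divide flip: diff_divide_distrib)
    ultimately have "A x y / M + C * (2 * t * \<bar>A v w\<bar> / M) powr r \<le> 1" by simp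
    moreover have "t * \<bar>A v w\<bar> \<le> 2 * t * \<bar>A v w\<bar> / M"
      using M t mult_right_mono[OF M(2), of "t * \<bar>A v w\<bar>"] by (simp add: field_simps)
    then have "C * (t * \<bar>A v w\<bar>) powr r \<le> C * (2 * t * \<bar>A v w\<bar> / M) powr r"
      using C t r by (intro mult_left_mono powr_mono2) auto
    moreover have "1 - A x y / M \<le> t powr s + \<eta>"
    proof -
      have "(M - A x y) / M \<le> (M - A x y) / 1"
      proof (rule divide_left_mono)
        have "\<bar>A x y\<bar> \<le> NX x * NY y" using A x y unfolding bilinear_def by blast
        also have "\<dots> \<le> 1 * 1" using x y X.nonneg Y.nonneg by (intro mult_mono) auto
        finally show "0 \<le> M - A x y" using M by simp
      qed (use M in auto)
      moreover have "(M - A x y) / M = 1 - A x y / M" using M by (simp add: diff_divide_distrib)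
      ultimately show ?thesis using y(3) by (simp only:) (simp add: M_def)
    qed
    ultimately have "C * (t * \<bar>A v w\<bar>) powr r \<le> t powr s + \<eta>" by linarith
    also have "t powr s = t powr (s - r) * t powr r" by (simp flip: powr_add)
    also have "\<dots> + \<eta> \<le> D * t powr r + \<eta>"
      using t by (intro add_right_mono mult_right_mono) auto
    also have "\<dots> = C * (t * \<delta>) powr r"
      using t \<delta> by (simp add: \<eta>_def D_def powr_mult)
    finally have "(t * \<bar>A v w\<bar>) powr r \<le> (t * \<delta>) powr r" using C by simp
    then have "t * \<bar>A v w\<bar> \<le> t * \<delta>"
      using r t \<delta> powr_less_mono2[of r "t * \<delta>" "t * \<bar>A v w\<bar>"] by (meson less_imp_le linorder_not_le mult_pos_pos)
    then show ?thesis using t by simp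
  qed
  then show ?thesis using \<eta> by blast
qed

lemma small_beyond_support:
  assumes "X.convex_dual r" "0 < r" "r < s" "upper_estimate s SY NY" "\<delta> > 0"
  shows "\<exists>\<eta>>0. \<forall>A x y v w. bilinear A \<and> x \<in> SX \<and> NX x \<le> 1 \<and> y \<in> SY \<and> NY y \<le> 1 \<and> 1 - \<eta> \<le> A x y \<and>
    v \<in> SX \<and> w \<in> SY \<and> orth y w \<longrightarrow> \<bar>A v w\<bar> \<le> \<delta> * NX v * NY w"
proof -
  obtain \<eta> where \<eta>: "\<eta> > 0" and unit: "\<And>A x y v w. bilinear A \<Longrightarrow> x \<in> SX \<Longrightarrow> NX x \<le> 1 \<Longrightarrow> y \<in> SY
      \<Longrightarrow> NY y \<le> 1 \<Longrightarrow> 1 - \<eta> \<le> A x y \<Longrightarrow> v \<in> SX \<Longrightarrow> NX v \<le> 1 \<Longrightarrow> w \<in> SY \<Longrightarrow> NY w \<le> 1 \<Longrightarrow> orth y w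
      \<Longrightarrow> \<bar>A v w\<bar> \<le> \<delta>"
    using small_beyond_support_unit[OF assms] by blast
  have "\<bar>A v w\<bar> \<le> \<delta> * NX v * NY w"
    if A: "bilinear A" and xy: "x \<in> SX" "NX x \<le> 1" "y \<in> SY" "NY y \<le> 1" "1 - \<eta> \<le> A x y"
      and vw: "v \<in> SX" "w \<in> SY" "orth y w" for A x y v w
  proof (cases "NX v = 0 \<or> NY w = 0")
    case True
    have "\<bar>A v w\<bar> \<le> NX v * NY w" using A vw unfolding bilinear_def by blast
    then show ?thesis using True by auto
  next
    case False
    then have pos: "NX v > 0" "NY w > 0" using X.nonneg[OF vw(1)] Y.nonneg[OF vw(2)] by auto
    have in': "(1 / NX v) *\<^sub>R v \<in> SX" "(1 / NY w) *\<^sub>R w \<in> SY" "orth y ((1 / NY w) *\<^sub>R w)"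
      using vw subspace_scale[OF X.subspace] subspace_scale[OF Y.subspace]
        subspace_scale[OF subspace_orth, of w y] by auto
    have "\<bar>A ((1 / NX v) *\<^sub>R v) ((1 / NY w) *\<^sub>R w)\<bar> \<le> \<delta>"
      by (rule unit[OF A xy in'(1) _ in'(2) _ in'(3)])
        (use pos X.scaleR[OF vw(1), of "1 / NX v"] Y.scaleR[OF vw(2), of "1 / NY w"] in auto)
    moreover have "A ((1 / NX v) *\<^sub>R v) ((1 / NY w) *\<^sub>R w) = A v w / (NX v * NY w)"
      using A vw in' unfolding bilinear_def by simp
    ultimately show ?thesis using pos by (simp add: abs_divide abs_mult field_simps)
  qed
  then show ?thesis using \<eta> by blast
qed

end

text \<open>The estimate beyond the support holds for every v in the other factor, so it covers the
  coordinate vectors in \<open>rigid\<close> too. The two halves of the symmetrized form are handled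
  by the two orders of the factors, hence the interpretation \<open>flip\<close>.\<close>

lemma (in lattice_pair) rigid_symmetrized:
  assumes X: "X.convex_dual r" "0 < r" "r < s" "upper_estimate s SY NY"
    and Y: "Y.convex_dual q" "0 < q" "q < p" "upper_estimate p SX NX"
  shows "J.rigid {symmetrized A |A. bilinear A}"
  unfolding J.rigid_def
proof (intro allI impI)
  fix \<delta> :: real
  assume \<delta>: "\<delta> > 0"
  interpret flip: lattice_pair SY NY SX NX by unfold_locales
  obtain \<eta>1 where \<eta>1: "\<eta>1 > 0" and right: "\<And>A x y v w. bilinear A \<Longrightarrow> x \<in> SX \<Longrightarrow> NX x \<le> 1 \<Longrightarrow> y \<in> SY
      \<Longrightarrow> NY y \<le> 1 \<Longrightarrow> 1 - \<eta>1 \<le> A x y \<Longrightarrow> v \<in> SX \<Longrightarrow> w \<in> SY \<Longrightarrow> orth y w \<Longrightarrow> \<bar>A v w\<bar> \<le> \<delta> * NX v * NY w"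
    using small_beyond_support[OF X \<delta>] by blast
  obtain \<eta>2 where \<eta>2: "\<eta>2 > 0" and left: "\<And>A y x w v. flip.bilinear A \<Longrightarrow> y \<in> SY \<Longrightarrow> NY y \<le> 1 \<Longrightarrow> x \<in> SX
      \<Longrightarrow> NX x \<le> 1 \<Longrightarrow> 1 - \<eta>2 \<le> A y x \<Longrightarrow> w \<in> SY \<Longrightarrow> v \<in> SX \<Longrightarrow> orth x v \<Longrightarrow> \<bar>A w v\<bar> \<le> \<delta> * NY w * NX v"
    using flip.small_beyond_support[OF Y \<delta>] by blast
  define \<eta> where "\<eta> = min \<eta>1 \<eta>2"
  have \<eta>: "\<eta> > 0" "\<eta> \<le> \<eta>1" "\<eta> \<le> \<eta>2" using \<eta>1 \<eta>2 by (auto simp: \<eta>_def)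
  have main: "\<bar>symmetrized A v w\<bar> \<le> \<delta> * join_norm v * join_norm w"
    if A: "bilinear A" and z: "z \<in> join_carrier" "join_norm z \<le> 1" "1 - \<eta> \<le> symmetrized A z z"
      and w: "w \<in> join_carrier" "orth z w" and v: "v \<in> join_carrier" for A z w v
  proof -
    have A': "flip.bilinear (\<lambda>y x. A x y)"
      using A unfolding bilinear_def flip.bilinear_def by (simp add: mult.commute)
    have zz: "1 - \<eta> \<le> A (z \<circ> Inl) (z \<circ> Inr)" using z(3) by (simp add: symmetrized_def)
    have o: "orth (z \<circ> Inl) (w \<circ> Inl)" "orth (z \<circ> Inr) (w \<circ> Inr)" using w(2) by (auto simp: orth_def)
    have prod: "\<delta> * a * b \<le> \<delta> * join_norm v * join_norm w"
      if "0 \<le> a" "a \<le> join_norm v" "0 \<le> b" "b \<le> join_norm w" for a b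
      using that \<delta> by (intro mult_mono mult_nonneg_nonneg) auto
    have "\<bar>A (v \<circ> Inl) (w \<circ> Inr)\<bar> \<le> \<delta> * NX (v \<circ> Inl) * NY (w \<circ> Inr)"
      using z w v zz o \<eta> by (intro right[OF A, of "z \<circ> Inl" "z \<circ> Inr"]) (auto simp: join_carrier_def join_norm_def)
    also have "\<dots> \<le> \<delta> * join_norm v * join_norm w"
      using v w by (intro prod) (auto simp: join_carrier_def join_norm_def X.nonneg Y.nonneg)
    finally have 1: "\<bar>A (v \<circ> Inl) (w \<circ> Inr)\<bar> \<le> \<delta> * join_norm v * join_norm w" .
    have "\<bar>A (w \<circ> Inl) (v \<circ> Inr)\<bar> \<le> \<delta> * NY (v \<circ> Inr) * NX (w \<circ> Inl)"
      using z w v zz o \<eta> by (intro left[OF A', of "z \<circ> Inr" "z \<circ> Inl"]) (auto simp: join_carrier_def join_norm_def)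
    also have "\<dots> \<le> \<delta> * join_norm v * join_norm w"
      using v w by (intro prod) (auto simp: join_carrier_def join_norm_def X.nonneg Y.nonneg)
    finally show ?thesis using 1 by (simp add: symmetrized_def)
  qed
  show "\<exists>\<eta>>0. \<forall>a\<in>{symmetrized A |A. bilinear A}. \<forall>z\<in>join_carrier. join_norm z \<le> 1 \<and> 1 - \<eta> \<le> a z z \<longrightarrow>
     (\<forall>w\<in>join_carrier. orth z w \<longrightarrow>
        (\<forall>v\<in>join_carrier. orth z v \<longrightarrow> \<bar>a v w\<bar> \<le> \<delta> * join_norm v * join_norm w) \<and>
        (\<forall>i c. \<bar>a (single i c) w\<bar> \<le> \<delta> * join_norm (single i c) * join_norm w))"
    using \<eta>(1) by (intro exI[of _ \<eta>]) (auto intro!: main J.single_in)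
qed

section \<open>Tensor norms generated by squares\<close>

text \<open>\<open>R u c\<close> says that \<open>u\<close> has a representation of cost \<open>c\<close>. Both tensor norms are infima of
  costs, and in both cases every tensor is a sum of squares \<open>sq z z\<close> of vectors of a lattice:
  for \<open>X \<otimes> Y\<close> the lattice is the sum of \<open>X\<close> and \<open>Y\<close>.\<close>

locale square_generated = Z: function_lattice SZ NZ
  for SZ :: "('i \<Rightarrow> 'k::{real_normed_field,euclidean_space}) set" and NZ +
  fixes R :: "('a \<Rightarrow> 'k) \<Rightarrow> real \<Rightarrow> bool" and sq :: "('i \<Rightarrow> 'k) \<Rightarrow> ('i \<Rightarrow> 'k) \<Rightarrow> 'a \<Rightarrow> 'k"
  assumes R_zero: "R 0 0"
    and R_add: "\<lbrakk>R u c; R v d\<rbrakk> \<Longrightarrow> R (u + v) (c + d)"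
    and R_smul: "R u c \<Longrightarrow> R (smul b u) (norm b * c)"
    and R_nonneg: "R u c \<Longrightarrow> 0 \<le> c"
    and R_sq: "\<lbrakk>z \<in> SZ; w \<in> SZ\<rbrakk> \<Longrightarrow> \<exists>c. R (sq z w) c"
    and R_square: "z \<in> SZ \<Longrightarrow> \<exists>c \<le> (NZ z)\<^sup>2. R (sq z z) c"
    and sq_commute: "sq z w = sq w z"
    and sq_add: "\<lbrakk>z \<in> SZ; z' \<in> SZ; w \<in> SZ\<rbrakk> \<Longrightarrow> sq (z + z') w = sq z w + sq z' w"
    and sq_smul: "\<lbrakk>z \<in> SZ; w \<in> SZ\<rbrakk> \<Longrightarrow> sq (smul b z) w = sq z (smul b w)"
    and sq_scaleR: "\<lbrakk>z \<in> SZ; w \<in> SZ\<rbrakk> \<Longrightarrow> sq (r *\<^sub>R z) w = r *\<^sub>R sq z w"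
    and generated: "R u c \<Longrightarrow> \<exists>(n::nat) z. (\<forall>j<n. z j \<in> SZ) \<and> u = (\<Sum>j<n. sq (z j) (z j)) \<and>
      (\<Sum>j<n. (NZ (z j))\<^sup>2) \<le> c"
begin

definition G :: "('a \<Rightarrow> 'k) set" where "G = {u. \<exists>c. R u c}"

definition NG :: "('a \<Rightarrow> 'k) \<Rightarrow> real" where "NG u = Inf {c. R u c}"

lemma NG_le: "R u c \<Longrightarrow> NG u \<le> c"
  unfolding NG_def using R_nonneg by (intro cInf_lower bdd_belowI[of _ 0]) auto

lemma le_NG: "u \<in> G \<Longrightarrow> (\<And>c. R u c \<Longrightarrow> l \<le> c) \<Longrightarrow> l \<le> NG u"
  unfolding NG_def G_def by (intro cInf_greatest) auto

lemma NG_less: "u \<in> G \<Longrightarrow> NG u < c \<Longrightarrow> \<exists>d<c. R u d"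
  using le_NG[of u c] by (meson not_le)

sublocale G: function_seminorm G NG
proof
  show "0 \<in> G" using R_zero by (auto simp: G_def)
  show "x + y \<in> G" if "x \<in> G" "y \<in> G" for x y
    using that unfolding G_def by (blast intro: R_add)
  show smul: "smul c x \<in> G" if "x \<in> G" for c x
    using that R_smul by (auto simp: G_def)
  show "NG (x + y) \<le> NG x + NG y" if "x \<in> G" "y \<in> G" for x y
  proof -
    have "NG (x + y) - d \<le> c" if "R x c" "R y d" for c d
      using NG_le[OF R_add[OF that]] by simp
    then have "NG (x + y) - d \<le> NG x" if "R y d" for d
      using that by (intro le_NG[OF \<open>x \<in> G\<close>]) auto
    then have "NG (x + y) - NG x \<le> d" if "R y d" for d
      using that by fastforce
    then have "NG (x + y) - NG x \<le> NG y"
      by (intro le_NG[OF \<open>y \<in> G\<close>])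
    then show ?thesis by simp
  qed
  have le: "NG (smul c x) \<le> norm c * NG x" if "x \<in> G" for c x
  proof (cases "c = 0")
    case True
    then show ?thesis using NG_le[OF R_zero] by (simp add: smul_algebra)
  next
    case False
    have "NG (smul c x) / norm c \<le> NG x"
    proof (rule le_NG[OF that])
      fix d assume "R x d"
      then show "NG (smul c x) / norm c \<le> d"
        using NG_le[OF R_smul, of x d c] False by (simp add: field_simps)
    qed
    then show ?thesis using False by (simp add: field_simps)
  qed
  show "NG (smul c x) = norm c * NG x" if "x \<in> G" for c x
  proof (cases "c = 0")
    case True
    have "0 \<le> NG (smul c x)" using smul[OF that] R_nonneg by (intro le_NG) auto
    then show ?thesis using le[OF that, of c] True by simp
  next
    case False
    have "smul (inverse c) (smul c x) = x" using False by (simp add: smul_algebra)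
    then have "NG x \<le> inverse (norm c) * NG (smul c x)"
      using le[OF smul[OF that, of c], of "inverse c"] by (simp add: norm_inverse)
    then have "norm c * NG x \<le> NG (smul c x)" using False by (simp add: field_simps)
    then show ?thesis using le[OF that, of c] by simp
  qed
qed

lemma sq_in: "\<lbrakk>z \<in> SZ; w \<in> SZ\<rbrakk> \<Longrightarrow> sq z w \<in> G"
  using R_sq by (auto simp: G_def)

lemma form_sq:
  assumes "G.contractive q"
  shows "Z.form (\<lambda>z w. q (sq z w))"
proof -
  have q: "linear q" "\<And>v. v \<in> G \<Longrightarrow> \<bar>q v\<bar> \<le> NG v"
    using assms by (auto simp: G.contractive_def)
  have "\<bar>q (sq z z)\<bar> \<le> (NZ z)\<^sup>2" if "z \<in> SZ" for z
  proof -
    obtain c where "c \<le> (NZ z)\<^sup>2" "R (sq z z) c" using R_square[OF \<open>z \<in> SZ\<close>] by blast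
    then show ?thesis using q(2)[OF sq_in[OF that that]] NG_le[of "sq z z" c] by simp
  qed
  then show ?thesis
    unfolding Z.form_def
    by (auto simp: sq_add sq_smul sq_scaleR linear_add[OF q(1)] linear_scale[OF q(1)]
        intro: arg_cong[OF sq_commute])
qed

text \<open>An averaging argument: g is a sum of squares of total cost c < 1 + \<eta> / 4, so if no
  normalized summand were a near-maximizer, q n g would fall below 1 - \<eta> / 4. The candidates
  come from g alone, so one finite set serves all n.\<close>

lemma approximate_maximizers:
  assumes q: "\<And>n. G.contractive (q n)"
    and tails: "\<And>z \<epsilon>. z \<in> SZ \<Longrightarrow> \<epsilon> > 0 \<Longrightarrow> \<exists>F. finite F \<and> NZ (proj (- F) z) < \<epsilon>"
    and g: "g \<in> G" "NG g < 1 + \<eta> / 4" "\<forall>\<^sub>F n in sequentially. 1 - \<eta> / 4 \<le> q n g"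
    and \<eta>: "0 < \<eta>" "\<eta> \<le> 1"
  shows "\<exists>Z\<subseteq>SZ. finite Z \<and> (\<forall>z\<in>Z. NZ z \<le> 1 \<and> finite (supp z)) \<and>
    (\<forall>\<^sub>F n in sequentially. \<exists>z\<in>Z. 1 - \<eta> \<le> q n (sq z z))"
proof -
  obtain c where c: "c < 1 + \<eta> / 4" "R g c" using NG_less[OF g(1,2)] by blast
  obtain m :: nat and z where mz: "(\<forall>j<m. z j \<in> SZ) \<and> g = (\<Sum>j<m. sq (z j) (z j)) \<and> (\<Sum>j<m. (NZ (z j))\<^sup>2) \<le> c"
    using generated[OF c(2)] by (elim exE) (rule that)
  have z: "z j \<in> SZ" if "j < m" for j using mz that by blast
  have g_eq: "g = (\<Sum>j<m. sq (z j) (z j))" and cost: "(\<Sum>j<m. (NZ (z j))\<^sup>2) \<le> c" using mz by auto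
  \<comment> \<open>Truncating z j with error e changes the square by at most 4 N(z j) N(e) + N(e)^2
    <= 5 N(z j) N(e); this choice makes the m errors add up to at most \<eta> / 4. The added ones
    keep the denominators positive.\<close>
  define \<epsilon> where "\<epsilon> j = \<eta> / (4 * (real m + 1) * (5 * NZ (z j) + 1))" for j
  have den: "0 < real m + 1" "0 < 5 * NZ (z j) + 1" if "j < m" for j
    using Z.nonneg[OF z[OF that]] by auto
  have "\<forall>j<m. \<exists>F. finite F \<and> NZ (proj (- F) (z j)) < \<epsilon> j"
  proof (intro allI impI tails z)
    fix j assume "j < m"
    then show "\<epsilon> j > 0" unfolding \<epsilon>_def using \<eta> den[of j] by (intro divide_pos_pos mult_pos_pos) auto
  qed
  then obtain F where F: "\<And>j. j < m \<Longrightarrow> finite (F j)" "\<And>j. j < m \<Longrightarrow> NZ (proj (- F j) (z j)) < \<epsilon> j"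
    by metis
  define y where "y j = proj (F j) (z j)" for j
  have y: "y j \<in> SZ" "NZ (y j) \<le> NZ (z j)" "finite (supp (y j))" if "j < m" for j
  proof -
    show "y j \<in> SZ" "NZ (y j) \<le> NZ (z j)"
      using z[OF that] by (simp_all add: y_def Z.proj_in Z.N_proj)
    show "finite (supp (y j))"
      using F(1)[OF that] by (auto simp: y_def supp_def proj_def)
  qed
  have close: "\<bar>q n (sq (z j) (z j)) - q n (sq (y j) (y j))\<bar> \<le> \<eta> / (4 * (real m + 1))" if j: "j < m" for n j
  proof -
    define e where "e = proj (- F j) (z j)"
    have e: "e \<in> SZ" "NZ e \<le> NZ (z j)" "NZ e \<le> \<epsilon> j" "z j = y j + e"
      using z[OF j] F(2)[OF j] Z.N_proj[OF z[OF j]] proj_split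
      by (auto simp: e_def y_def Z.proj_in)
    have f: "Z.form (\<lambda>z w. q n (sq z w))" by (rule form_sq[OF q])
    have "q n (sq (z j) (z j)) = q n (sq (y j) (y j)) + 2 * q n (sq (y j) e) + q n (sq e e)"
      using Z.form_square_add[OF f y(1)[OF j] e(1)] e(4) by simp
    then have "\<bar>q n (sq (z j) (z j)) - q n (sq (y j) (y j))\<bar> \<le> 2 * (2 * NZ (y j) * NZ e) + (NZ e)\<^sup>2"
      using Z.form_bound[OF f y(1)[OF j] e(1)] Z.form_le[OF f e(1)] by linarith
    also have "\<dots> \<le> 4 * (NZ (z j) * NZ e) + NZ (z j) * NZ e"
      using mult_right_mono[OF y(2)[OF j] Z.nonneg[OF e(1)]]
        mult_right_mono[OF e(2) Z.nonneg[OF e(1)]] unfolding power2_eq_square by linarith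
    also have "\<dots> \<le> (5 * NZ (z j) + 1) * \<epsilon> j"
      using e(3) Z.nonneg[OF e(1)] Z.nonneg[OF z[OF j]] mult_left_mono[OF e(3), of "5 * NZ (z j) + 1"]
      by (simp add: algebra_simps)
    also have "\<dots> = \<eta> / (4 * (real m + 1))"
      using den[OF j] by (simp add: \<epsilon>_def)
    finally show ?thesis .
  qed
  \<comment> \<open>Normalized by the norm of z j and not of its truncation: the weights remain the
    squares that are summed in the cost, and the norms are still at most 1.\<close>
  define Z where "Z = (\<lambda>j. (1 / NZ (z j)) *\<^sub>R y j) ` {j. j < m \<and> NZ (z j) \<noteq> 0}"
  have "\<exists>w\<in>Z. 1 - \<eta> \<le> q n (sq w w)" if low: "1 - \<eta> / 4 \<le> q n g" for n
  proof (rule ccontr)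
    assume none: "\<not> ?thesis"
    have f: "Z.form (\<lambda>z w. q n (sq z w))" by (rule form_sq[OF q])
    have lin: "linear (q n)" using q[of n] by (simp add: G.contractive_def)
    have le: "q n (sq (y j) (y j)) \<le> (1 - \<eta>) * (NZ (z j))\<^sup>2" if j: "j < m" for j
    proof (cases "NZ (z j) = 0")
      case True
      then have "NZ (y j) = 0" using y(2)[OF j] Z.nonneg[OF y(1)[OF j]] by simp
      then show ?thesis using Z.form_le[OF f y(1)[OF j]] True by simp
    next
      case False
      then have pos: "NZ (z j) > 0" using Z.nonneg[OF z[OF j]] by simp
      have "q n (sq ((1 / NZ (z j)) *\<^sub>R y j) ((1 / NZ (z j)) *\<^sub>R y j)) < 1 - \<eta>"
        using none j False by (auto simp: Z_def not_le)
      moreover have "q n (sq ((1 / NZ (z j)) *\<^sub>R y j) ((1 / NZ (z j)) *\<^sub>R y j))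
          = q n (sq (y j) (y j)) / (NZ (z j))\<^sup>2"
        using y(1)[OF j] subspace_scale[OF Z.subspace y(1)[OF j]]
          Z.form_scale_left[OF f] Z.form_scale_right[OF f] by (simp add: power2_eq_square)
      ultimately show ?thesis using pos by (simp add: field_simps)
    qed
    have "q n g = (\<Sum>j<m. q n (sq (z j) (z j)))"
      by (simp add: g_eq linear_sum[OF lin])
    also have "\<dots> \<le> (\<Sum>j<m. (1 - \<eta>) * (NZ (z j))\<^sup>2 + \<eta> / (4 * (real m + 1)))"
    proof (rule sum_mono)
      fix j assume "j \<in> {..<m}"
      then show "q n (sq (z j) (z j)) \<le> (1 - \<eta>) * (NZ (z j))\<^sup>2 + \<eta> / (4 * (real m + 1))"
        using close[of j n] le[of j] by (auto simp: abs_le_iff)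
    qed
    also have "\<dots> = (1 - \<eta>) * (\<Sum>j<m. (NZ (z j))\<^sup>2) + real m * (\<eta> / (4 * (real m + 1)))"
      by (simp add: sum.distrib sum_distrib_left)
    also have "\<dots> \<le> (1 - \<eta>) * (1 + \<eta> / 4) + \<eta> / 4"
    proof (rule add_mono)
      show "(1 - \<eta>) * (\<Sum>j<m. (NZ (z j))\<^sup>2) \<le> (1 - \<eta>) * (1 + \<eta> / 4)"
        using c cost \<eta> by (intro mult_left_mono) auto
      show "real m * (\<eta> / (4 * (real m + 1))) \<le> \<eta> / 4"
        using \<eta> by (simp add: field_simps)
    qed
    also have "\<dots> = 1 - \<eta> / 2 - \<eta> * \<eta> / 4"
      by (simp add: field_simps)
    also have "\<dots> < 1 - \<eta> / 4"
      using \<eta>(1) mult_pos_pos[OF \<eta>(1) \<eta>(1)] by linarith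
    finally show False using low by simp
  qed
  then have "\<forall>\<^sub>F n in sequentially. \<exists>w\<in>Z. 1 - \<eta> \<le> q n (sq w w)"
    using g(3) by (auto elim: eventually_mono)
  moreover have "finite Z" by (simp add: Z_def)
  moreover have "w \<in> SZ \<and> NZ w \<le> 1 \<and> finite (supp w)" if "w \<in> Z" for w
  proof -
    obtain j where j: "j < m" "NZ (z j) \<noteq> 0" "w = (1 / NZ (z j)) *\<^sub>R y j" using \<open>w \<in> Z\<close> by (auto simp: Z_def)
    then have "NZ (z j) > 0" using Z.nonneg[OF z[OF j(1)]] by simp
    moreover have "supp w \<subseteq> supp (y j)" by (auto simp: j(3) supp_def)
    ultimately show ?thesis
      using j y[OF j(1)] Z.scaleR[OF y(1)[OF j(1)], of "1 / NZ (z j)"] subspace_scale[OF Z.subspace]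
      by (auto simp: finite_subset)
  qed
  ultimately show ?thesis by (intro exI[of _ Z]) auto
qed

text \<open>Rigidity makes the functionals close on squares; as every tensor is a sum of squares
  whose total cost approximates its norm, they are then close on the whole unit ball.\<close>

theorem strongly_subdifferentiable_if_rigid:
  assumes rigid: "Z.rigid \<A>" and \<A>: "\<And>q. G.contractive q \<Longrightarrow> (\<lambda>z w. q (sq z w)) \<in> \<A>"
    and tails: "\<And>z \<epsilon>. z \<in> SZ \<Longrightarrow> \<epsilon> > 0 \<Longrightarrow> \<exists>F. finite F \<and> NZ (proj (- F) z) < \<epsilon>"
  shows "strongly_subdifferentiable (completion (function_space G NG))"
proof (rule G.strongly_subdifferentiable_completion)
  fix u q \<delta>
  assume u: "u \<in> G.cauchys" "G.lim_norm u = 1" and q: "\<And>n::nat. G.contractive (q n)"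
    and lim: "\<And>\<eta>. \<eta> > 0 \<Longrightarrow> \<exists>K. \<forall>k\<ge>K. \<forall>\<^sub>F n in sequentially. 1 - \<eta> \<le> q n (u k)"
    and \<delta>: "(0::real) < \<delta>"
  have "\<exists>J. infinite J \<and> (\<forall>n\<in>J. \<forall>m\<in>J. \<forall>x\<in>SZ. \<bar>q n (sq x x) - q m (sq x x)\<bar> \<le> \<delta> * (NZ x)\<^sup>2)"
  proof (rule Z.rigid_forms_close[OF form_sq[OF q] \<A>[OF q] rigid _ \<delta>])
    fix \<eta> :: real
    assume "\<eta> > 0"
    define \<eta>' where "\<eta>' = min \<eta> 1"
    have \<eta>': "0 < \<eta>'" "\<eta>' \<le> 1" "\<eta>' \<le> \<eta>" using \<open>\<eta> > 0\<close> by (auto simp: \<eta>'_def)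
    obtain K where K: "\<And>k. k \<ge> K \<Longrightarrow> \<forall>\<^sub>F n in sequentially. 1 - \<eta>' / 4 \<le> q n (u k)"
      using lim[of "\<eta>' / 4"] \<eta>' by auto
    have "\<forall>\<^sub>F k in sequentially. NG (u k) < 1 + \<eta>' / 4"
      using G.lim_norm[OF u(1)] u(2) \<eta>' by (intro order_tendstoD(2)[where a = "1 + \<eta>' / 4"]) auto
    then have "\<forall>\<^sub>F k in sequentially. K \<le> k \<and> NG (u k) < 1 + \<eta>' / 4"
      by (intro eventually_conj eventually_ge_at_top)
    then obtain k where k: "k \<ge> K" "NG (u k) < 1 + \<eta>' / 4"
      using eventually_happens[of _ sequentially] by auto
    \<comment> \<open>The point u is a Cauchy sequence; a late term u k, of norm almost 1 and almost
      normed by late q n, takes its place.\<close>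
    obtain Z where "Z \<subseteq> SZ" "finite Z" "\<forall>z\<in>Z. NZ z \<le> 1 \<and> finite (supp z)"
        and ev: "\<forall>\<^sub>F n in sequentially. \<exists>z\<in>Z. 1 - \<eta>' \<le> q n (sq z z)"
      using approximate_maximizers[of q, OF q tails G.cauchysD[OF u(1)] k(2) K[OF k(1)] \<eta>'(1,2)] by blast
    moreover have "\<forall>\<^sub>F n in sequentially. \<exists>z\<in>Z. 1 - \<eta> \<le> q n (sq z z)"
      using ev
    proof (rule eventually_mono)
      fix n assume "\<exists>z\<in>Z. 1 - \<eta>' \<le> q n (sq z z)"
      then show "\<exists>z\<in>Z. 1 - \<eta> \<le> q n (sq z z)" using \<eta>'(3) by force
    qed
    ultimately show "\<exists>Z\<subseteq>SZ. finite Z \<and> (\<forall>z\<in>Z. NZ z \<le> 1 \<and> finite (supp z)) \<and>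
        (\<forall>\<^sub>F n in sequentially. \<exists>z\<in>Z. 1 - \<eta> \<le> q n (sq z z))" by blast
  qed
  then obtain J where J: "infinite J"
      and close: "\<And>n m x. n \<in> J \<Longrightarrow> m \<in> J \<Longrightarrow> x \<in> SZ \<Longrightarrow> \<bar>q n (sq x x) - q m (sq x x)\<bar> \<le> \<delta> * (NZ x)\<^sup>2"
    by blast
  have "\<bar>q n v - q m v\<bar> \<le> \<delta> * NG v" if nm: "n \<in> J" "m \<in> J" and v: "v \<in> G" for n m v
  proof -
    have "\<bar>q n v - q m v\<bar> / \<delta> \<le> c" if "R v c" for c
    proof -
      obtain l :: nat and z where lz: "(\<forall>j<l. z j \<in> SZ) \<and> v = (\<Sum>j<l. sq (z j) (z j)) \<and> (\<Sum>j<l. (NZ (z j))\<^sup>2) \<le> c"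
        using generated[OF \<open>R v c\<close>] by (elim exE) (rule that)
      have z: "z j \<in> SZ" if "j < l" for j using lz that by blast
      have v_eq: "v = (\<Sum>j<l. sq (z j) (z j))" and cost: "(\<Sum>j<l. (NZ (z j))\<^sup>2) \<le> c" using lz by auto
      have lin: "linear (q n)" "linear (q m)" using q by (auto simp: G.contractive_def)
      have "q n v - q m v = (\<Sum>j<l. q n (sq (z j) (z j)) - q m (sq (z j) (z j)))"
        by (simp add: v_eq linear_sum[OF lin(1)] linear_sum[OF lin(2)] sum_subtractf)
      also have "\<bar>\<dots>\<bar> \<le> (\<Sum>j<l. \<delta> * (NZ (z j))\<^sup>2)"
        by (rule order_trans[OF sum_abs]) (intro sum_mono close nm z, auto)
      also have "\<dots> \<le> \<delta> * c"
        using cost \<delta> by (simp flip: sum_distrib_left)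
      finally show ?thesis using \<delta> by (simp add: field_simps)
    qed
    then have "\<bar>q n v - q m v\<bar> / \<delta> \<le> NG v" by (intro le_NG v)
    then show ?thesis using \<delta> by (simp add: field_simps)
  qed
  moreover obtain n where "n \<in> J" using J by fastforce
  ultimately have "\<forall>m\<in>J. \<forall>v\<in>G. \<bar>q n v - q m v\<bar> \<le> \<delta> * NG v" by blast
  then have "J \<subseteq> {m. \<forall>v\<in>G. \<bar>q n v - q m v\<bar> \<le> \<delta> * NG v}" by blast
  then show "\<exists>n. \<exists>\<^sub>\<infinity>m. \<forall>v\<in>G. \<bar>q n v - q m v\<bar> \<le> \<delta> * NG v"
    unfolding INFM_iff_infinite using J infinite_super by blast
qed

end

section \<open>Projective tensor products of lattices\<close>

lemma sum_lessThan_add: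
  fixes h :: "nat \<Rightarrow> 'b::comm_monoid_add"
  shows "(\<Sum>j<n + m. h j) = (\<Sum>j<n. h j) + (\<Sum>j<m. h (n + j))"
  by (induction m) (auto simp: add.assoc)

context lattice_pair
begin

definition tens :: "('i \<Rightarrow> 'k) \<Rightarrow> ('j \<Rightarrow> 'k) \<Rightarrow> (('i \<Rightarrow> 'k) \<Rightarrow> ('j \<Rightarrow> 'k) \<Rightarrow> 'k) \<Rightarrow> 'k" where
  "tens = tensor (function_space SX NX) (function_space SY NY)"

lemma tens_add_left: "\<lbrakk>x \<in> SX; x' \<in> SX; y \<in> SY\<rbrakk> \<Longrightarrow> tens (x + x') y = tens x y + tens x' y"
  and tens_add_right: "\<lbrakk>x \<in> SX; y \<in> SY; y' \<in> SY\<rbrakk> \<Longrightarrow> tens x (y + y') = tens x y + tens x y'"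
  and tens_smul_left: "\<lbrakk>x \<in> SX; y \<in> SY\<rbrakk> \<Longrightarrow> tens (smul c x) y = smul c (tens x y)"
  and tens_smul_right: "\<lbrakk>x \<in> SX; y \<in> SY\<rbrakk> \<Longrightarrow> tens x (smul c y) = smul c (tens x y)"
  by (auto simp: tens_def tensor_def bilinear_form_def fun_eq_iff)

lemma tens_scaleR_left: "\<lbrakk>x \<in> SX; y \<in> SY\<rbrakk> \<Longrightarrow> tens (r *\<^sub>R x) y = r *\<^sub>R tens x y"
  and tens_scaleR_right: "\<lbrakk>x \<in> SX; y \<in> SY\<rbrakk> \<Longrightarrow> tens x (r *\<^sub>R y) = r *\<^sub>R tens x y"
  by (simp_all add: scaleR_eq_smul tens_smul_left tens_smul_right)

definition cost :: "((('i \<Rightarrow> 'k) \<Rightarrow> ('j \<Rightarrow> 'k) \<Rightarrow> 'k) \<Rightarrow> 'k) \<Rightarrow> real \<Rightarrow> bool" where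
  "cost u c \<longleftrightarrow> (\<exists>n x y. (\<forall>j<n. x j \<in> SX \<and> y j \<in> SY) \<and> u = (\<Sum>j<(n::nat). tens (x j) (y j)) \<and>
     c = (\<Sum>j<n. NX (x j) * NY (y j)))"

definition sq :: "('i + 'j \<Rightarrow> 'k) \<Rightarrow> ('i + 'j \<Rightarrow> 'k) \<Rightarrow> (('i \<Rightarrow> 'k) \<Rightarrow> ('j \<Rightarrow> 'k) \<Rightarrow> 'k) \<Rightarrow> 'k" where
  "sq z w = (1 / 2) *\<^sub>R (tens (z \<circ> Inl) (w \<circ> Inr) + tens (w \<circ> Inl) (z \<circ> Inr))"

lemma sq_self: "sq z z = tens (z \<circ> Inl) (z \<circ> Inr)"
  by (simp add: sq_def scaleR_2[symmetric])

lemma cost_tens: "x \<in> SX \<Longrightarrow> y \<in> SY \<Longrightarrow> cost (tens x y) (NX x * NY y)"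
  unfolding cost_def by (intro exI[of _ 1] exI[of _ "\<lambda>_. x"] exI[of _ "\<lambda>_. y"]) auto

lemma cost_add:
  assumes "cost u c" "cost v d"
  shows "cost (u + v) (c + d)"
proof -
  obtain n m :: nat and x y x' y' where
    1: "\<forall>j<n. x j \<in> SX \<and> y j \<in> SY" "u = (\<Sum>j<n. tens (x j) (y j))" "c = (\<Sum>j<n. NX (x j) * NY (y j))" and
    2: "\<forall>j<m. x' j \<in> SX \<and> y' j \<in> SY" "v = (\<Sum>j<m. tens (x' j) (y' j))" "d = (\<Sum>j<m. NX (x' j) * NY (y' j))"
    using assms unfolding cost_def by blast
  define X' where "X' j = (if j < n then x j else x' (j - n))" for j
  define Y' where "Y' j = (if j < n then y j else y' (j - n))" for j
  have "u + v = (\<Sum>j<n + m. tens (X' j) (Y' j))" "c + d = (\<Sum>j<n + m. NX (X' j) * NY (Y' j))"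
    unfolding sum_lessThan_add 1 2
    by (intro arg_cong2[of _ _ _ _ "(+)"] sum.cong; simp add: X'_def Y'_def)+
  moreover have "\<forall>j<n + m. X' j \<in> SX \<and> Y' j \<in> SY"
    using 1(1) 2(1) by (auto simp: X'_def Y'_def)
  ultimately show ?thesis
    unfolding cost_def by blast
qed

lemma cost_smul:
  assumes "cost u c"
  shows "cost (smul b u) (norm b * c)"
proof -
  obtain n :: nat and x y where
    1: "\<forall>j<n. x j \<in> SX \<and> y j \<in> SY" "u = (\<Sum>j<n. tens (x j) (y j))" "c = (\<Sum>j<n. NX (x j) * NY (y j))"
    using assms unfolding cost_def by blast
  have "smul b u = (\<Sum>j<n. smul b (tens (x j) (y j)))"
    by (auto simp: 1(2) fun_eq_iff sum_fun_apply sum_distrib_left)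
  also have "\<dots> = (\<Sum>j<n. tens (smul b (x j)) (y j))"
    using 1(1) by (intro sum.cong) (auto simp: tens_smul_left)
  finally have "smul b u = (\<Sum>j<n. tens (smul b (x j)) (y j))" .
  moreover have "norm b * c = (\<Sum>j<n. NX (smul b (x j)) * NY (y j))"
    using 1(1) by (auto simp: 1(3) sum_distrib_left X.N_smul mult.assoc intro!: sum.cong)
  moreover have "\<forall>j<n. smul b (x j) \<in> SX \<and> y j \<in> SY"
    using 1(1) by (auto simp: X.smul_in)
  ultimately show ?thesis
    unfolding cost_def by (intro exI[of _ n] exI[of _ "\<lambda>j. smul b (x j)"] exI[of _ y]) simp
qed

text \<open>Makes the cost of an elementary tensor equal to the squared norm of a single vector of
  the join, so that passing to sums of squares loses nothing.\<close>

lemma balanced_square: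
  assumes xy: "x \<in> SX" "y \<in> SY"
  shows "\<exists>z\<in>join_carrier. sq z z = tens x y \<and> (join_norm z)\<^sup>2 = NX x * NY y"
proof (cases "NX x = 0 \<or> NY y = 0")
  case True
  have "tens 0 y = 0" "tens x 0 = 0" "tens 0 0 = 0"
    using tens_smul_left[OF X.zero_in xy(2), of 0] tens_smul_right[OF xy(1) Y.zero_in, of 0]
      tens_smul_left[OF X.zero_in Y.zero_in, of 0]
    by (simp_all add: smul_algebra)
  moreover have "x = 0 \<or> y = 0" using True X.definite Y.definite xy by blast
  ultimately have "tens x y = 0" by auto
  moreover have "sq 0 0 = 0" using \<open>tens 0 0 = 0\<close> by (simp add: sq_self comp_algebra)
  ultimately show ?thesis
    using True J.zero_in J.zero by (intro bexI[of _ 0]) auto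
next
  case False
  then have pos: "NX x > 0" "NY y > 0" using X.nonneg[OF xy(1)] Y.nonneg[OF xy(2)] by auto
  define r where "r = sqrt (NY y / NX x)" \<comment> \<open>equalizes the norms of the two factors\<close>
  have r: "r > 0" using pos by (simp add: r_def)
  define z where "z = case_sum (r *\<^sub>R x) ((1 / r) *\<^sub>R y)"
  have z: "z \<circ> Inl = r *\<^sub>R x" "z \<circ> Inr = (1 / r) *\<^sub>R y"
    by (auto simp: z_def fun_eq_iff)
  have in': "r *\<^sub>R x \<in> SX" "(1 / r) *\<^sub>R y \<in> SY"
    using xy subspace_scale X.subspace Y.subspace by blast+
  have "r * NX x = sqrt (NX x * NY y)" "NY y / r = sqrt (NX x * NY y)"
    using pos by (simp_all add: r_def real_sqrt_divide real_sqrt_mult field_simps flip: power2_eq_square)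
  then have "join_norm z = sqrt (NX x * NY y)"
    using r by (simp add: join_norm_def z X.scaleR[OF xy(1)] Y.scaleR[OF xy(2)])
  then have "(join_norm z)\<^sup>2 = NX x * NY y" using pos by simp
  moreover have "sq z z = tens x y"
    using r xy in' by (simp add: sq_self z tens_scaleR_left tens_scaleR_right)
  moreover have "z \<in> join_carrier" using in' by (simp add: join_carrier_def z)
  ultimately show ?thesis by blast
qed

sublocale tensors: square_generated join_carrier join_norm cost sq
proof
  show "cost 0 0" unfolding cost_def by (intro exI[of _ 0]) auto
  show "0 \<le> c" if "cost u c" for u c
    using that X.nonneg Y.nonneg unfolding cost_def by (auto intro!: sum_nonneg)
  show "\<exists>c. cost (sq z w) c" if "z \<in> join_carrier" "w \<in> join_carrier" for z w
  proof -
    have "cost (tens (z \<circ> Inl) (w \<circ> Inr)) (NX (z \<circ> Inl) * NY (w \<circ> Inr))"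
        "cost (tens (w \<circ> Inl) (z \<circ> Inr)) (NX (w \<circ> Inl) * NY (z \<circ> Inr))"
      using that by (auto simp: join_carrier_def intro!: cost_tens)
    then show ?thesis
      unfolding sq_def scaleR_eq_smul by (blast intro: cost_smul cost_add)
  qed
  show "\<exists>c\<le>(join_norm z)\<^sup>2. cost (sq z z) c" if z: "z \<in> join_carrier" for z
  proof (intro exI conjI)
    show "cost (sq z z) (NX (z \<circ> Inl) * NY (z \<circ> Inr))"
      using z unfolding sq_self by (auto simp: join_carrier_def intro!: cost_tens)
    show "NX (z \<circ> Inl) * NY (z \<circ> Inr) \<le> (join_norm z)\<^sup>2"
      using z X.nonneg[of "z \<circ> Inl"] Y.nonneg[of "z \<circ> Inr"] unfolding power2_eq_square
      by (intro mult_mono) (auto simp: join_norm_def join_carrier_def)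
  qed
  show "sq z w = sq w z" for z w by (simp add: sq_def add.commute)
  show "sq (z + z') w = sq z w + sq z' w"
    if "z \<in> join_carrier" "z' \<in> join_carrier" "w \<in> join_carrier" for z z' w
    using that by (simp add: sq_def comp_algebra join_carrier_def tens_add_left tens_add_right
        scaleR_add_right add_ac)
  show "sq (smul b z) w = sq z (smul b w)" if "z \<in> join_carrier" "w \<in> join_carrier" for z w b
    using that by (simp add: sq_def comp_algebra join_carrier_def tens_smul_left tens_smul_right)
  show "sq (r *\<^sub>R z) w = r *\<^sub>R sq z w" if "z \<in> join_carrier" "w \<in> join_carrier" for z w r
    using that by (simp add: sq_def comp_algebra join_carrier_def tens_scaleR_left tens_scaleR_right
        scaleR_add_right)
  show "\<exists>(n::nat) z. (\<forall>j<n. z j \<in> join_carrier) \<and> u = (\<Sum>j<n. sq (z j) (z j)) \<and>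
      (\<Sum>j<n. (join_norm (z j))\<^sup>2) \<le> c" if u: "cost u c" for u c
  proof -
    obtain n :: nat and x y where
      1: "\<forall>j<n. x j \<in> SX \<and> y j \<in> SY" "u = (\<Sum>j<n. tens (x j) (y j))" "c = (\<Sum>j<n. NX (x j) * NY (y j))"
      using u unfolding cost_def by blast
    have "\<forall>j<n. \<exists>z\<in>join_carrier. sq z z = tens (x j) (y j) \<and> (join_norm z)\<^sup>2 = NX (x j) * NY (y j)"
      using 1(1) balanced_square by blast
    then obtain z where z: "\<And>j. j < n \<Longrightarrow> z j \<in> join_carrier \<and> sq (z j) (z j) = tens (x j) (y j) \<and>
        (join_norm (z j))\<^sup>2 = NX (x j) * NY (y j)"
      by metis
    then show ?thesis
      unfolding 1(2,3) by (intro exI[of _ n] exI[of _ z]) auto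
  qed
qed (fact cost_add cost_smul)+

lemma projective_tensor_eq:
  "projective_tensor (function_space SX NX) (function_space SY NY) = function_space tensors.G tensors.NG"
proof -
  have rep: "tensor_rep (function_space SX NX) (function_space SY NY) u n x y \<longleftrightarrow>
      (\<forall>j<n. x j \<in> SX \<and> y j \<in> SY) \<and> u = (\<Sum>j<n. tens (x j) (y j))" for u n x y
    unfolding tensor_rep_def tens_def function_space_simps by (auto simp: fun_eq_iff sum_fun_apply)
  show ?thesis
    unfolding projective_tensor_def rep function_space_simps tensors.G_def tensors.NG_def[abs_def] cost_def
    by (intro arg_cong2[of _ _ _ _ function_space] ext arg_cong[of _ _ Inf]) auto
qed

theorem projective_tensor_ssd:
  assumes "J.rigid \<A>" "\<And>q. tensors.G.contractive q \<Longrightarrow> (\<lambda>z w. q (sq z w)) \<in> \<A>"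
    and "\<And>x \<epsilon>. x \<in> SX \<Longrightarrow> \<epsilon> > 0 \<Longrightarrow> \<exists>F. finite F \<and> NX (proj (- F) x) < \<epsilon>"
    and "\<And>y \<epsilon>. y \<in> SY \<Longrightarrow> \<epsilon> > 0 \<Longrightarrow> \<exists>F. finite F \<and> NY (proj (- F) y) < \<epsilon>"
  shows "strongly_subdifferentiable
    (completed_projective_tensor (function_space SX NX) (function_space SY NY))"
  unfolding projective_tensor_eq
  by (intro tensors.strongly_subdifferentiable_if_rigid[OF assms(1)] assms(2) join_tails assms(3,4))

theorem projective_tensor_ssd_convex_duals:
  assumes X: "X.convex_dual r" "0 < r" "r < s" "upper_estimate s SY NY"
    and Y: "Y.convex_dual q" "0 < q" "q < p" "upper_estimate p SX NX"
    and tails: "\<And>x \<epsilon>. x \<in> SX \<Longrightarrow> \<epsilon> > 0 \<Longrightarrow> \<exists>F. finite F \<and> NX (proj (- F) x) < \<epsilon>"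
      "\<And>y \<epsilon>. y \<in> SY \<Longrightarrow> \<epsilon> > 0 \<Longrightarrow> \<exists>F. finite F \<and> NY (proj (- F) y) < \<epsilon>"
  shows "strongly_subdifferentiable
    (completed_projective_tensor (function_space SX NX) (function_space SY NY))"
proof (rule projective_tensor_ssd[OF rigid_symmetrized[OF X Y] _ tails])
  fix \<phi>
  assume \<phi>: "tensors.G.contractive \<phi>"
  then have lin: "linear \<phi>" and le: "\<And>v. v \<in> tensors.G \<Longrightarrow> \<bar>\<phi> v\<bar> \<le> tensors.NG v"
    by (auto simp: tensors.G.contractive_def)
  have "bilinear (\<lambda>x y. \<phi> (tens x y))"
    unfolding bilinear_def
  proof (intro conjI ballI allI)
    fix x y
    assume "x \<in> SX" "y \<in> SY"
    then have "cost (tens x y) (NX x * NY y)" by (rule cost_tens)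
    then show "\<bar>\<phi> (tens x y)\<bar> \<le> NX x * NY y"
      using le[of "tens x y"] tensors.NG_le[of "tens x y"] by (fastforce simp: tensors.G_def)
  qed (simp_all add: tens_add_left tens_add_right tens_scaleR_left tens_scaleR_right
      linear_add[OF lin] linear_scale[OF lin])
  moreover have "(\<lambda>z w. \<phi> (sq z w)) = symmetrized (\<lambda>x y. \<phi> (tens x y))"
    by (auto simp: fun_eq_iff symmetrized_def sq_def linear_add[OF lin] linear_scale[OF lin])
  ultimately show "(\<lambda>z w. \<phi> (sq z w)) \<in> {symmetrized A |A. bilinear A}"
    by blast
qed

end

theorem projective_tensor_ssd_complex:
  fixes SX :: "('i \<Rightarrow> complex) set" and SY :: "('j \<Rightarrow> complex) set"
  assumes "function_lattice SX NX" "function_lattice SY NY"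
    and p: "p > 2" "upper_estimate p SX NX" "upper_estimate p SY NY"
    and tails: "\<And>x \<epsilon>. x \<in> SX \<Longrightarrow> \<epsilon> > 0 \<Longrightarrow> \<exists>F. finite F \<and> NX (proj (- F) x) < \<epsilon>"
      "\<And>y \<epsilon>. y \<in> SY \<Longrightarrow> \<epsilon> > 0 \<Longrightarrow> \<exists>F. finite F \<and> NY (proj (- F) y) < \<epsilon>"
  shows "strongly_subdifferentiable
    (completed_projective_tensor (function_space SX NX) (function_space SY NY))"
proof -
  interpret lattice_pair SX NX SY NY using assms by (intro lattice_pair.intro)
  interpret C: complex_upper_lattice join_carrier join_norm p
    by unfold_locales (use p join_upper_estimate in auto)
  show ?thesis
    by (rule projective_tensor_ssd[OF C.rigid_forms _ tails]) (simp add: tensors.form_sq)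
qed

section \<open>Symmetric projective tensor squares of complex lattices\<close>

context complex_upper_lattice
begin

definition tens :: "('i \<Rightarrow> complex) \<Rightarrow> ('i \<Rightarrow> complex) \<Rightarrow> (('i \<Rightarrow> complex) \<Rightarrow> ('i \<Rightarrow> complex) \<Rightarrow> complex) \<Rightarrow> complex" where
  "tens = tensor (function_space S N) (function_space S N)"

lemma tens_add_left: "\<lbrakk>x \<in> S; x' \<in> S; y \<in> S\<rbrakk> \<Longrightarrow> tens (x + x') y = tens x y + tens x' y"
  and tens_add_right: "\<lbrakk>x \<in> S; y \<in> S; y' \<in> S\<rbrakk> \<Longrightarrow> tens x (y + y') = tens x y + tens x y'"
  and tens_smul_left: "\<lbrakk>x \<in> S; y \<in> S\<rbrakk> \<Longrightarrow> tens (smul c x) y = smul c (tens x y)"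
  and tens_smul_right: "\<lbrakk>x \<in> S; y \<in> S\<rbrakk> \<Longrightarrow> tens x (smul c y) = smul c (tens x y)"
  by (auto simp: tens_def tensor_def bilinear_form_def fun_eq_iff)

lemma tens_scaleR_left: "\<lbrakk>x \<in> S; y \<in> S\<rbrakk> \<Longrightarrow> tens (r *\<^sub>R x) y = r *\<^sub>R tens x y"
  and tens_scaleR_right: "\<lbrakk>x \<in> S; y \<in> S\<rbrakk> \<Longrightarrow> tens x (r *\<^sub>R y) = r *\<^sub>R tens x y"
  by (simp_all add: scaleR_eq_smul tens_smul_left tens_smul_right)

definition cost :: "((('i \<Rightarrow> complex) \<Rightarrow> ('i \<Rightarrow> complex) \<Rightarrow> complex) \<Rightarrow> complex) \<Rightarrow> real \<Rightarrow> bool" where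
  "cost u c \<longleftrightarrow> (\<exists>n a x. (\<forall>j<n. x j \<in> S) \<and> u = (\<Sum>j<(n::nat). smul (a j) (tens (x j) (x j))) \<and>
     c = (\<Sum>j<n. norm (a j) * (N (x j))\<^sup>2))"

definition sq :: "('i \<Rightarrow> complex) \<Rightarrow> ('i \<Rightarrow> complex) \<Rightarrow> (('i \<Rightarrow> complex) \<Rightarrow> ('i \<Rightarrow> complex) \<Rightarrow> complex) \<Rightarrow> complex" where
  "sq z w = (1 / 2) *\<^sub>R (tens z w + tens w z)"

lemma sq_self: "sq z z = tens z z"
  by (simp add: sq_def scaleR_2[symmetric])

lemma cost_square: "z \<in> S \<Longrightarrow> cost (tens z z) ((N z)\<^sup>2)"
  unfolding cost_def by (intro exI[of _ 1] exI[of _ "\<lambda>_. 1"] exI[of _ "\<lambda>_. z"]) (auto simp: smul_algebra)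

lemma cost_add:
  assumes "cost u c" "cost v d"
  shows "cost (u + v) (c + d)"
proof -
  obtain n m :: nat and a x a' x' where
    1: "\<forall>j<n. x j \<in> S" "u = (\<Sum>j<n. smul (a j) (tens (x j) (x j)))" "c = (\<Sum>j<n. norm (a j) * (N (x j))\<^sup>2)" and
    2: "\<forall>j<m. x' j \<in> S" "v = (\<Sum>j<m. smul (a' j) (tens (x' j) (x' j)))" "d = (\<Sum>j<m. norm (a' j) * (N (x' j))\<^sup>2)"
    using assms unfolding cost_def by blast
  define X' where "X' j = (if j < n then x j else x' (j - n))" for j
  define A' where "A' j = (if j < n then a j else a' (j - n))" for j
  have "u + v = (\<Sum>j<n + m. smul (A' j) (tens (X' j) (X' j)))"
      "c + d = (\<Sum>j<n + m. norm (A' j) * (N (X' j))\<^sup>2)"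
    unfolding sum_lessThan_add 1 2
    by (intro arg_cong2[of _ _ _ _ "(+)"] sum.cong; simp add: X'_def A'_def)+
  moreover have "\<forall>j<n + m. X' j \<in> S"
    using 1(1) 2(1) by (auto simp: X'_def)
  ultimately show ?thesis
    unfolding cost_def by blast
qed

lemma cost_smul:
  assumes "cost u c"
  shows "cost (smul b u) (norm b * c)"
proof -
  obtain n :: nat and a x where
    1: "\<forall>j<n. x j \<in> S" "u = (\<Sum>j<n. smul (a j) (tens (x j) (x j)))" "c = (\<Sum>j<n. norm (a j) * (N (x j))\<^sup>2)"
    using assms unfolding cost_def by blast
  have "smul b u = (\<Sum>j<n. smul (b * a j) (tens (x j) (x j)))"
    by (auto simp: 1(2) fun_eq_iff sum_fun_apply sum_distrib_left mult.assoc)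
  moreover have "norm b * c = (\<Sum>j<n. norm (b * a j) * (N (x j))\<^sup>2)"
    by (simp add: 1(3) sum_distrib_left norm_mult mult.assoc)
  ultimately show ?thesis
    using 1(1) unfolding cost_def by (intro exI[of _ n] exI[of _ "\<lambda>j. b * a j"] exI[of _ x]) simp
qed

sublocale tensors: square_generated S N cost sq
proof
  show "cost 0 0" unfolding cost_def by (intro exI[of _ 0]) auto
  show "0 \<le> c" if "cost u c" for u c
    using that unfolding cost_def by (auto intro!: sum_nonneg)
  show "\<exists>c. cost (sq z w) c" if zw: "z \<in> S" "w \<in> S" for z w
  proof -
    \<comment> \<open>Polarization, since only squares have a cost by definition.\<close>
    have "sq z w = smul (1 / 2) (tens (z + w) (z + w) + (smul (- 1) (tens z z) + smul (- 1) (tens w w)))"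
      using zw by (auto simp: sq_def tens_add_left tens_add_right add_in fun_eq_iff scaleR_conv_of_real)
    then show ?thesis
      using cost_square[OF zw(1)] cost_square[OF zw(2)] cost_square[OF add_in[OF zw]]
      by (metis cost_add cost_smul)
  qed
  show "\<exists>c\<le>(N z)\<^sup>2. cost (sq z z) c" if "z \<in> S" for z
    using cost_square[OF that] unfolding sq_self by blast
  show "sq z w = sq w z" for z w by (simp add: sq_def add.commute)
  show "sq (z + z') w = sq z w + sq z' w" if "z \<in> S" "z' \<in> S" "w \<in> S" for z z' w
    using that by (simp add: sq_def tens_add_left tens_add_right scaleR_add_right add_ac)
  show "sq (smul b z) w = sq z (smul b w)" if "z \<in> S" "w \<in> S" for z w b
    using that by (simp add: sq_def tens_smul_left tens_smul_right)
  show "sq (r *\<^sub>R z) w = r *\<^sub>R sq z w" if "z \<in> S" "w \<in> S" for z w r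
    using that by (simp add: sq_def tens_scaleR_left tens_scaleR_right scaleR_add_right)
  show "\<exists>(n::nat) z. (\<forall>j<n. z j \<in> S) \<and> u = (\<Sum>j<n. sq (z j) (z j)) \<and> (\<Sum>j<n. (N (z j))\<^sup>2) \<le> c"
    if u: "cost u c" for u c
  proof -
    obtain n :: nat and a x where
      1: "\<forall>j<n. x j \<in> S" "u = (\<Sum>j<n. smul (a j) (tens (x j) (x j)))" "c = (\<Sum>j<n. norm (a j) * (N (x j))\<^sup>2)"
      using u unfolding cost_def by blast
    \<comment> \<open>A complex square root absorbs the coefficient into the vector at no additional
      cost.\<close>
    define z where "z j = smul (csqrt (a j)) (x j)" for j
    have root: "csqrt b * csqrt b = b" for b
      using power2_csqrt[of b] by (simp add: power2_eq_square)
    have "sq (z j) (z j) = smul (a j) (tens (x j) (x j))" if "j < n" for j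
      using 1(1) that unfolding sq_self z_def
      by (simp add: tens_smul_left tens_smul_right smul_in smul_algebra root)
    moreover have "(N (z j))\<^sup>2 = norm (a j) * (N (x j))\<^sup>2" if "j < n" for j
    proof -
      have "(norm (csqrt (a j)))\<^sup>2 = norm (a j)"
        by (metis norm_power power2_csqrt)
      then show ?thesis
        using 1(1) that by (simp add: z_def N_smul power_mult_distrib)
    qed
    moreover have "\<forall>j<n. z j \<in> S" using 1(1) by (auto simp: z_def smul_in)
    ultimately show ?thesis
      unfolding 1(2,3) by (intro exI[of _ n] exI[of _ z]) auto
  qed
qed (fact cost_add cost_smul)+

lemma sym_projective_tensor_eq:
  "sym_projective_tensor (function_space S N) = function_space tensors.G tensors.NG"
proof -
  have rep: "sym_tensor_rep (function_space S N) u n a x \<longleftrightarrow>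
      (\<forall>j<n. x j \<in> S) \<and> u = (\<Sum>j<n. smul (a j) (tens (x j) (x j)))" for u n a x
    unfolding sym_tensor_rep_def tens_def function_space_simps by (auto simp: fun_eq_iff sum_fun_apply)
  show ?thesis
    unfolding sym_projective_tensor_def rep function_space_simps tensors.G_def tensors.NG_def[abs_def] cost_def
    by (intro arg_cong2[of _ _ _ _ function_space] ext arg_cong[of _ _ Inf]) auto
qed

theorem sym_projective_tensor_ssd:
  assumes "\<And>x \<epsilon>. x \<in> S \<Longrightarrow> \<epsilon> > 0 \<Longrightarrow> \<exists>F. finite F \<and> N (proj (- F) x) < \<epsilon>"
  shows "strongly_subdifferentiable (completed_sym_projective_tensor (function_space S N))"
  unfolding sym_projective_tensor_eq
  by (intro tensors.strongly_subdifferentiable_if_rigid[OF rigid_forms] assms) (auto simp: tensors.form_sq)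

end

section \<open>Banach sequence lattices\<close>

lemma sequence_lattice_banach:
  fixes X :: "('k::{real_normed_field,euclidean_space}, nat \<Rightarrow> 'k) normed_structure"
  assumes "banach_sequence_lattice X"
  shows "sequence_lattice (vcarrier X) (vnorm X)"
proof -
  interpret X: banach_sequence_lattice X by fact
  have ops: "vadd X = (+)" "vzero X = 0" "vscale X = smul"
    using X.coordinatewise by (metis function_space_simps)+
  show ?thesis
  proof unfold_locales
    show "single i c \<in> vcarrier X" for i c
      using X.c00_subset by (auto simp: c00_def single_def intro!: set_mp[OF X.c00_subset])
    show "x = 0" if "x \<in> vcarrier X" "vnorm X x = 0" for x
      using X.norm_eq_zero that by (simp add: ops)
  qed (use X.zero_closed X.add_closed X.scale_closed X.norm_triangle X.norm_scale X.solid in \<open>auto simp: ops\<close>)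
qed

lemma c00_dense_tails:
  fixes X :: "('k::{real_normed_field,euclidean_space}, nat \<Rightarrow> 'k) normed_structure"
  assumes X: "banach_sequence_lattice X" "c00_dense X" and x: "x \<in> vcarrier X" and \<epsilon>: "\<epsilon> > 0"
  shows "\<exists>F. finite F \<and> vnorm X (proj (- F) x) < \<epsilon>"
proof -
  interpret X: banach_sequence_lattice X by fact
  interpret L: sequence_lattice "vcarrier X" "vnorm X" by (rule sequence_lattice_banach[OF X(1)])
  obtain y where y: "y \<in> c00" "vnorm X (vdiff X x y) < \<epsilon>"
    using X(2) x \<epsilon> unfolding c00_dense_def by blast
  have diff: "vdiff X x y = x - y"
    using X.coordinatewise by (metis vdiff_function_space)
  \<comment> \<open>Outside its support y vanishes, so the tail of x is dominated there by x - y,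
    and solidity applies.\<close>
  have "norm (proj (- supp y) x k) \<le> norm ((x - y) k)" for k
    by (auto simp: proj_def supp_def)
  moreover have "x - y \<in> vcarrier X"
    using x y X.c00_subset by (intro L.diff_in) auto
  ultimately have "vnorm X (proj (- supp y) x) \<le> vnorm X (x - y)"
    using L.solid by blast
  then show ?thesis
    using y by (intro exI[of _ "supp y"]) (auto simp: diff c00_def supp_def)
qed

text \<open>Supplies for the third statement what density of \<open>c00\<close> supplies for the
  first two.\<close>

lemma convex_dual_tails:
  fixes X :: "('k::{real_normed_field,euclidean_space}, nat \<Rightarrow> 'k) normed_structure"
  assumes X: "banach_sequence_lattice X"
    and conv: "function_seminorm.convex_dual (vcarrier X) (vnorm X) r" "0 \<le> r"
    and x: "x \<in> vcarrier X" and \<epsilon>: "\<epsilon> > 0"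
  shows "\<exists>F. finite F \<and> vnorm X (proj (- F) x) < \<epsilon>"
proof -
  interpret X: banach_sequence_lattice X by fact
  interpret L: sequence_lattice "vcarrier X" "vnorm X" by (rule sequence_lattice_banach[OF X(1)])
  have diff: "vdiff X u v = u - v" for u v
    using X.coordinatewise by (metis vdiff_function_space)
  show ?thesis
  proof (rule L.tails_vanish[OF conv _ x \<epsilon>])
    fix u
    assume "u \<in> L.cauchys"
    then have "cauchy_in X u" by (simp add: L.cauchys_def X.coordinatewise[symmetric])
    then show "\<exists>y\<in>vcarrier X. (\<lambda>n. vnorm X (u n - y)) \<longlonglongrightarrow> 0"
      using X.complete by (simp add: diff)
  qed
qed

text \<open>For the family z, t w of disjoint vectors the coordinatewise p-sum is |z + t w|, so
  convexity bounds the norm by (1 + t^p)^(1/p) <= 1 + t^p.\<close>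

lemma convex_upper_estimate:
  fixes X :: "('k::{real_normed_field,euclidean_space}, nat \<Rightarrow> 'k) normed_structure"
  assumes X: "banach_sequence_lattice X" and conv: "convex_const_one p X"
  shows "upper_estimate p (vcarrier X) (vnorm X)"
  unfolding upper_estimate_def
proof (intro ballI allI impI)
  interpret L: sequence_lattice "vcarrier X" "vnorm X" by (rule sequence_lattice_banach[OF X])
  let ?N = "vnorm X"
  fix z w and t :: real
  assume zw: "z \<in> vcarrier X" "w \<in> vcarrier X"
    and *: "orth z w \<and> ?N z \<le> 1 \<and> ?N w \<le> 1 \<and> 0 \<le> t \<and> t \<le> 1"
  have p: "1 \<le> p" using conv by (simp add: convex_const_one_def)
  define x where "x j = (if j = 0 then z else t *\<^sub>R w)" for j :: nat
  have x: "x j \<in> vcarrier X" for j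
    using zw subspace_scale[OF L.subspace] by (simp add: x_def)
  define y :: "nat \<Rightarrow> 'k" where "y k = of_real ((\<Sum>j<2. norm (x j k) powr p) powr (1 / p))" for k
  have norm_y: "norm (y k) = norm ((z + t *\<^sub>R w) k)" for k
  proof -
    have "norm (x 0 k) powr p + norm (x 1 k) powr p = norm ((z + t *\<^sub>R w) k) powr p"
      using * p by (cases "z k = 0") (auto simp: x_def orth_def)
    then show ?thesis
      using p by (simp add: y_def numeral_2_eq_2 powr_powr)
  qed
  have sum_in: "z + t *\<^sub>R w \<in> vcarrier X" by (rule L.shift_in[OF zw])
  then have "y \<in> vcarrier X" using L.solid[OF sum_in, of y] norm_y by simp
  then have "?N (z + t *\<^sub>R w) \<le> ?N y" using L.solid[of y "z + t *\<^sub>R w"] norm_y by simp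
  also have "\<dots> \<le> (\<Sum>j<2. ?N (x j) powr p) powr (1 / p)"
    using conv x unfolding convex_const_one_def y_def by blast
  also have "\<dots> \<le> (1 + t powr p) powr (1 / p)"
  proof (intro powr_mono2)
    have "?N (t *\<^sub>R w) = t * ?N w" using L.scaleR[OF zw(2), of t] * by simp
    also have "\<dots> \<le> t * 1" using * by (intro mult_left_mono) auto
    finally have "?N (x 1) \<le> t" by (simp add: x_def)
    then have "?N (x 1) powr p \<le> t powr p" using p L.nonneg[OF x] by (intro powr_mono2) auto
    moreover have "?N (x 0) powr p \<le> 1"
      using * p L.nonneg[OF zw(1)] by (intro powr_le1) (auto simp: x_def)
    ultimately show "(\<Sum>j<2. ?N (x j) powr p) \<le> 1 + t powr p" by (simp add: numeral_2_eq_2)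
  qed (use p in \<open>auto intro: sum_nonneg\<close>)
  also have "\<dots> \<le> (1 + t powr p) powr 1"
    using p by (intro powr_mono) auto
  finally show "?N (z + t *\<^sub>R w) \<le> 1 + t powr p" by (simp add: powr_one)
qed

text \<open>The exponents are paired crosswise: the convexity of the dual of X (r) works against the
  upper estimate of Y (s), and that of the dual of Y (q) against the upper estimate of X
  (p).\<close>

lemma projective_tensor_ssd_banach:
  fixes X Y :: "('k::{real_normed_field,euclidean_space}, nat \<Rightarrow> 'k) normed_structure"
  assumes \<rho>: "scalar_part (\<rho> :: 'k \<Rightarrow> real)"
    and X: "banach_sequence_lattice X" "convex_const_one p X" "has_convexity_power_type r (dual_space X)"
    and Y: "banach_sequence_lattice Y" "convex_const_one s Y" "has_convexity_power_type q (dual_space Y)"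
    and exponents: "2 \<le> q" "q < p" "2 \<le> r" "r < s"
  shows "strongly_subdifferentiable (completed_projective_tensor X Y)"
proof -
  interpret X: banach_sequence_lattice X by fact
  interpret Y: banach_sequence_lattice Y by fact
  interpret LX: sequence_lattice "vcarrier X" "vnorm X" by (rule sequence_lattice_banach[OF X(1)])
  interpret LY: sequence_lattice "vcarrier Y" "vnorm Y" by (rule sequence_lattice_banach[OF Y(1)])
  interpret lattice_pair "vcarrier X" "vnorm X" "vcarrier Y" "vnorm Y" by unfold_locales
  note eqX = X.coordinatewise[symmetric] and eqY = Y.coordinatewise[symmetric]
  have dX: "LX.convex_dual r"
    by (rule scalar_part.convex_dual[OF \<rho> LX.function_seminorm_axioms]) (simp only: eqX X(3))
  have dY: "LY.convex_dual q"
    by (rule scalar_part.convex_dual[OF \<rho> LY.function_seminorm_axioms]) (simp only: eqY Y(3))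
  have "strongly_subdifferentiable (completed_projective_tensor
      (function_space (vcarrier X) (vnorm X)) (function_space (vcarrier Y) (vnorm Y)))"
    using exponents
    by (intro projective_tensor_ssd_convex_duals[OF dX _ _ convex_upper_estimate[OF Y(1,2)]
          dY _ _ convex_upper_estimate[OF X(1,2)]]
        convex_dual_tails[OF X(1) dX] convex_dual_tails[OF Y(1) dY]) auto
  then show ?thesis by (simp only: eqX eqY)
qed

theorem corollary6p1:
  shows
    "(\<forall>X :: (complex, nat \<Rightarrow> complex) normed_structure.
        banach_sequence_lattice X \<and> c00_dense X \<and> (\<exists>p>2. convex_const_one p X)
        \<longrightarrow> strongly_subdifferentiable (completed_sym_projective_tensor X))
     \<and>
     (\<forall>(X :: (complex, nat \<Rightarrow> complex) normed_structure)
       (Y :: (complex, nat \<Rightarrow> complex) normed_structure).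
        banach_sequence_lattice X \<and> c00_dense X \<and>
        banach_sequence_lattice Y \<and> c00_dense Y \<and>
        (\<exists>p>2. convex_const_one p X \<and> convex_const_one p Y)
        \<longrightarrow> strongly_subdifferentiable (completed_projective_tensor X Y))
     \<and>
     (\<forall>(X :: (real, nat \<Rightarrow> real) normed_structure)
       (Y :: (real, nat \<Rightarrow> real) normed_structure) p q r s.
        banach_sequence_lattice X \<and> banach_sequence_lattice Y \<and>
        convex_const_one p X \<and> convex_const_one s Y \<and>
        has_convexity_power_type q (dual_space Y) \<and> 2 \<le> q \<and> q < p \<and>
        has_convexity_power_type r (dual_space X) \<and> 2 \<le> r \<and> r < s
        \<longrightarrow> strongly_subdifferentiable (completed_projective_tensor X Y))
     \<and>
     (\<forall>(X :: (complex, nat \<Rightarrow> complex) normed_structure)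
       (Y :: (complex, nat \<Rightarrow> complex) normed_structure) p q r s.
        banach_sequence_lattice X \<and> banach_sequence_lattice Y \<and>
        convex_const_one p X \<and> convex_const_one s Y \<and>
        has_convexity_power_type q (dual_space Y) \<and> 2 \<le> q \<and> q < p \<and>
        has_convexity_power_type r (dual_space X) \<and> 2 \<le> r \<and> r < s
        \<longrightarrow> strongly_subdifferentiable (completed_projective_tensor X Y))"
proof (intro conjI allI impI; (elim conjE exE)?)
  fix X :: "(complex, nat \<Rightarrow> complex) normed_structure" and p :: real
  assume X: "banach_sequence_lattice X" "c00_dense X" and p: "2 < p" "convex_const_one p X"
  interpret X: banach_sequence_lattice X by fact
  interpret L: sequence_lattice "vcarrier X" "vnorm X" by (rule sequence_lattice_banach[OF X(1)])
  interpret complex_upper_lattice "vcarrier X" "vnorm X" p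
    by unfold_locales (use p convex_upper_estimate[OF X(1)] in auto)
  have "strongly_subdifferentiable
      (completed_sym_projective_tensor (function_space (vcarrier X) (vnorm X)))"
    by (intro sym_projective_tensor_ssd c00_dense_tails[OF X])
  then show "strongly_subdifferentiable (completed_sym_projective_tensor X)"
    by (simp only: X.coordinatewise[symmetric])
next
  fix X Y :: "(complex, nat \<Rightarrow> complex) normed_structure" and p :: real
  assume X: "banach_sequence_lattice X" "c00_dense X" and Y: "banach_sequence_lattice Y" "c00_dense Y"
    and p: "2 < p" "convex_const_one p X" "convex_const_one p Y"
  interpret X: banach_sequence_lattice X by fact
  interpret Y: banach_sequence_lattice Y by fact
  interpret LX: sequence_lattice "vcarrier X" "vnorm X" by (rule sequence_lattice_banach[OF X(1)])
  interpret LY: sequence_lattice "vcarrier Y" "vnorm Y" by (rule sequence_lattice_banach[OF Y(1)])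
  have "strongly_subdifferentiable (completed_projective_tensor
      (function_space (vcarrier X) (vnorm X)) (function_space (vcarrier Y) (vnorm Y)))"
    by (intro projective_tensor_ssd_complex[OF LX.function_lattice_axioms LY.function_lattice_axioms p(1)]
        convex_upper_estimate X(1) Y(1) p c00_dense_tails[OF X] c00_dense_tails[OF Y])
  then show "strongly_subdifferentiable (completed_projective_tensor X Y)"
    by (simp only: X.coordinatewise[symmetric] Y.coordinatewise[symmetric])
qed (blast intro: projective_tensor_ssd_banach[OF scalar_part_real]
    projective_tensor_ssd_banach[OF scalar_part_complex])+

end
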